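(* For any infinite cardinality $\kappa$, there is an $\widetilde{A_2}$ group for which the number of vertices in the link of a vertex (of the building on which it acts) is $\kappa$.
   Context: An $\widetilde{A_2}$ group is a group acting simply transitively, and in a type-rotating manner, on the vertices of a thick (two-dimensional Euclidean) building of type $\widetilde{A_2}$. The vertices of such a building have types in $\mathbb{Z}/3$, and an automorphism is type-rotating if there is $c\in\mathbb{Z}/3$ such that it maps every vertex of type $i$ to a vertex of type $i+c$. Local finiteness of the building is not required. *)

theory Defs
  imports Main "HOL-Algebra.Group_Action" "HOL-Library.Numeral_Type"
begin

unbundle cardinal_syntax

text \<open>
  A simplicial complex is given by the set of its simplices, each of which is a finite set of
  vertices; the empty simplex belongs to every nonempty complex.
\<close>

definition simplicial_complex :: "'v set set \<Rightarrow> bool" where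
  "simplicial_complex \<Delta> \<longleftrightarrow> (\<forall>A\<in>\<Delta>. finite A \<and> (\<forall>B. B \<subseteq> A \<longrightarrow> B \<in> \<Delta>))"

abbreviation vertices :: "'v set set \<Rightarrow> 'v set" where
  "vertices \<Delta> \<equiv> \<Union>\<Delta>"

definition link :: "'v set set \<Rightarrow> 'v \<Rightarrow> 'v set set" where
  "link \<Delta> v = {A. v \<notin> A \<and> insert v A \<in> \<Delta>}"

definition complex_iso :: "('v \<Rightarrow> 'w) \<Rightarrow> 'v set set \<Rightarrow> 'w set set \<Rightarrow> bool" where
  "complex_iso f \<Delta> \<Delta>' \<longleftrightarrow>
     bij_betw f (vertices \<Delta>) (vertices \<Delta>') \<and> (\<lambda>A. f ` A) ` \<Delta> = \<Delta>'"

text \<open>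
  The Coxeter complex of type \<open>A\<^sub>2\<close>-tilde is the tessellation of the Euclidean plane by equilateral
  triangles. The pair \<open>(a, b)\<close> stands for the point \<open>a + b \<omega>\<close> of the complex plane, where
  \<open>\<omega> = exp (i \<pi> / 3)\<close>; the two families of triangles below are the two orientations of the tiles
  of side length 1.
\<close>

definition A2_tilde_coxeter_complex :: "(int \<times> int) set set" where
  "A2_tilde_coxeter_complex =
     {A. \<exists>a b. A \<subseteq> {(a, b), (a + 1, b), (a, b + 1)} \<or>
               A \<subseteq> {(a + 1, b + 1), (a + 1, b), (a, b + 1)}}"

text \<open>
  Buildings in the sense of Tits, defined through some system of apartments \<open>\<A>\<close>. Requiring
  \<open>\<A> \<noteq> {}\<close> excludes the empty complex.
\<close>

definition A2_tilde_building :: "'v set set \<Rightarrow> bool" where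
  "A2_tilde_building \<Delta> \<longleftrightarrow> simplicial_complex \<Delta> \<and>
     (\<exists>\<A>. \<A> \<noteq> {} \<and> \<Delta> = \<Union>\<A> \<and>
        (\<forall>\<Sigma>\<in>\<A>. \<exists>f. complex_iso f A2_tilde_coxeter_complex \<Sigma>) \<and>
        (\<forall>A\<in>\<Delta>. \<forall>B\<in>\<Delta>. \<exists>\<Sigma>\<in>\<A>. A \<in> \<Sigma> \<and> B \<in> \<Sigma>) \<and>
        (\<forall>\<Sigma>\<in>\<A>. \<forall>\<Sigma>'\<in>\<A>. \<forall>A\<in>\<Sigma> \<inter> \<Sigma>'. \<forall>B\<in>\<Sigma> \<inter> \<Sigma>'.
           \<exists>f. complex_iso f \<Sigma> \<Sigma>' \<and> (\<forall>x\<in>A \<union> B. f x = x)))"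

text \<open>
  Apartments being tessellated planes, the chambers are the simplices with three vertices and the
  panels those with two. Thickness asks for at least three (possibly infinitely many) chambers on
  every panel; \<open>3 \<le> card\<close> of all such chambers would fail for infinitely many.
\<close>

definition thick :: "'v set set \<Rightarrow> bool" where
  "thick \<Delta> \<longleftrightarrow>
     (\<forall>P\<in>\<Delta>. card P = 2 \<longrightarrow> (\<exists>T. T \<subseteq> {C \<in> \<Delta>. card C = 3 \<and> P \<subseteq> C} \<and> card T = 3))"

text \<open>
  A type function takes values in \<open>\<int>/3\<close>, here the numeral type \<open>3\<close>, and gives the vertices of each
  chamber distinct types. It is unique up to a permutation of \<open>\<int>/3\<close>, and every such permutation is
  affine, so being type-rotating does not depend on the choice of the type function.
\<close>

definition type_function :: "'v set set \<Rightarrow> ('v \<Rightarrow> 3) \<Rightarrow> bool" where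
  "type_function \<Delta> \<tau> \<longleftrightarrow> (\<forall>A\<in>\<Delta>. inj_on \<tau> A)"

definition type_rotating :: "'v set set \<Rightarrow> ('v \<Rightarrow> 3) \<Rightarrow> ('v \<Rightarrow> 'v) \<Rightarrow> bool" where
  "type_rotating \<Delta> \<tau> f \<longleftrightarrow> (\<exists>c. \<forall>v\<in>vertices \<Delta>. \<tau> (f v) = \<tau> v + c)"

text \<open>
  \<open>A2_tilde_group G \<Delta> \<phi>\<close>: the group \<open>G\<close> is an \<open>A\<^sub>2\<close>-tilde group by virtue of its action \<open>\<phi>\<close> on the
  building \<open>\<Delta>\<close>.
\<close>

definition A2_tilde_group ::
    "('g, 'm) monoid_scheme \<Rightarrow> 'v set set \<Rightarrow> ('g \<Rightarrow> 'v \<Rightarrow> 'v) \<Rightarrow> bool" where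
  "A2_tilde_group G \<Delta> \<phi> \<longleftrightarrow>
     group G \<and> A2_tilde_building \<Delta> \<and> thick \<Delta> \<and>
     group_action G (vertices \<Delta>) \<phi> \<and>
     (\<forall>g\<in>carrier G. complex_iso (\<phi> g) \<Delta> \<Delta>) \<and>
     (\<forall>v\<in>vertices \<Delta>. \<forall>w\<in>vertices \<Delta>. \<exists>!g. g \<in> carrier G \<and> \<phi> g v = w) \<and>
     (\<exists>\<tau>. type_function \<Delta> \<tau> \<and> (\<forall>g\<in>carrier G. type_rotating \<Delta> \<tau> (\<phi> g)))"

end

theory Submission
  imports Defs Complex_Main "HOL-Library.Poly_Mapping" "HOL-Computational_Algebra.Formal_Laurent_Series"
    "HOL-Computational_Algebra.Polynomial_FPS" "HOL-Computational_Algebra.Fraction_Field"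
begin

text \<open>
  Let \<open>K / k\<close> be a cyclic cubic extension with Galois generator \<open>\<sigma>\<close> and characteristic different
  from 3, such that \<open>K\<close> and \<open>K\<^sup>* / k\<^sup>*\<close> have cardinality \<open>\<kappa>\<close>, and put \<open>s = 1 - X\<close>. The skew polynomial ring
  \<open>K[z; \<sigma>]\<close> acts \<open>k((X))\<close>-linearly on \<open>K((X))\<close> by \<open>z f = s \<sigma>(f)\<close>; its central element \<open>t = 1 - z\<^sup>3\<close>
  acts as the scalar \<open>1 - s\<^sup>3\<close>, which is \<open>X\<close> times a unit. The homothety classes of lattices of
  the three-dimensional \<open>k((X))\<close>-space \<open>K((X))\<close> are the vertices of a building. The skew polynomials
  with constant term 1 dividing a power of \<open>t\<close> form, modulo powers of \<open>t\<close>, a group acting simply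
  transitively on them. Transitivity: by Hilbert 90, the maximal sublattices of \<open>K[[X]]\<close> above
  \<open>X K[[X]]\<close> are its images under the elements \<open>1 + c z\<close> with \<open>c \<sigma>(c) \<sigma>\<^sup>2(c) = -1\<close>, and these divide \<open>t\<close>.
  Freeness: up to a power of \<open>t\<close>, an element fixing the class of \<open>K[[X]]\<close> is a unit of
  \<open>K[z; \<sigma>]\<close> with constant term 1. The link of \<open>K[[X]]\<close> contains the classes of
  \<open>k b + X K[[X]]\<close> for \<open>b\<close> in \<open>K\<^sup>* / k\<^sup>*\<close>, and there are only \<open>\<kappa>\<close> skew polynomials, so it
  has \<open>\<kappa>\<close> elements.

  Two periodic lattice chains \<open>L\<close>, \<open>M\<close> lie in a common apartment: let \<open>\<pi> i\<close> be the last \<open>j\<close> for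
  which \<open>M\<^sub>j\<close> meets \<open>L\<^sub>i - L\<^sub>i\<^sub>+\<^sub>1\<close>, in \<open>e\<^sub>i\<close> say. Then \<open>\<pi>\<close> is a permutation of \<open>\<int>\<close>, and the
  \<open>e\<^sub>i\<close> form a basis adapted to both chains.
\<close>

unbundle fps_syntax

section \<open>Lattices over a power series ring\<close>

text \<open>The statement asks for vertices in \<open>'k\<close>, while the Laurent series here have
  coefficients in a field containing the complex numbers. So \<open>K\<close>, its subfield k and
  all lattices are subsets of ambient types, and only at the end are building and group carried into
  \<open>'k\<close>, along an injection of the vertices.

  The operator z meets several demands at once. With z f = \<sigma>(f) the central element 1 - z^3
  would act as 0. The factor s = 1 - X makes it a uniformizer of k((X)), keeps z congruent to
  \<sigma> modulo X, and is transcendental over the constants, which makes the action faithful.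
  Characteristic 3 is excluded because 1 - s^3 = 3 X - 3 X^2 + X^3 must have valuation 1, and
  because additive Hilbert 90 is solved by a division by 3. Nonzero constants of \<open>K\<close>
  fix the class of K[[X]]; prescribing constant term 1 removes all of them but 1.

  K((X)) may have more than \<kappa> elements, so vertices cannot be counted by counting lattice
  bases; it is transitivity that bounds their number. Conversely the link is large only if
  \<open>K\<close> has many lines over k, which is why the quotient of the multiplicative groups
  must be large and not just \<open>K\<close>.\<close>

definition Xp :: "int \<Rightarrow> 'a::field fls" where
  "Xp n = fls_shift (- n) 1"

lemma Xp_0 [simp]: "Xp 0 = 1"
  by (simp add: Xp_def)

lemma Xp_add: "Xp (m + n) = Xp m * Xp n"
  by (simp add: Xp_def fls_X_intpow_times_fls_X_intpow)

lemma Xp_nonzero [simp]: "Xp n \<noteq> 0"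
  by (simp add: Xp_def)

lemma Xp_nth [simp]: "(Xp n * f) $$ m = f $$ (m - n)"
  by (simp add: Xp_def fls_X_intpow_times_conv_shift)

lemma Xp_nth_eq: "Xp n $$ m = (if m = n then 1 else 0)"
  by (simp add: Xp_def)

lemma Xp_mult_Xp: "Xp m * (Xp n * f) = Xp (m + n) * f"
  by (simp add: Xp_add mult.assoc)

lemma Xp_cancel [simp]: "Xp n * (Xp (- n) * f) = f" "Xp (- n) * (Xp n * f) = f"
  by (simp_all add: Xp_mult_Xp)

definition sc :: "int \<Rightarrow> 'a::field fls set \<Rightarrow> 'a fls set" where
  "sc n L = (*) (Xp n) ` L"

lemma mem_sc: "x \<in> sc n L \<longleftrightarrow> Xp (- n) * x \<in> L"
proof
  assume "Xp (- n) * x \<in> L"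
  then have "Xp n * (Xp (- n) * x) \<in> sc n L"
    unfolding sc_def by blast
  then show "x \<in> sc n L" by simp
qed (auto simp: sc_def)

lemma sc_sc [simp]: "sc m (sc n L) = sc (m + n) L"
  by (simp add: sc_def image_image Xp_mult_Xp)

lemma sc_0 [simp]: "sc 0 L = L"
  by (simp add: sc_def)

lemma sc_mono: "L \<subseteq> M \<Longrightarrow> sc n L \<subseteq> sc n M"
  by (auto simp: sc_def)

lemma sc_inj [simp]: "sc n L = sc n M \<longleftrightarrow> L = M"
  using inj_image_eq_iff[of "(*) (Xp n)" L M] by (simp add: sc_def inj_def)

text \<open>A unit of the power series ring maps a module to itself, so scaling by powers of X
  already produces the full homothety class of a lattice.\<close>

definition cls :: "'a::field fls set \<Rightarrow> 'a fls set set" where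
  "cls L = range (\<lambda>n. sc n L)"

lemma mem_cls: "L \<in> cls L"
  using rangeI[of "\<lambda>n. sc n L" 0] by (simp add: cls_def)

lemma cls_eq_iff: "cls L = cls M \<longleftrightarrow> (\<exists>n. M = sc n L)"
proof
  assume "cls L = cls M"
  then have "M \<in> cls L" using mem_cls by blast
  then show "\<exists>n. M = sc n L" by (auto simp: cls_def)
next
  assume "\<exists>n. M = sc n L"
  then obtain n where M: "M = sc n L" by blast
  have *: "cls (sc n L) \<subseteq> cls L" for n and L :: "'a fls set"
    by (auto simp: cls_def)
  show "cls L = cls M"
    using *[of n L] *[of "- n" M] by (simp add: M)
qed

lemma cls_sc [simp]: "cls (sc n L) = cls L"
  unfolding cls_eq_iff by (rule exI[of _ "- n"]) simp

section \<open>Laurent series with coefficients in a subfield, and modules over its power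
  series\<close>

locale subfield_of =
  fixes k :: "'a::field set"
  assumes zero_mem [simp]: "0 \<in> k" and one_mem [simp]: "1 \<in> k"
    and add_mem [simp]: "a \<in> k \<Longrightarrow> b \<in> k \<Longrightarrow> a + b \<in> k"
    and uminus_mem [simp]: "a \<in> k \<Longrightarrow> - a \<in> k"
    and mult_mem [simp]: "a \<in> k \<Longrightarrow> b \<in> k \<Longrightarrow> a * b \<in> k"
    and inverse_mem [simp]: "a \<in> k \<Longrightarrow> inverse a \<in> k"
begin

lemma diff_mem [simp]: "a \<in> k \<Longrightarrow> b \<in> k \<Longrightarrow> a - b \<in> k"
  using add_mem[of a "- b"] by simp

lemma divide_mem [simp]: "a \<in> k \<Longrightarrow> b \<in> k \<Longrightarrow> a / b \<in> k"
  by (simp add: divide_inverse)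

lemma sum_mem: "(\<And>i. i \<in> A \<Longrightarrow> f i \<in> k) \<Longrightarrow> sum f A \<in> k"
  by (induction A rule: infinite_finite_induct) auto

text \<open>\<open>F\<close> is k((X)) and \<open>R\<close> below is k[[X]], both inside the Laurent
  series over the ambient field.\<close>

definition F :: "'a fls set" where "F = {f. \<forall>n. f $$ n \<in> k}"

definition R :: "'a fls set" where "R = {f \<in> F. \<forall>n<0. f $$ n = 0}"

lemma F_add [simp]: "f \<in> F \<Longrightarrow> g \<in> F \<Longrightarrow> f + g \<in> F"
  by (simp add: F_def)
lemma F_uminus [simp]: "f \<in> F \<Longrightarrow> - f \<in> F"
  by (simp add: F_def)
lemma F_diff [simp]: "f \<in> F \<Longrightarrow> g \<in> F \<Longrightarrow> f - g \<in> F"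
  by (simp add: F_def)
lemma F_mult [simp]: "f \<in> F \<Longrightarrow> g \<in> F \<Longrightarrow> f * g \<in> F"
  by (auto simp: F_def fls_times_nth(1) intro!: sum_mem)
lemma F_0 [simp]: "0 \<in> F" by (simp add: F_def)
lemma F_const [simp]: "c \<in> k \<Longrightarrow> fls_const c \<in> F" by (simp add: F_def)
lemma F_1 [simp]: "1 \<in> F" by (simp add: F_def)
lemma F_Xp [simp]: "Xp n \<in> F" by (simp add: F_def Xp_nth_eq)
lemma F_Xp_mult [simp]: "Xp n * f \<in> F \<longleftrightarrow> f \<in> F"
proof
  assume "Xp n * f \<in> F"
  then have "Xp (- n) * (Xp n * f) \<in> F" by (rule F_mult[OF F_Xp])
  then show "f \<in> F" by simp
qed (rule F_mult[OF F_Xp])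

lemma R_imp_F: "f \<in> R \<Longrightarrow> f \<in> F" by (simp add: R_def)
lemma R_add [simp]: "f \<in> R \<Longrightarrow> g \<in> R \<Longrightarrow> f + g \<in> R"
  by (simp add: R_def)
lemma R_uminus [simp]: "f \<in> R \<Longrightarrow> - f \<in> R"
  by (simp add: R_def)
lemma R_diff [simp]: "f \<in> R \<Longrightarrow> g \<in> R \<Longrightarrow> f - g \<in> R"
  by (simp add: R_def)
lemma R_mult [simp]: assumes "f \<in> R" "g \<in> R" shows "f * g \<in> R"
proof -
  have "(f * g) $$ n = 0" if "n < 0" for n
  proof -
    have "f $$ i * g $$ (n - i) = 0" for i
      using assms that by (cases "i < 0") (auto simp: R_def)
    then show ?thesis unfolding fls_times_nth(2) by (intro sum.neutral) blast
  qed
  then show ?thesis using assms by (simp add: R_def)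
qed
lemma R_0 [simp]: "0 \<in> R" by (simp add: R_def)
lemma R_const [simp]: "c \<in> k \<Longrightarrow> fls_const c \<in> R" by (simp add: R_def)
lemma R_1 [simp]: "1 \<in> R" by (simp add: R_def)
lemma R_Xp [simp]: "0 \<le> n \<Longrightarrow> Xp n \<in> R"
  by (auto simp: R_def Xp_nth_eq)
lemma R_Xp_1: assumes "f \<in> R" "f $$ 0 = 0" shows "Xp (- 1) * f \<in> R"
proof -
  have "f $$ (n + 1) = 0" if "n < 0" for n
    using assms that by (cases "n + 1 = 0") (auto simp: R_def)
  then show ?thesis using assms(1) by (simp add: R_def)
qed

lemma F_clear: assumes "f \<in> F" shows "\<exists>n\<ge>0. \<forall>m\<ge>n. Xp m * f \<in> R"
proof -
  obtain n where n: "\<And>i. i < n \<Longrightarrow> f $$ i = 0"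
    by (meson fls_eq0_below_subdegree)
  have "Xp m * f \<in> R" if "m \<ge> max 0 (- n)" for m
    using assms that n by (auto simp: R_def)
  then show ?thesis by (meson max.cobounded1)
qed

definition omod :: "'a fls set \<Rightarrow> bool" where
  "omod L \<longleftrightarrow> 0 \<in> L \<and> (\<forall>x\<in>L. \<forall>y\<in>L. x + y \<in> L) \<and> (\<forall>c\<in>R. \<forall>x\<in>L. c * x \<in> L)"

lemma omodD: assumes "omod L"
  shows "0 \<in> L" "x \<in> L \<Longrightarrow> y \<in> L \<Longrightarrow> x + y \<in> L" "c \<in> R \<Longrightarrow> x \<in> L \<Longrightarrow> c * x \<in> L"
    "x \<in> L \<Longrightarrow> - x \<in> L" "x \<in> L \<Longrightarrow> y \<in> L \<Longrightarrow> x - y \<in> L"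
proof -
  show add: "x \<in> L \<Longrightarrow> y \<in> L \<Longrightarrow> x + y \<in> L" for x y using assms by (simp add: omod_def)
  show minus: "- x \<in> L" if "x \<in> L" for x
  proof -
    have "- 1 * x \<in> L" using assms R_uminus[OF R_1] that unfolding omod_def by blast
    then show ?thesis by simp
  qed
  show "x - y \<in> L" if "x \<in> L" "y \<in> L"
    using add[OF that(1) minus[OF that(2)]] by simp
qed (use assms in \<open>simp_all add: omod_def\<close>)

lemma omod_sc: "omod L \<Longrightarrow> omod (sc n L)"
  unfolding omod_def Ball_def mem_sc by (simp add: distrib_left mult.left_commute)

lemma omod_sc_subset: assumes "omod L" "0 \<le> n" shows "sc n L \<subseteq> L"
  using omodD(3)[OF assms(1) R_Xp[OF assms(2)]] by (auto simp: sc_def)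

definition B :: "'a fls \<Rightarrow> 'a fls \<Rightarrow> 'a fls \<Rightarrow> 'a fls set" where
  "B x y z = {f * x + g * y + h * z | f g h. f \<in> R \<and> g \<in> R \<and> h \<in> R}"

lemma BI: "f \<in> R \<Longrightarrow> g \<in> R \<Longrightarrow> h \<in> R \<Longrightarrow> f * x + g * y + h * z \<in> B x y z"
  by (auto simp: B_def)

lemma BE: assumes "v \<in> B x y z"
  obtains f g h where "f \<in> R" "g \<in> R" "h \<in> R" "v = f * x + g * y + h * z"
  using assms by (auto simp: B_def)

lemma omod_B: "omod (B x y z)"
  unfolding omod_def
proof (intro conjI ballI)
  show "0 \<in> B x y z" using BI[of 0 0 0 x y z] by simp
next
  fix u v assume "u \<in> B x y z" "v \<in> B x y z"
  then obtain f g h f' g' h' where "f \<in> R" "g \<in> R" "h \<in> R" "u = f * x + g * y + h * z"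
    "f' \<in> R" "g' \<in> R" "h' \<in> R" "v = f' * x + g' * y + h' * z" by (metis BE)
  then show "u + v \<in> B x y z"
    using BI[of "f + f'" "g + g'" "h + h'" x y z] by (simp add: algebra_simps)
next
  fix c v assume "c \<in> R" "v \<in> B x y z"
  then obtain f g h where "f \<in> R" "g \<in> R" "h \<in> R" "v = f * x + g * y + h * z" by (metis BE)
  then show "c * v \<in> B x y z"
    using BI[of "c * f" "c * g" "c * h" x y z] \<open>c \<in> R\<close> by (simp add: algebra_simps)
qed

lemma B_least: "omod L \<Longrightarrow> x \<in> L \<Longrightarrow> y \<in> L \<Longrightarrow> z \<in> L \<Longrightarrow> B x y z \<subseteq> L"
  by (auto simp: B_def intro!: omodD)

lemma B_mem [simp]: "x \<in> B x y z" "y \<in> B x y z" "z \<in> B x y z"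
  using BI[of 1 0 0 x y z] BI[of 0 1 0 x y z] BI[of 0 0 1 x y z] by auto

lemma B_swap: "B y x z = B x y z"
  by (simp add: set_eq_subset B_least omod_B)

lemma B_cyc: "B y z x = B x y z"
  by (simp add: set_eq_subset B_least omod_B)

lemma sc_B: "sc n (B x y z) = B (Xp n * x) (Xp n * y) (Xp n * z)"
proof
  show "sc n (B x y z) \<subseteq> B (Xp n * x) (Xp n * y) (Xp n * z)"
  proof
    fix v assume "v \<in> sc n (B x y z)"
    then obtain f g h where *: "f \<in> R" "g \<in> R" "h \<in> R" "v = Xp n * (f * x + g * y + h * z)"
      unfolding sc_def by (metis BE imageE)
    then show "v \<in> B (Xp n * x) (Xp n * y) (Xp n * z)"
      using BI[OF *(1-3), of "Xp n * x" "Xp n * y" "Xp n * z"] by (simp add: algebra_simps)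
  qed
  show "B (Xp n * x) (Xp n * y) (Xp n * z) \<subseteq> sc n (B x y z)"
    by (rule B_least) (simp_all add: omod_B omod_sc mem_sc)
qed

lemma B_scale_subset:
  assumes "a' \<le> a" "b' \<le> b" "c' \<le> c"
  shows "B (Xp a * x) (Xp b * y) (Xp c * z) \<subseteq> B (Xp a' * x) (Xp b' * y) (Xp c' * z)"
proof (rule B_least[OF omod_B])
  have *: "Xp a * x = Xp (a - a') * (Xp a' * x)" "Xp b * y = Xp (b - b') * (Xp b' * y)"
    "Xp c * z = Xp (c - c') * (Xp c' * z)" by (simp_all add: Xp_mult_Xp)
  show "Xp a * x \<in> B (Xp a' * x) (Xp b' * y) (Xp c' * z)"
    "Xp b * y \<in> B (Xp a' * x) (Xp b' * y) (Xp c' * z)"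
    "Xp c * z \<in> B (Xp a' * x) (Xp b' * y) (Xp c' * z)"
    unfolding * using assms by (simp_all add: omodD(3)[OF omod_B] del: Xp_cancel)
qed

definition indep :: "'a fls \<Rightarrow> 'a fls \<Rightarrow> 'a fls \<Rightarrow> bool" where
  "indep x y z \<longleftrightarrow> (\<forall>f\<in>F. \<forall>g\<in>F. \<forall>h\<in>F. f * x + g * y + h * z = 0 \<longrightarrow> f = 0 \<and> g = 0 \<and> h = 0)"

lemma indep_swap: "indep x y z \<Longrightarrow> indep y x z"
  unfolding indep_def by (metis add.commute)

lemma indep_cyc: "indep x y z \<Longrightarrow> indep y z x"
  unfolding indep_def by (metis add.commute add.assoc)

lemma indep_scale: assumes "indep x y z" shows "indep (Xp a * x) (Xp b * y) (Xp c * z)"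
  unfolding indep_def
proof (intro ballI impI)
  fix f g h assume *: "f \<in> F" "g \<in> F" "h \<in> F" "f * (Xp a * x) + g * (Xp b * y) + h * (Xp c * z) = 0"
  have "f * Xp a * x + g * Xp b * y + h * Xp c * z = 0" using *(4) by (simp add: mult.assoc)
  then have "f * Xp a = 0 \<and> g * Xp b = 0 \<and> h * Xp c = 0"
    using assms *(1-3) F_mult F_Xp unfolding indep_def by blast
  then show "f = 0 \<and> g = 0 \<and> h = 0" by simp
qed

lemma indep_eq:
  assumes "indep x y z" "f \<in> F" "g \<in> F" "h \<in> F" "f' \<in> F" "g' \<in> F" "h' \<in> F"
    "f * x + g * y + h * z = f' * x + g' * y + h' * z"
  shows "f = f'" "g = g'" "h = h'"
proof -
  have "(f - f') * x + (g - g') * y + (h - h') * z = 0"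
    using assms(8) by (simp add: algebra_simps)
  then have "f - f' = 0 \<and> g - g' = 0 \<and> h - h' = 0"
    using assms(1-7) F_diff unfolding indep_def by blast
  then show "f = f'" "g = g'" "h = h'" by auto
qed

end

section \<open>Frames and apartments\<close>

lemma complex_iso_comp:
  assumes "complex_iso f A C" "complex_iso g C D" shows "complex_iso (g \<circ> f) A D"
proof -
  have "(\<lambda>E. (g \<circ> f) ` E) ` A = (\<lambda>E. g ` E) ` ((\<lambda>E. f ` E) ` A)"
    by (simp add: image_comp comp_def)
  moreover have "bij_betw (g \<circ> f) (vertices A) (vertices D)"
    using assms unfolding complex_iso_def by (intro bij_betw_trans[of f]) auto
  ultimately show ?thesis using assms unfolding complex_iso_def by simp
qed

abbreviation Cox :: "(int \<times> int) set set" where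
  "Cox \<equiv> A2_tilde_coxeter_complex"

text \<open>\<open>V\<close> is a reference module, later K[[X]]. Being a lattice is expressed by
  commensurability with \<open>V\<close> (\<open>bounded\<close>), which takes the place of
  statements about dimension and finite generation.\<close>

locale lattices = subfield_of k for k :: "'a::field set" +
  fixes V :: "'a fls set"
  assumes omod_V: "omod V" and V_nonneg: "f \<in> V \<Longrightarrow> n < 0 \<Longrightarrow> f $$ n = 0"
begin

definition bounded :: "'a fls set \<Rightarrow> bool" where
  "bounded L \<longleftrightarrow> (\<exists>n. sc n V \<subseteq> L \<and> L \<subseteq> sc (- n) V)"

lemma sc_V_mono: "m \<le> n \<Longrightarrow> sc n V \<subseteq> sc m V"
  using sc_mono[OF omod_sc_subset[OF omod_V, of "n - m"], of m] by simp

lemma boundedI: assumes "sc m V \<subseteq> L" "L \<subseteq> sc n V" shows "bounded L"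
proof -
  have "sc (max m (- n)) V \<subseteq> sc m V" "sc n V \<subseteq> sc (- max m (- n)) V"
    by (auto intro!: sc_V_mono)
  then show ?thesis using assms unfolding bounded_def by blast
qed

lemma bounded_between: assumes "bounded L" "sc a L \<subseteq> M" "M \<subseteq> sc b L" shows "bounded M"
proof -
  obtain n where "sc n V \<subseteq> L" "L \<subseteq> sc (- n) V" using assms(1) by (auto simp: bounded_def)
  then have "sc a (sc n V) \<subseteq> M" "M \<subseteq> sc b (sc (- n) V)"
    using assms(2,3) sc_mono by (meson subset_trans)+
  then show ?thesis by (intro boundedI) simp_all
qed

lemma bounded_absorb: assumes "bounded L" "bounded M" shows "\<exists>n\<ge>0. \<forall>m\<ge>n. sc m L \<subseteq> M"
proof -
  obtain a where a: "L \<subseteq> sc (- a) V" using assms(1) by (auto simp: bounded_def)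
  obtain b where b: "sc b V \<subseteq> M" using assms(2) by (auto simp: bounded_def)
  have "sc m L \<subseteq> M" if "m \<ge> max 0 (a + b)" for m
  proof -
    have "sc m L \<subseteq> sc (m - a) V" using sc_mono[OF a, of m] by simp
    also have "\<dots> \<subseteq> sc b V" using that by (intro sc_V_mono) simp
    finally show ?thesis using b by blast
  qed
  then show ?thesis by (meson max.cobounded1)
qed

text \<open>If L lies in \<open>X^(-a) V\<close>, an element of \<open>X^n L\<close> has no
  coefficients below n - a. This lets a series expansion be identified with its sum without a
  topology.\<close>

lemma bounded_separated: assumes "bounded L" "\<And>n::nat. v \<in> sc (int n) L" shows "v = 0"
proof (rule fls_eqI)
  obtain a where a: "L \<subseteq> sc (- a) V" using assms(1) by (auto simp: bounded_def)
  fix m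
  define n where "n = nat (m + a + 1)"
  have "v \<in> sc (int n) (sc (- a) V)" using assms(2)[of n] sc_mono[OF a] by blast
  then have *: "Xp (a - int n) * v \<in> V" by (simp add: mem_sc)
  have "(Xp (a - int n) * v) $$ (m + a - int n) = 0"
    by (rule V_nonneg[OF *]) (simp add: n_def)
  then show "v $$ m = 0 $$ m" by simp
qed

text \<open>Boundedness makes the span commensurable with \<open>V\<close>, so a frame is a basis
  over \<open>F\<close> of the space spanned by \<open>V\<close>; no dimension has to be
  mentioned.\<close>

definition frame :: "'a fls \<Rightarrow> 'a fls \<Rightarrow> 'a fls \<Rightarrow> bool" where
  "frame x y z \<longleftrightarrow> indep x y z \<and> bounded (B x y z)"

lemma frame_swap: "frame x y z \<Longrightarrow> frame y x z"
  by (simp add: frame_def indep_swap B_swap)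

lemma frame_cyc: "frame x y z \<Longrightarrow> frame y z x"
  by (simp add: frame_def indep_cyc B_cyc)

lemma frame_scale: assumes "frame x y z" shows "frame (Xp a * x) (Xp b * y) (Xp c * z)"
proof -
  define m where "m = max a (max b c)"
  define n where "n = min a (min b c)"
  have "sc m (B x y z) \<subseteq> B (Xp a * x) (Xp b * y) (Xp c * z)"
    unfolding sc_B by (rule B_scale_subset) (auto simp: m_def)
  moreover have "B (Xp a * x) (Xp b * y) (Xp c * z) \<subseteq> sc n (B x y z)"
    unfolding sc_B by (rule B_scale_subset) (auto simp: n_def)
  ultimately show ?thesis using assms bounded_between indep_scale by (auto simp: frame_def)
qed

lemma frame_scale1: "frame x y z \<Longrightarrow> frame (Xp a * x) y z"
  using frame_scale[of x y z a 0 0] by simp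

text \<open>Change of frame by a monomial matrix whose entries are powers of \<open>X\<close>.\<close>

inductive monomial :: "'a fls \<Rightarrow> 'a fls \<Rightarrow> 'a fls \<Rightarrow> 'a fls \<Rightarrow> 'a fls \<Rightarrow> 'a fls \<Rightarrow> bool"
  for x y z where
  monomial_refl: "monomial x y z x y z"
| monomial_swap: "monomial x y z u v w \<Longrightarrow> monomial x y z v u w"
| monomial_cyc: "monomial x y z u v w \<Longrightarrow> monomial x y z v w u"
| monomial_scale: "monomial x y z u v w \<Longrightarrow> monomial x y z (Xp a * u) (Xp b * v) (Xp c * w)"

lemma monomial_frame: "monomial x y z u v w \<Longrightarrow> frame x y z \<Longrightarrow> frame u v w"
  by (induction rule: monomial.induct) (auto intro: frame_swap frame_cyc frame_scale)

text \<open>Multiplying the basis vectors by X one after the other gives a chain from a lattice L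
  down to X L with three steps; the classes in it form a maximal simplex.\<close>

definition chamber :: "'a fls \<Rightarrow> 'a fls \<Rightarrow> 'a fls \<Rightarrow> 'a fls set set set" where
  "chamber x y z = {cls (B x y z), cls (B (Xp 1 * x) y z), cls (B (Xp 1 * x) (Xp 1 * y) z)}"

definition building :: "'a fls set set set set" where
  "building = {A. \<exists>x y z. frame x y z \<and> A \<subseteq> chamber x y z}"

text \<open>The coordinates make the triangle \<open>{(0, 0), (1, 0), (0, 1)}\<close> the chamber of the frame.\<close>

definition apt_point :: "'a fls \<Rightarrow> 'a fls \<Rightarrow> 'a fls \<Rightarrow> int \<times> int \<Rightarrow> 'a fls set set" where
  "apt_point x y z = (\<lambda>(p, q). cls (B (Xp (p + q) * x) (Xp q * y) z))"

definition apartment :: "'a fls \<Rightarrow> 'a fls \<Rightarrow> 'a fls \<Rightarrow> 'a fls set set set set" where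
  "apartment x y z = (\<lambda>A. apt_point x y z ` A) ` Cox"

lemma cls_B_scale:
  "cls (B (Xp a * x) (Xp b * y) (Xp c * z)) = apt_point x y z (a - b, b - c)"
proof -
  have "sc (- c) (B (Xp a * x) (Xp b * y) (Xp c * z)) = B (Xp (a - c) * x) (Xp (b - c) * y) z"
    by (simp add: sc_B Xp_mult_Xp)
  then have "cls (B (Xp a * x) (Xp b * y) (Xp c * z)) = cls (B (Xp (a - c) * x) (Xp (b - c) * y) z)"
    by (metis cls_sc)
  then show ?thesis by (simp add: apt_point_def)
qed

lemma apt_point_eq: "apt_point x y z (p, q) = cls (B (Xp (p + q) * x) (Xp q * y) z)"
  by (simp add: apt_point_def)

abbreviation up :: "int \<Rightarrow> int \<Rightarrow> (int \<times> int) set" where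
  "up a b \<equiv> {(a, b), (a + 1, b), (a, b + 1)}"

abbreviation down :: "int \<Rightarrow> int \<Rightarrow> (int \<times> int) set" where
  "down a b \<equiv> {(a + 1, b + 1), (a + 1, b), (a, b + 1)}"

lemma coxeterI:
  "A \<subseteq> up a b \<Longrightarrow> A \<in> Cox"
  "A \<subseteq> down a b \<Longrightarrow> A \<in> Cox"
  unfolding A2_tilde_coxeter_complex_def by blast+

lemma coxeterE:
  assumes "A \<in> Cox"
  obtains a b where "A \<subseteq> up a b" | a b where "A \<subseteq> down a b"
  using assms unfolding A2_tilde_coxeter_complex_def by blast

lemma coxeter_image:
  assumes "A \<in> Cox"
    "\<And>a b. g ` up a b \<in> Cox" "\<And>a b. g ` down a b \<in> Cox"
  shows "g ` A \<in> Cox"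
proof -
  have down: "C \<in> Cox \<Longrightarrow> D \<subseteq> C \<Longrightarrow> D \<in> Cox" for C D
    unfolding A2_tilde_coxeter_complex_def mem_Collect_eq by (meson subset_trans)
  from assms(1) show ?thesis
    by (rule coxeterE) (rule down[OF assms(2)] down[OF assms(3)], erule image_mono)+
qed

text \<open>If two coordinate maps differ by an automorphism \<open>g\<close> of the tessellation,
  they have the same simplices as images. It is applied to a reflection, a rotation of order three
  and the translations, which is how transpositions, cyclic shifts and scalings of a frame act on
  coordinates.\<close>

lemma apartment_reparametrize:
  assumes gh: "g \<circ> h = id" and eq: "apt_point u v w = apt_point x y z \<circ> g"
    and g: "\<And>a b. g ` up a b \<in> Cox" "\<And>a b. g ` down a b \<in> Cox"
    and h: "\<And>a b. h ` up a b \<in> Cox" "\<And>a b. h ` down a b \<in> Cox"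
  shows "apartment u v w = apartment x y z"
proof -
  have "(\<lambda>A. g ` A) ` Cox = Cox"
  proof
    show "(\<lambda>A. g ` A) ` Cox \<subseteq> Cox"
      using coxeter_image[OF _ g] by blast
    show "Cox \<subseteq> (\<lambda>A. g ` A) ` Cox"
    proof
      fix A assume A: "A \<in> Cox"
      have "A = g ` (h ` A)" using gh by (simp add: image_comp)
      then show "A \<in> (\<lambda>A. g ` A) ` Cox" using coxeter_image[OF A h] by (rule image_eqI)
    qed
  qed
  then have "apartment x y z = (\<lambda>A. apt_point x y z ` A) ` (\<lambda>A. g ` A) ` Cox"
    by (simp add: apartment_def)
  also have "\<dots> = apartment u v w"
    by (simp add: apartment_def eq image_comp image_image)
  finally show ?thesis by simp
qed

lemma apartment_swap: "apartment y x z = apartment x y z"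
proof (rule apartment_reparametrize)
  let ?g = "\<lambda>(p, q). (- p, p + q) :: int \<times> int"
  show "?g \<circ> ?g = id" by (simp add: fun_eq_iff)
  show "apt_point y x z = apt_point x y z \<circ> ?g"
    using B_swap[of "Xp (p + q) * y" "Xp q * x" z for p q] by (simp add: apt_point_eq fun_eq_iff)
  fix a b :: int
  show "?g ` up a b \<in> Cox" "?g ` up a b \<in> Cox"
    by (rule coxeterI(2)[of _ "- a - 1" "a + b"]; auto)+
  show "?g ` down a b \<in> Cox" "?g ` down a b \<in> Cox"
    by (rule coxeterI(1)[of _ "- a - 1" "a + b + 1"]; auto)+
qed

lemma apartment_cyc: "apartment y z x = apartment x y z"
proof (rule apartment_reparametrize)
  let ?g = "\<lambda>(p, q). (- p - q, p) :: int \<times> int"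
  let ?h = "\<lambda>(p, q). (q, - p - q) :: int \<times> int"
  show "?g \<circ> ?h = id" by (simp add: fun_eq_iff)
  show "apt_point y z x = apt_point x y z \<circ> ?g"
  proof
    fix c :: "int \<times> int" obtain p q where c: "c = (p, q)" by force
    have "apt_point y z x c = cls (B (Xp 0 * x) (Xp (p + q) * y) (Xp q * z))"
      using B_cyc[of "Xp (p + q) * y" "Xp q * z" x] by (simp add: c apt_point_eq)
    also have "\<dots> = (apt_point x y z \<circ> ?g) c" unfolding cls_B_scale by (simp add: c)
    finally show "apt_point y z x c = (apt_point x y z \<circ> ?g) c" .
  qed
  fix a b :: int
  show "?g ` up a b \<in> Cox" by (rule coxeterI(1)[of _ "- a - b - 1" a]) auto
  show "?g ` down a b \<in> Cox" by (rule coxeterI(2)[of _ "- a - b - 2" a]) auto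
  show "?h ` up a b \<in> Cox" by (rule coxeterI(1)[of _ b "- a - b - 1"]) auto
  show "?h ` down a b \<in> Cox" by (rule coxeterI(2)[of _ b "- a - b - 2"]) auto
qed

lemma apartment_scale: "apartment (Xp a * x) (Xp b * y) (Xp c * z) = apartment x y z"
proof (rule apartment_reparametrize)
  let ?g = "\<lambda>(p, q). (p + (a - b), q + (b - c)) :: int \<times> int"
  let ?h = "\<lambda>(p, q). (p - (a - b), q - (b - c)) :: int \<times> int"
  show "?g \<circ> ?h = id" by (simp add: fun_eq_iff)
  show "apt_point (Xp a * x) (Xp b * y) (Xp c * z) = apt_point x y z \<circ> ?g"
  proof
    fix d :: "int \<times> int" obtain p q where d: "d = (p, q)" by force
    have "apt_point (Xp a * x) (Xp b * y) (Xp c * z) d = cls (B (Xp (p + q + a) * x) (Xp (q + b) * y) (Xp c * z))"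
      by (simp add: d apt_point_eq Xp_mult_Xp)
    also have "\<dots> = (apt_point x y z \<circ> ?g) d" unfolding cls_B_scale by (simp add: d algebra_simps)
    finally show "apt_point (Xp a * x) (Xp b * y) (Xp c * z) d = (apt_point x y z \<circ> ?g) d" .
  qed
  fix p q :: int
  show "?g ` up p q \<in> Cox" by (rule coxeterI(1)[of _ "p + (a - b)" "q + (b - c)"]) auto
  show "?g ` down p q \<in> Cox" by (rule coxeterI(2)[of _ "p + (a - b)" "q + (b - c)"]) auto
  show "?h ` up p q \<in> Cox" by (rule coxeterI(1)[of _ "p - (a - b)" "q - (b - c)"]) auto
  show "?h ` down p q \<in> Cox" by (rule coxeterI(2)[of _ "p - (a - b)" "q - (b - c)"]) auto
qed

lemma monomial_apartment: "monomial x y z u v w \<Longrightarrow> apartment u v w = apartment x y z"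
proof (induction rule: monomial.induct)
  case (monomial_swap u v w)
  then show ?case using apartment_swap[of v u w] by simp
next
  case (monomial_cyc u v w)
  then show ?case using apartment_cyc[of v w u] by simp
next
  case (monomial_scale u v w a b c)
  then show ?case using apartment_scale[of a u b v c w] by simp
qed simp

lemma chamber_eq_apt_point: "chamber x y z = apt_point x y z ` {(0, 0), (1, 0), (0, 1)}"
  by (simp add: chamber_def apt_point_eq)

lemma sub_chamber_in_apartment: "A \<subseteq> chamber x y z \<Longrightarrow> A \<in> apartment x y z"
proof -
  assume "A \<subseteq> chamber x y z"
  then obtain C where C: "C \<subseteq> {(0, 0), (1, 0), (0, 1)}" "A = apt_point x y z ` C"
    unfolding chamber_eq_apt_point subset_image_iff by blast
  then have "C \<in> Cox" using coxeterI(1)[of C 0 0] by simp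
  then show ?thesis using C(2) by (auto simp: apartment_def)
qed

lemma apartment_chamber:
  assumes "A \<in> apartment x y z"
  obtains u v w where "monomial x y z u v w" "A \<subseteq> chamber u v w"
proof -
  obtain C where C: "C \<in> Cox" "A = apt_point x y z ` C"
    using assms by (auto simp: apartment_def)
  from C(1) show ?thesis
  proof (cases rule: coxeterE)
    case (1 p q)
    have "chamber (Xp (p + q) * x) (Xp q * y) z = apt_point x y z ` up p q"
      by (simp add: chamber_def apt_point_eq Xp_mult_Xp add_ac)
    then have "A \<subseteq> chamber (Xp (p + q) * x) (Xp q * y) z" using 1 C(2) by blast
    moreover have "monomial x y z (Xp (p + q) * x) (Xp q * y) z"
      using monomial_scale[OF monomial_refl, of x y z "p + q" q 0] by simp
    ultimately show ?thesis using that by blast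
  next
    case (2 p q)
    \<comment> \<open>Exchanging the first two vectors turns over the orientation of the tile. The
      exponent p + q + 1 makes (p + 1, q) the first vertex; the other two are (p, q + 1) and (p + 1,
      q + 1).\<close>
    have "chamber (Xp q * y) (Xp (p + q + 1) * x) z = apt_point x y z ` down p q"
      by (simp add: chamber_def apt_point_eq Xp_mult_Xp B_swap[of "Xp a * x" "Xp b * y" z for a b] add_ac insert_commute)
    then have "A \<subseteq> chamber (Xp q * y) (Xp (p + q + 1) * x) z" using 2 C(2) by blast
    moreover have "monomial x y z (Xp q * y) (Xp (p + q + 1) * x) z"
      using monomial_scale[OF monomial_swap[OF monomial_refl], of x y z q "p + q + 1" 0] by simp
    ultimately show ?thesis using that by blast
  qed
qed

lemma apartment_sub_building: "frame x y z \<Longrightarrow> apartment x y z \<subseteq> building"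
  using monomial_frame by (auto simp: building_def elim!: apartment_chamber) blast

text \<open>
  Two frames with the same chamber and the same vertices in the same order give any common vertex
  the same coordinates; this is what makes the isomorphisms between apartments fix it.
\<close>

definition same_chain where
  "same_chain x y z x' y' z' \<longleftrightarrow> B x y z = B x' y' z' \<and> B (Xp 1 * x) y z = B (Xp 1 * x') y' z' \<and>
     B (Xp 1 * x) (Xp 1 * y) z = B (Xp 1 * x') (Xp 1 * y') z'"

lemma same_chain_chamber: "same_chain x y z x' y' z' \<Longrightarrow> chamber x y z = chamber x' y' z'"
  by (simp add: same_chain_def chamber_def)

lemma same_chain_sym: "same_chain x y z x' y' z' \<Longrightarrow> same_chain x' y' z' x y z"
  by (simp add: same_chain_def)

lemma same_chain_trans:
  "same_chain x y z x' y' z' \<Longrightarrow> same_chain x' y' z' u v w \<Longrightarrow> same_chain x y z u v w"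
  by (simp add: same_chain_def)

text \<open>Moving one step down the periodic chain. With this shift, a claim about the first
  exponent yields the claims about the other two.\<close>

lemma same_chain_cyc: assumes "same_chain x y z x' y' z'"
  shows "same_chain y z (Xp 1 * x) y' z' (Xp 1 * x')"
proof -
  have 1: "B y z (Xp 1 * x) = B (Xp 1 * x) y z" for x y z
    by (rule B_cyc)
  have 2: "B (Xp 1 * y) z (Xp 1 * x) = B (Xp 1 * x) (Xp 1 * y) z" for x y z
    by (rule B_cyc)
  have 3: "B (Xp 1 * y) (Xp 1 * z) (Xp 1 * x) = sc 1 (B x y z)" for x y z
    unfolding sc_B by (rule B_cyc)
  show ?thesis
    using assms unfolding same_chain_def 1[of y z x] 1[of y' z' x'] 2[of y z x] 2[of y' z' x'] 3[of y z x] 3[of y' z' x']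
    by simp
qed

lemma mem_B_small_coeff:
  assumes ind: "indep x y z" and m: "m \<in> B (Xp a * x) (Xp b * y) (Xp c * z)" "m \<in> B x y z" and "1 \<le> a"
  shows "m \<in> B (Xp 1 * x) y z"
proof -
  obtain f g h where 1: "f \<in> R" "g \<in> R" "h \<in> R" "m = f * (Xp a * x) + g * (Xp b * y) + h * (Xp c * z)"
    using m(1) by (rule BE)
  obtain f' g' h' where 2: "f' \<in> R" "g' \<in> R" "h' \<in> R" "m = f' * x + g' * y + h' * z"
    using m(2) by (rule BE)
  have "(f * Xp a) * x + (g * Xp b) * y + (h * Xp c) * z = f' * x + g' * y + h' * z"
    using 1(4) 2(4) by (simp add: algebra_simps)
  then have "f * Xp a = f'"
    using indep_eq(1)[OF ind, of "f * Xp a" "g * Xp b" "h * Xp c" f' g' h'] 1(1-3) 2(1-3) R_imp_F F_mult F_Xp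
    by blast
  moreover have "Xp a = Xp (a - 1) * Xp 1" using Xp_add[of "a - 1" 1] by simp
  ultimately have "f' = f * (Xp (a - 1) * Xp 1)" by metis
  then have "m = (f * Xp (a - 1)) * (Xp 1 * x) + g' * y + h' * z" using 2(4) by (simp add: mult.assoc)
  then show ?thesis using 1(1) 2(2,3) \<open>1 \<le> a\<close> by (simp add: BI)
qed

lemma not_mem_B: assumes "indep x y z" shows "x \<notin> B (Xp 1 * x) y z"
proof
  assume "x \<in> B (Xp 1 * x) y z"
  then obtain f g h where *: "f \<in> R" "g \<in> R" "h \<in> R" "x = f * (Xp 1 * x) + g * y + h * z" by (rule BE)
  have "1 * x + 0 * y + 0 * z = (f * Xp 1) * x + g * y + h * z" using *(4) by (simp add: mult.assoc)
  then have "1 = f * Xp 1"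
    using indep_eq(1)[OF assms, of 1 0 0 "f * Xp 1" g h] *(1-3) R_imp_F F_mult F_Xp F_1 F_0 by blast
  then have "(1::'a fls) $$ 0 = (Xp 1 * f) $$ 0" by (simp add: mult.commute)
  moreover have "f $$ (- 1) = 0" using *(1) by (simp add: R_def)
  ultimately show False by simp
qed

text \<open>After scaling back by \<open>X^a\<close> the common lattice contains x. If a' exceeded
  a, the x'-coordinate of x would be divisible by X, so x would already lie in the second lattice of
  the common chain, which it does not.\<close>

lemma same_chain_coeff_le:
  assumes "frame x y z" "frame x' y' z'" "same_chain x y z x' y' z'"
    "B (Xp a * x) (Xp b * y) (Xp c * z) = B (Xp a' * x') (Xp b' * y') (Xp c' * z')"
  shows "a' \<le> a"
proof (rule ccontr)
  assume "\<not> a' \<le> a"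
  have "x \<in> sc (- a) (B (Xp a * x) (Xp b * y) (Xp c * z))"
    by (simp add: mem_sc)
  then have "x \<in> B (Xp (a' - a) * x') (Xp (b' - a) * y') (Xp (c' - a) * z')"
    unfolding assms(4) by (simp add: sc_B Xp_mult_Xp)
  moreover have "x \<in> B x' y' z'" using assms(3) B_mem(1)[of x y z] by (simp add: same_chain_def)
  ultimately have "x \<in> B (Xp 1 * x') y' z'"
    using mem_B_small_coeff assms(2) \<open>\<not> a' \<le> a\<close> by (auto simp: frame_def)
  then show False using assms(1,3) not_mem_B[of x y z] by (simp add: same_chain_def frame_def)
qed

lemma same_chain_coeff:
  assumes "frame x y z" "frame x' y' z'" "same_chain x y z x' y' z'"
    "B (Xp a * x) (Xp b * y) (Xp c * z) = B (Xp a' * x') (Xp b' * y') (Xp c' * z')"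
  shows "a = a'" "b = b'" "c = c'"
proof -
  have 1: "a = a'"
    if "frame x y z" "frame x' y' z'" "same_chain x y z x' y' z'"
      "B (Xp a * x) (Xp b * y) (Xp c * z) = B (Xp a' * x') (Xp b' * y') (Xp c' * z')"
    for a b c a' b' c' x y z x' y' z'
    using same_chain_coeff_le[OF that] same_chain_coeff_le[OF that(2,1) same_chain_sym[OF that(3)] that(4)[symmetric]]
    by simp
  have 2: "frame y z (Xp 1 * x)" if "frame x y z" for x y z
    using frame_cyc[OF frame_scale1[OF that]] .
  have 3: "B (Xp b * y) (Xp c * z) (Xp (a - 1) * (Xp 1 * x)) = B (Xp a * x) (Xp b * y) (Xp c * z)" for a b c x y z
    using B_cyc[of "Xp b * y" "Xp c * z" "Xp a * x"] by (simp add: Xp_mult_Xp)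
  show "a = a'" using 1[OF assms] .
  show "b = b'" by (rule 1[OF 2 2 same_chain_cyc, of x y z x' y' z' b c "a - 1" b' c' "a' - 1"])
      (use assms 3 in auto)
  show "c = c'"
    by (rule 1[OF 2[OF 2] 2[OF 2] same_chain_cyc[OF same_chain_cyc], of x y z x' y' z' c "a - 1" "b - 1" c' "a' - 1" "b' - 1"])
      (use assms 3 in auto)
qed

lemma same_chain_refl: "same_chain x y z x y z"
  by (simp add: same_chain_def)

lemma same_chain_apt_point:
  assumes "frame x y z" "frame x' y' z'" "same_chain x y z x' y' z'" "apt_point x y z c = apt_point x' y' z' d"
  shows "c = d"
proof -
  obtain p q where c: "c = (p, q)" by force
  obtain p' q' where d: "d = (p', q')" by force
  obtain n where n: "B (Xp (p' + q') * x') (Xp q' * y') z' = sc n (B (Xp (p + q) * x) (Xp q * y) z)"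
    using assms(4) unfolding c d apt_point_eq cls_eq_iff by blast
  \<comment> \<open>The exponent of the third vector is n on the left and 0 on the right, so
    comparing exponents also removes the unknown homothety.\<close>
  have "B (Xp (n + (p + q)) * x) (Xp (n + q) * y) (Xp n * z) = B (Xp (p' + q') * x') (Xp q' * y') (Xp 0 * z')"
    using n by (simp add: sc_B Xp_mult_Xp)
  from same_chain_coeff[OF assms(1-3) this] show ?thesis by (simp add: c d)
qed

lemma inj_apt_point: "frame x y z \<Longrightarrow> inj (apt_point x y z)"
  using same_chain_apt_point[OF _ _ same_chain_refl] by (auto simp: inj_def)

lemma vertices_coxeter: "vertices Cox = UNIV"
proof -
  have "c \<in> vertices Cox" for c
    using coxeterI(1)[of "{c}" "fst c" "snd c"] by (cases c) auto
  then show ?thesis by blast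
qed

lemma vertices_apartment: "vertices (apartment x y z) = range (apt_point x y z)"
proof -
  have "vertices (apartment x y z) = apt_point x y z ` vertices Cox"
    by (auto simp: apartment_def)
  then show ?thesis by (simp add: vertices_coxeter)
qed

lemma complex_iso_apt_point: "frame x y z \<Longrightarrow> complex_iso (apt_point x y z) Cox (apartment x y z)"
  unfolding complex_iso_def vertices_coxeter vertices_apartment bij_betw_def using inj_apt_point by (simp add: apartment_def)

lemma apartment_iso_fix:
  assumes fr: "frame x y z" "frame x' y' z'" and ch: "same_chain x y z x' y' z'"
  shows "\<exists>f. complex_iso f (apartment x y z) (apartment x' y' z') \<and>
    (\<forall>v \<in> vertices (apartment x y z) \<inter> vertices (apartment x' y' z'). f v = v)"
proof -
  define f where "f = apt_point x' y' z' \<circ> inv_into UNIV (apt_point x y z)"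
  have f: "f (apt_point x y z c) = apt_point x' y' z' c" for c
    using inj_apt_point[OF fr(1)] by (simp add: f_def)
  have "(\<lambda>A. f ` A) ` apartment x y z = apartment x' y' z'"
    unfolding apartment_def image_image by (simp add: f)
  moreover have "bij_betw f (range (apt_point x y z)) (range (apt_point x' y' z'))"
  proof (rule bij_betw_imageI)
    show "inj_on f (range (apt_point x y z))"
      using inj_apt_point[OF fr(2)] by (auto simp: inj_on_def f inj_def)
    show "f ` range (apt_point x y z) = range (apt_point x' y' z')" by (simp add: image_image f)
  qed
  moreover have "f v = v" if v: "v \<in> range (apt_point x y z)" "v \<in> range (apt_point x' y' z')" for v
  proof -
    obtain c d where *: "v = apt_point x y z c" "v = apt_point x' y' z' d" using v by blast
    then have "c = d" using same_chain_apt_point[OF fr ch] by simp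
    then show ?thesis using * f by simp
  qed
  ultimately show ?thesis unfolding complex_iso_def vertices_apartment by (intro exI[of _ f]) auto
qed

section \<open>Apartments through two chambers\<close>

text \<open>A complete periodic chain of lattices. The last clause says that each quotient of
  consecutive members is at most a line over k, and strictness of the inclusions makes it exactly a
  line.\<close>

definition lchain :: "(int \<Rightarrow> 'a fls set) \<Rightarrow> bool" where
  "lchain L \<longleftrightarrow> (\<forall>i. omod (L i)) \<and> (\<forall>i. L (i + 1) \<subset> L i) \<and> (\<forall>i. L (i + 3) = sc 1 (L i)) \<and>
     bounded (L 0) \<and>
     (\<forall>i. \<forall>x \<in> L i - L (i + 1). \<forall>y \<in> L i. \<exists>c\<in>k. y - fls_const c * x \<in> L (i + 1))"

lemma chnD:
  assumes "lchain L"
  shows "omod (L i)" "L (i + 1) \<subset> L i" "L (i + 3) = sc 1 (L i)" "bounded (L 0)"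
    "x \<in> L i \<Longrightarrow> x \<notin> L (i + 1) \<Longrightarrow> y \<in> L i \<Longrightarrow> \<exists>c\<in>k. y - fls_const c * x \<in> L (i + 1)"
  using assms by (auto simp: lchain_def)

lemma lchain_shift3: assumes "lchain L" shows "L (i + 3 * n) = sc n (L i)"
proof (induction n rule: int_induct[of _ 0])
  case (step1 n)
  have "L (i + 3 * (n + 1)) = L (i + 3 * n + 3)" by (simp add: algebra_simps)
  then show ?case using step1 chnD(3)[OF assms, of "i + 3 * n"] by (simp add: add.commute)
next
  case (step2 n)
  have "L (i + 3 * n) = L (i + 3 * (n - 1) + 3)" by (simp add: algebra_simps)
  then have "sc 1 (L (i + 3 * (n - 1))) = sc n (L i)"
    using step2 chnD(3)[OF assms, of "i + 3 * (n - 1)"] by simp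
  also have "\<dots> = sc 1 (sc (n - 1) (L i))" by simp
  finally show ?case by (simp only: sc_inj)
qed simp

lemma lchain_antimono: assumes "lchain L" "i \<le> j" shows "L j \<subseteq> L i"
  using assms(2)
proof (induction j rule: int_ge_induct)
  case (step j)
  then show ?case using chnD(2)[OF assms(1), of j] by blast
qed simp

lemma lchain_bounded: assumes "lchain L" shows "bounded (L i)"
proof -
  have "L (0 + 3 * (i div 3 + 1)) \<subseteq> L i" "L i \<subseteq> L (0 + 3 * (i div 3))"
    by (auto intro!: lchain_antimono[OF assms])
  then show ?thesis
    unfolding lchain_shift3[OF assms] by (rule bounded_between[OF chnD(4)[OF assms]])
qed

lemma lchain_shift: assumes "lchain L" shows "lchain (\<lambda>n. L (i + n))"
  using assms lchain_bounded[OF assms, of i] unfolding lchain_def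
  by (simp add: add.assoc[symmetric])

definition periodic :: "(int \<Rightarrow> 'a fls) \<Rightarrow> bool" where
  "periodic e \<longleftrightarrow> (\<forall>i. e (i + 3) = Xp 1 * e i)"

lemma periodic_shift3: assumes "periodic e" shows "e (i + 3 * n) = Xp n * e i"
proof (induction n rule: int_induct[of _ 0])
  case (step1 n)
  have "e (i + 3 * (n + 1)) = e (i + 3 * n + 3)" by (simp add: algebra_simps)
  also have "\<dots> = Xp 1 * e (i + 3 * n)" using assms unfolding periodic_def by blast
  also have "\<dots> = Xp (n + 1) * e i" by (simp add: step1 Xp_mult_Xp add.commute)
  finally show ?case .
next
  case (step2 n)
  have "Xp 1 * e (i + 3 * (n - 1)) = e (i + 3 * (n - 1) + 3)" using assms unfolding periodic_def by metis
  also have "\<dots> = e (i + 3 * n)" by (simp add: algebra_simps)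
  also have "\<dots> = Xp 1 * (Xp (n - 1) * e i)" by (simp add: step2 Xp_mult_Xp)
  finally show ?case by simp
qed simp

definition window :: "(int \<Rightarrow> 'a fls) \<Rightarrow> int \<Rightarrow> 'a fls set" where
  "window e i = B (e i) (e (i + 1)) (e (i + 2))"

lemma B_step: "B y z (Xp 1 * x) = B (Xp 1 * x) y z"
  by (rule B_cyc)

text \<open>The class of an element modulo the smaller lattice is the constant term of its
  x-coefficient, so a quotient of constant terms gives \<open>c\<close>.\<close>

lemma B_cover:
  assumes "v \<in> B x y z" "v \<notin> B (Xp 1 * x) y z" "u \<in> B x y z"
  shows "\<exists>c\<in>k. u - fls_const c * v \<in> B (Xp 1 * x) y z"
proof -
  have vanish: "f * x + g * y + h * z \<in> B (Xp 1 * x) y z"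
    if "f \<in> R" "g \<in> R" "h \<in> R" "f $$ 0 = 0" for f g h
  proof -
    have "(Xp (- 1) * f) * (Xp 1 * x) + g * y + h * z \<in> B (Xp 1 * x) y z"
      using that R_Xp_1 by (intro BI) auto
    moreover have "(Xp (- 1) * f) * (Xp 1 * x) = f * x"
      using Xp_cancel(2)[of 1 "f * x"] by (simp only: ac_simps)
    ultimately show ?thesis by simp
  qed
  obtain f g h where v: "f \<in> R" "g \<in> R" "h \<in> R" "v = f * x + g * y + h * z"
    using assms(1) by (rule BE)
  obtain f' g' h' where u: "f' \<in> R" "g' \<in> R" "h' \<in> R" "u = f' * x + g' * y + h' * z"
    using assms(3) by (rule BE)
  have nz: "f $$ 0 \<noteq> 0" using vanish[OF v(1-3)] v(4) assms(2) by auto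
  define c where "c = f' $$ 0 / f $$ 0"
  have c: "c \<in> k" using u(1) v(1) by (auto simp: c_def R_def F_def)
  have "(f' - fls_const c * f) * x + (g' - fls_const c * g) * y + (h' - fls_const c * h) * z \<in> B (Xp 1 * x) y z"
    using c u v nz by (intro vanish) (auto simp: c_def)
  then have "u - fls_const c * v \<in> B (Xp 1 * x) y z"
    by (simp add: u(4) v(4) algebra_simps)
  then show ?thesis using c by blast
qed

lemma frame_shift: assumes "periodic e" "frame (e 0) (e 1) (e 2)" shows "frame (e i) (e (i + 1)) (e (i + 2))"
proof (induction i rule: int_induct[of _ 0])
  case (step1 i)
  have "frame (e (i + 1)) (e (i + 2)) (Xp 1 * e i)"
    using frame_cyc[OF frame_scale1[OF step1(2)]] .
  then show ?case using assms(1) by (simp add: periodic_def add.assoc)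
next
  case (step2 i)
  have "e (i + 2) = Xp 1 * e (i - 1)" using assms(1)[unfolded periodic_def, rule_format, of "i - 1"] by (simp add: add.commute)
  then have "frame (e (i - 1)) (e i) (e (i + 1))"
    using frame_scale1[OF frame_cyc[OF frame_cyc[OF step2(2)]], of "- 1"] by simp
  then show ?case by (simp add: add.commute)
qed (use assms in simp)

lemma lchain_window: assumes "periodic e" "frame (e 0) (e 1) (e 2)" shows "lchain (window e)"
proof -
  have periodic: "e (i + 3) = Xp 1 * e i" for i using assms(1) by (simp add: periodic_def)
  have next': "window e (i + 1) = B (Xp 1 * e i) (e (i + 1)) (e (i + 2))" for i
    using B_step[of "e (i + 1)" "e (i + 2)" "e i"] periodic[of i] by (simp add: window_def add.assoc)
  have sub: "window e (i + 1) \<subset> window e i" for i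
  proof
    show "window e (i + 1) \<subseteq> window e i"
      unfolding next' unfolding window_def using B_scale_subset[of 0 1 0 0 0 0 "e i" "e (i + 1)" "e (i + 2)"] by simp
    show "window e (i + 1) \<noteq> window e i"
      using not_mem_B[of "e i" "e (i + 1)" "e (i + 2)"] frame_shift[OF assms, of i] B_mem(1)
      unfolding next' unfolding window_def frame_def by metis
  qed
  have 3: "window e (i + 3) = sc 1 (window e i)" for i
    using periodic[of i] periodic[of "i + 1"] periodic[of "i + 2"] by (simp add: window_def sc_B algebra_simps)
  have cov: "\<exists>c\<in>k. y - fls_const c * x \<in> window e (i + 1)"
    if "x \<in> window e i - window e (i + 1)" "y \<in> window e i" for x y i
    using that unfolding next' unfolding window_def by (intro B_cover) auto
  have "bounded (window e 0)" using assms(2) by (simp add: frame_def window_def)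
  then show ?thesis unfolding lchain_def using sub 3 cov omod_B by (auto simp: window_def)
qed

text \<open>X sends \<open>L i\<close> into \<open>L (i + 3)\<close>, hence into
  \<open>L (i + 1)\<close>, so a power series acts on the quotient through its constant term, and a
  nonzero constant is invertible there.\<close>

lemma lead_zero:
  assumes L: "lchain L" and e: "e \<in> L i" "e \<notin> L (i + 1)" and f: "f \<in> R" "f * e \<in> L (i + 1)"
  shows "f $$ 0 = 0"
proof (rule ccontr)
  assume nz: "f $$ 0 \<noteq> 0"
  define c where "c = f $$ 0"
  have c: "c \<in> k" using f(1) by (simp add: R_def F_def c_def)
  define g where "g = Xp (- 1) * (f - fls_const c)"
  have g: "g \<in> R" unfolding g_def using f(1) c by (intro R_Xp_1) (auto simp: c_def)
  have "g * e \<in> L i" using omodD(3)[OF chnD(1)[OF L] g e(1)] .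
  then have "Xp 1 * (g * e) \<in> L (i + 3)" by (simp add: chnD(3)[OF L] mem_sc)
  then have "Xp 1 * (g * e) \<in> L (i + 1)" using lchain_antimono[OF L, of "i + 1" "i + 3"] by auto
  moreover have "Xp 1 * (g * e) = (f - fls_const c) * e"
    unfolding g_def by (simp only: mult.assoc Xp_mult_Xp) simp
  ultimately have "f * e - (f - fls_const c) * e \<in> L (i + 1)"
    using f(2) omodD(5)[OF chnD(1)[OF L]] by metis
  then have "fls_const c * e \<in> L (i + 1)" by (simp add: algebra_simps)
  then have "fls_const (inverse c) * (fls_const c * e) \<in> L (i + 1)"
    using c by (simp add: omodD(3)[OF chnD(1)[OF L]] del: mult_eq_0_iff)
  moreover have "fls_const (inverse c) * (fls_const c * e) = e"
    using nz unfolding c_def by (metis fls_const_mult_const left_inverse fls_const_1 mult.assoc mult_1)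
  ultimately show False using e(2) by simp
qed

text \<open>One vector from every gap of the chain suffices: v is expanded digit by digit, removing
  at stage n the right multiple of \<open>e n\<close>. Periodicity gathers the infinitely many
  digits into three power series, and here it matters that the coefficients are complete.\<close>

lemma lchain_basis:
  assumes L: "lchain L" and e: "periodic e" "\<And>i. e i \<in> L i" "\<And>i. e i \<notin> L (i + 1)"
  shows "L 0 = B (e 0) (e 1) (e 2)"
proof
  note om = chnD(1)[OF L]
  show "B (e 0) (e 1) (e 2) \<subseteq> L 0"
    using e(2)[of 0] e(2)[of 1] e(2)[of 2] lchain_antimono[OF L, of 0 1] lchain_antimono[OF L, of 0 2]
    by (intro B_least[OF om]) auto
  show "L 0 \<subseteq> B (e 0) (e 1) (e 2)"
  proof
    fix v assume v: "v \<in> L 0"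
    have "\<exists>c. \<forall>n::nat. \<forall>r\<in>L (int n). c n r \<in> k \<and> r - fls_const (c n r) * e (int n) \<in> L (int (Suc n))"
    proof -
      have "\<exists>c. r \<in> L (int n) \<longrightarrow> c \<in> k \<and> r - fls_const c * e (int n) \<in> L (int (Suc n))" for n :: nat and r
        using chnD(5)[OF L e(2) e(3), of r "int n"] by (auto simp: add.commute)
      then have "\<exists>c. \<forall>r. r \<in> L (int n) \<longrightarrow> c r \<in> k \<and> r - fls_const (c r) * e (int n) \<in> L (int (Suc n))" for n :: nat
        by (intro choice) blast
      then have "\<exists>C. \<forall>n::nat. \<forall>r. r \<in> L (int n) \<longrightarrow> C n r \<in> k \<and> r - fls_const (C n r) * e (int n) \<in> L (int (Suc n))"
        by (intro choice) blast
      then show ?thesis unfolding Ball_def .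
    qed
    then obtain C where C: "\<And>n r. r \<in> L (int n) \<Longrightarrow> C n r \<in> k"
      "\<And>n r. r \<in> L (int n) \<Longrightarrow> r - fls_const (C n r) * e (int n) \<in> L (int (Suc n))"
      by metis
    define r where "r = rec_nat v (\<lambda>n r. r - fls_const (C n r) * e (int n))"
    have r0: "r 0 = v" and rS: "r (Suc n) = r n - fls_const (C n (r n)) * e (int n)" for n
      by (simp_all add: r_def)
    have rL: "r n \<in> L (int n)" for n
      by (induction n) (use v C(2) in \<open>auto simp: r0 rS simp del: of_nat_Suc\<close>)
    define c where "c n = C n (r n)" for n
    have c: "c n \<in> k" for n using C(1)[OF rL] by (simp add: c_def)
    have rS': "r (Suc n) = r n - fls_const (c n) * e (int n)" for n
      by (simp add: rS c_def)
    \<comment> \<open>\<open>v = \<Sum> c\<^sub>n e\<^sub>n\<close>; \<open>T j m\<close> collects the digits with index \<open>\<equiv> j\<close> modulo 3, from position \<open>m\<close> on.\<close>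
    define T where "T j m = fps_to_fls (Abs_fps (\<lambda>i. c (3 * (m + i) + j)))" for j m :: nat
    have T: "T j m \<in> R" for j m using c by (auto simp: T_def R_def F_def)
    have TS: "T j m = fls_const (c (3 * m + j)) + Xp 1 * T j (Suc m)" for j m
    proof (rule fls_eqI)
      fix n :: int
      consider "n < 0" | "n = 0" | i where "n = int (Suc i)"
        by (metis int_cases not0_implies_Suc of_nat_0 negative_zless)
      then show "T j m $$ n = (fls_const (c (3 * m + j)) + Xp 1 * T j (Suc m)) $$ n"
        by cases (auto simp: T_def nat_add_distrib algebra_simps)
    qed
    let ?S = "\<lambda>m. T 0 m * e 0 + T 1 m * e 1 + T 2 m * e 2"
    \<comment> \<open>An exact identity for every m replaces a limit: the remainder after 3m digits
      and the tail \<open>Xp (int m) * ?S m\<close> both lie in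
      \<open>sc (int m) (L 0)\<close>.\<close>
    have eq: "v - ?S 0 = r (3 * m) - Xp (int m) * ?S m" for m
    proof (induction m)
      case (Suc m)
      have E: "e (3 * int m) = Xp (int m) * e 0" "e (3 * int m + 1) = Xp (int m) * e 1"
        "e (3 * int m + 2) = Xp (int m) * e 2"
        using periodic_shift3[OF e(1), of 0 "int m"] periodic_shift3[OF e(1), of 1 "int m"]
          periodic_shift3[OF e(1), of 2 "int m"] by (simp_all add: add.commute)
      have "3 * Suc m = Suc (Suc (Suc (3 * m)))" by simp
      then have "r (3 * Suc m) = r (Suc (Suc (Suc (3 * m))))" by (simp only:)
      also have "\<dots> = r (3 * m) - fls_const (c (3 * m)) * e (3 * int m)
          - fls_const (c (3 * m + 1)) * e (3 * int m + 1) - fls_const (c (3 * m + 2)) * e (3 * int m + 2)"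
        unfolding rS' by (simp add: add.commute)
      finally have r3: "r (3 * Suc m) = r (3 * m) - Xp (int m) *
          (fls_const (c (3 * m + 0)) * e 0 + fls_const (c (3 * m + 1)) * e 1 + fls_const (c (3 * m + 2)) * e 2)"
        unfolding E by (simp add: algebra_simps)
      have X: "Xp (int (Suc m)) = Xp (int m) * Xp 1" using Xp_add[of "int m" 1] by (simp add: add.commute)
      show ?case unfolding Suc.IH r3 X
        by (subst TS[of 0 m], subst TS[of 1 m], subst TS[of 2 m]) (simp add: algebra_simps)
    qed (simp add: r0)
    have S: "?S m \<in> L 0" for m
      using \<open>B (e 0) (e 1) (e 2) \<subseteq> L 0\<close> BI[OF T T T] by blast
    have "v - ?S 0 \<in> sc (int m) (L 0)" for m
    proof -
      have "r (3 * m) \<in> sc (int m) (L 0)" using rL[of "3 * m"] lchain_shift3[OF L, of 0 "int m"] by simp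
      moreover have "Xp (int m) * ?S m \<in> sc (int m) (L 0)" using S by (simp add: mem_sc)
      ultimately show ?thesis unfolding eq[of m] by (intro omodD(5)[OF omod_sc[OF om]])
    qed
    then have "v - ?S 0 = 0" by (rule bounded_separated[OF chnD(4)[OF L]])
    then show "v \<in> B (e 0) (e 1) (e 2)" using BI[OF T T T] by simp
  qed
qed

text \<open>Independence is a descent: in a relation the three terms start in different gaps of the
  chain, so the constant terms of the coefficients vanish one after another, and division by X
  leaves another relation over \<open>R\<close>.\<close>

lemma lchain_frame:
  assumes L: "lchain L" and e: "periodic e" "\<And>i. e i \<in> L i" "\<And>i. e i \<notin> L (i + 1)"
  shows "frame (e 0) (e 1) (e 2)" "L i = window e i"
proof -
  note om = chnD(1)[OF L]
  have periodic: "e (i + 3) = Xp 1 * e i" for i using e(1) by (simp add: periodic_def)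
  have "L (i + 0) = B (e (i + 0)) (e (i + 1)) (e (i + 2))"
    by (rule lchain_basis[OF lchain_shift[OF L, of i], of "\<lambda>n. e (i + n)"])
      (use e periodic in \<open>auto simp: periodic_def add.assoc[symmetric]\<close>)
  then show "L i = window e i" by (simp add: window_def)
  have step: "\<exists>f' g' h'. f = Xp 1 * f' \<and> g = Xp 1 * g' \<and> h = Xp 1 * h' \<and> f' \<in> R \<and> g' \<in> R \<and> h' \<in> R \<and>
      f' * e 0 + g' * e 1 + h' * e 2 = 0"
    if "f \<in> R" "g \<in> R" "h \<in> R" and rel: "f * e 0 + g * e 1 + h * e 2 = 0" for f g h
  proof -
    have m: "a * e j \<in> L i" if "a \<in> R" "i \<le> j" for a i j
      using omodD(3)[OF om that(1)] e(2)[of j] lchain_antimono[OF L that(2)] by blast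
    have lz: "a $$ 0 = 0" if "a \<in> R" "a * e j \<in> L (j + 1)" for a j
      using lead_zero[OF L e(2) e(3) that] .
    have "f * e 0 = - (g * e 1 + h * e 2)" using rel by (metis eq_neg_iff_add_eq_0 add.assoc)
    also have "\<dots> \<in> L (0 + 1)" by (intro omodD(4)[OF om] omodD(2)[OF om] m) (use that in auto)
    finally have f0: "f $$ 0 = 0" using lz[of f 0] that(1) by simp
    define f' where "f' = Xp (- 1) * f"
    have f': "f' \<in> R" "f = Xp 1 * f'" using R_Xp_1[OF that(1) f0] by (simp_all add: f'_def)
    have fe: "f * e 0 = f' * e 3" using periodic[of 0] by (simp add: f'(2) ac_simps)
    have "g * e 1 = - (h * e 2 + f' * e 3)"
      using rel unfolding fe by (metis eq_neg_iff_add_eq_0 add.assoc add.commute)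
    also have "\<dots> \<in> L (1 + 1)" by (intro omodD(4)[OF om] omodD(2)[OF om] m) (use that f' in auto)
    finally have g0: "g $$ 0 = 0" using lz[of g 1] that(2) by simp
    define g' where "g' = Xp (- 1) * g"
    have g': "g' \<in> R" "g = Xp 1 * g'" using R_Xp_1[OF that(2) g0] by (simp_all add: g'_def)
    have ge: "g * e 1 = g' * e 4" using periodic[of 1] by (simp add: g'(2) ac_simps)
    have "h * e 2 = - (f' * e 3 + g' * e 4)"
      using rel unfolding fe ge by (metis eq_neg_iff_add_eq_0 add.commute)
    also have "\<dots> \<in> L (2 + 1)" by (intro omodD(4)[OF om] omodD(2)[OF om] m) (use that f' g' in auto)
    finally have h0: "h $$ 0 = 0" using lz[of h 2] that(3) by simp
    define h' where "h' = Xp (- 1) * h"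
    have h': "h' \<in> R" "h = Xp 1 * h'" using R_Xp_1[OF that(3) h0] by (simp_all add: h'_def)
    have "Xp 1 * (f' * e 0 + g' * e 1 + h' * e 2) = 0"
      using rel unfolding f'(2) g'(2) h'(2) by (simp add: algebra_simps)
    then show ?thesis using f' g' h' by auto
  qed
  have R0: "f $$ int n = 0 \<and> g $$ int n = 0 \<and> h $$ int n = 0"
    if "f \<in> R" "g \<in> R" "h \<in> R" "f * e 0 + g * e 1 + h * e 2 = 0" for f g h n
    using that
  proof (induction n arbitrary: f g h)
    case 0
    obtain f' g' h' where *: "f = Xp 1 * f'" "g = Xp 1 * g'" "h = Xp 1 * h'" "f' \<in> R" "g' \<in> R" "h' \<in> R"
      using step[OF 0] by blast
    have "f' $$ (- 1) = 0" "g' $$ (- 1) = 0" "h' $$ (- 1) = 0" using *(4-6) by (simp_all add: R_def)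
    then show ?case by (simp add: *(1-3))
  next
    case (Suc n)
    obtain f' g' h' where *: "f = Xp 1 * f'" "g = Xp 1 * g'" "h = Xp 1 * h'" "f' \<in> R" "g' \<in> R" "h' \<in> R"
      "f' * e 0 + g' * e 1 + h' * e 2 = 0"
      using step[OF Suc.prems] by blast
    show ?case using Suc.IH[OF *(4-7)] by (simp add: *(1-3))
  qed
  have Rz: "f = 0 \<and> g = 0 \<and> h = 0"
    if "f \<in> R" "g \<in> R" "h \<in> R" "f * e 0 + g * e 1 + h * e 2 = 0" for f g h
  proof -
    have "f $$ n = 0 \<and> g $$ n = 0 \<and> h $$ n = 0" for n
      using R0[OF that, of "nat n"] that(1-3) by (cases "n < 0") (auto simp: R_def)
    then show ?thesis by (auto intro: fls_eqI)
  qed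
  have "indep (e 0) (e 1) (e 2)"
    unfolding indep_def
  proof (intro ballI impI)
    fix f g h assume *: "f \<in> F" "g \<in> F" "h \<in> F" "f * e 0 + g * e 1 + h * e 2 = 0"
    obtain nf where nf: "\<And>m. m \<ge> nf \<Longrightarrow> Xp m * f \<in> R" using F_clear[OF *(1)] by blast
    obtain ng where ng: "\<And>m. m \<ge> ng \<Longrightarrow> Xp m * g \<in> R" using F_clear[OF *(2)] by blast
    obtain nh where nh: "\<And>m. m \<ge> nh \<Longrightarrow> Xp m * h \<in> R" using F_clear[OF *(3)] by blast
    define m where "m = max nf (max ng nh)"
    have "Xp m * f * e 0 + Xp m * g * e 1 + Xp m * h * e 2 = Xp m * (f * e 0 + g * e 1 + h * e 2)"
      by (simp only: distrib_left mult.assoc)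
    then have "Xp m * f = 0 \<and> Xp m * g = 0 \<and> Xp m * h = 0"
      using *(4) nf ng nh by (intro Rz) (auto simp: m_def)
    then show "f = 0 \<and> g = 0 \<and> h = 0" by simp
  qed
  then show "frame (e 0) (e 1) (e 2)"
    using chnD(4)[OF L] \<open>L i = window e i\<close> lchain_basis[OF L e] by (simp add: frame_def)
qed

text \<open>A last index exists because the second chain contains \<open>L i\<close> far to the left
  and lies inside \<open>L (i + 1)\<close> far to the right; otherwise the failure of the inclusion
  would propagate from one end to the other.\<close>

lemma lchain_jump:
  assumes L: "lchain L" and M: "lchain M"
  shows "\<exists>v j. v \<in> L i \<and> v \<in> M j \<and> v \<notin> L (i + 1) \<and> L i \<inter> M (j + 1) \<subseteq> L (i + 1)"
proof (rule ccontr)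
  assume *: "\<not> ?thesis"
  have step: "\<not> L i \<inter> M (j + 1) \<subseteq> L (i + 1)" if "\<not> L i \<inter> M j \<subseteq> L (i + 1)" for j
    using that * by blast
  obtain a where a: "\<And>m. m \<ge> a \<Longrightarrow> sc m (L i) \<subseteq> M 0"
    using bounded_absorb[OF lchain_bounded[OF L] lchain_bounded[OF M]] by blast
  obtain b where b: "\<And>m. m \<ge> b \<Longrightarrow> sc m (M 0) \<subseteq> L (i + 1)"
    using bounded_absorb[OF lchain_bounded[OF M] lchain_bounded[OF L]] by blast
  have "L i \<subseteq> M (- 3 * a)"
    using sc_mono[OF a[OF order.refl], of "- a"] lchain_shift3[OF M, of 0 "- a"] by simp
  then have start: "\<not> L i \<inter> M (- 3 * a) \<subseteq> L (i + 1)" using chnD(2)[OF L, of i] by blast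
  define c where "c = max b (- a)"
  have "- 3 * a \<le> 3 * c" by (simp add: c_def)
  then have "\<not> L i \<inter> M (3 * c) \<subseteq> L (i + 1)"
    by (induction rule: int_ge_induct) (use start step in auto)
  moreover have "M (3 * c) \<subseteq> L (i + 1)"
    using b[of c] lchain_shift3[OF M, of 0 c] by (simp add: c_def)
  ultimately show False by blast
qed

lemma int_mod3_cases: "(i::int) mod 3 = 0 \<or> i mod 3 = 1 \<or> i mod 3 = 2"
  by presburger

lemma lchain_adapted:
  assumes L: "lchain L" and M: "lchain M"
  obtains e \<pi> where "periodic e" "\<And>i. \<pi> (i + 3) = \<pi> i + 3" "bij \<pi>"
    "\<And>i. e i \<in> L i" "\<And>i. e i \<notin> L (i + 1)" "\<And>i. e i \<in> M (\<pi> i)" "\<And>i. e i \<notin> M (\<pi> i + 1)"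
proof -
  obtain v j where vj: "\<And>i. v i \<in> L i" "\<And>i. v i \<in> M (j i)" "\<And>i. v i \<notin> L (i + 1)"
    "\<And>i. L i \<inter> M (j i + 1) \<subseteq> L (i + 1)"
    using lchain_jump[OF assms] by metis
  \<comment> \<open>Choices are made at the residues 0, 1, 2 and extended by powers of X, which
    makes both \<open>e\<close> and \<open>\<pi>\<close> periodic.\<close>
  define e where "e i = Xp (i div 3) * v (i mod 3)" for i
  define \<pi> where "\<pi> i = j (i mod 3) + 3 * (i div 3)" for i
  have pi3: "\<pi> (i + 3) = \<pi> i + 3" for i by (simp add: \<pi>_def)
  have e3: "periodic e" unfolding periodic_def e_def by (simp add: Xp_mult_Xp add.commute)
  have Li: "L i = sc (i div 3) (L (i mod 3))" for i
    using lchain_shift3[OF L, of "i mod 3" "i div 3"] by simp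
  have Li1: "L (i + 1) = sc (i div 3) (L (i mod 3 + 1))" for i
    using lchain_shift3[OF L, of "i mod 3 + 1" "i div 3"] by (simp add: add.commute add.left_commute)
  have Mi: "M (\<pi> i) = sc (i div 3) (M (j (i mod 3)))" "M (\<pi> i + 1) = sc (i div 3) (M (j (i mod 3) + 1))" for i
    using lchain_shift3[OF M, of "j (i mod 3)" "i div 3"] lchain_shift3[OF M, of "j (i mod 3) + 1" "i div 3"]
    by (simp_all add: \<pi>_def add_ac)
  have e1: "e i \<in> L i" for i unfolding Li[of i] by (simp add: mem_sc e_def vj(1))
  have e2: "e i \<notin> L (i + 1)" for i unfolding Li1[of i] by (simp add: mem_sc e_def vj(3))
  have e4: "e i \<in> M (\<pi> i)" for i unfolding Mi by (simp add: mem_sc e_def vj(2))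
  have jump: "L i \<inter> M (\<pi> i + 1) \<subseteq> L (i + 1)" for i
    using vj(4)[of "i mod 3"] unfolding Li[of i] Li1[of i] Mi by (auto simp: mem_sc)
  have e5: "e i \<notin> M (\<pi> i + 1)" for i using jump e1 e2 by blast
  \<comment> \<open>If two indices jumped at the same place, subtracting a multiple of the later
    vector would push \<open>e i\<close> one step further down in M without leaving the gap
    \<open>L i - L (i + 1)\<close>, against the choice of the last index.\<close>
  have lt: False if eq: "\<pi> i = \<pi> i'" and less: "i < i'" for i i'
  proof -
    obtain c where c: "c \<in> k" "e i - fls_const c * e i' \<in> M (\<pi> i + 1)"
      using chnD(5)[OF M, of "e i'" "\<pi> i" "e i"] e4[of i] e4[of i'] e5[of i'] eq by metis
    have "fls_const c * e i' \<in> L i'" using c(1) by (intro omodD(3)[OF chnD(1)[OF L]] e1) auto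
    then have l: "fls_const c * e i' \<in> L (i + 1)" using lchain_antimono[OF L, of "i + 1" i'] less by auto
    then have "e i - fls_const c * e i' \<in> L i"
      using chnD(2)[OF L, of i] e1[of i] by (intro omodD(5)[OF chnD(1)[OF L]]) auto
    then have "e i - fls_const c * e i' \<in> L (i + 1)" using jump[of i] c(2) by blast
    then have "(e i - fls_const c * e i') + fls_const c * e i' \<in> L (i + 1)"
      using l by (rule omodD(2)[OF chnD(1)[OF L]])
    then show False using e2[of i] by simp
  qed
  have "inj \<pi>"
  proof (rule injI)
    fix i i' assume "\<pi> i = \<pi> i'"
    then show "i = i'" using lt[of i i'] lt[of i' i] by (cases i i' rule: linorder_cases) auto
  qed
  have pi3n: "\<pi> (i + 3 * n) = \<pi> i + 3 * n" for i n by (simp add: \<pi>_def algebra_simps)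
  have inj3: "i mod 3 = i' mod 3" if "\<pi> i mod 3 = \<pi> i' mod 3" for i i'
  proof -
    have "3 dvd \<pi> i - \<pi> i'" using that by (rule mod_eq_dvd_iff[THEN iffD1])
    then obtain n where "\<pi> i - \<pi> i' = 3 * n" by (rule dvdE)
    then have "\<pi> i = \<pi> (i' + 3 * n)" by (simp add: pi3n)
    then have "i = i' + 3 * n" using \<open>inj \<pi>\<close> by (simp add: inj_eq)
    then show ?thesis by simp
  qed
  \<comment> \<open>Surjectivity comes from counting: \<open>\<pi>\<close> is injective on residues
    modulo 3, hence permutes the three of them, and translations by 3 do the rest.\<close>
  have "(\<lambda>i. \<pi> i mod 3) ` {0, 1, 2} = {0, 1, 2}"
  proof (rule endo_inj_surj)
    show "(\<lambda>i. \<pi> i mod 3) ` {0, 1, 2} \<subseteq> {0, 1, 2}"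
      using int_mod3_cases[of "\<pi> 0"] int_mod3_cases[of "\<pi> 1"] int_mod3_cases[of "\<pi> 2"] by auto
    show "inj_on (\<lambda>i. \<pi> i mod 3) {0, 1, 2}"
    proof (rule inj_onI)
      fix i i' :: int assume "i \<in> {0, 1, 2}" "i' \<in> {0, 1, 2}" "\<pi> i mod 3 = \<pi> i' mod 3"
      then show "i = i'" using inj3[of i i'] by auto
    qed
  qed simp
  then have im: "n mod 3 \<in> (\<lambda>i. \<pi> i mod 3) ` {0, 1, 2}" for n
    using int_mod3_cases[of n] by simp
  have "surj \<pi>"
  proof (rule surjI)
    fix n
    obtain i where "n mod 3 = \<pi> i mod 3" using im[of n] by blast
    then have "3 dvd n - \<pi> i" by (rule mod_eq_dvd_iff[THEN iffD1])
    then obtain m where "n - \<pi> i = 3 * m" by (rule dvdE)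
    then have "\<pi> (i + 3 * m) = n" by (simp add: pi3n)
    then show "\<pi> (SOME i. \<pi> i = n) = n" by (rule someI)
  qed
  then have "bij \<pi>" using \<open>inj \<pi>\<close> by (simp add: bij_def)
  then show ?thesis using that[of e \<pi>] pi3 e3 e1 e2 e4 e5 by blast
qed

text \<open>A periodic injection permutes the residues modulo 3, and changing an index within its
  residue class only introduces a power of X.\<close>

lemma monomial_reindex:
  fixes w :: "int \<Rightarrow> int"
  assumes e: "periodic e" and w: "\<And>i. w (i + 3) = w i + 3" "inj w"
  shows "monomial (e 0) (e 1) (e 2) (e (w 0)) (e (w 1)) (e (w 2))"
proof -
  have ew: "e (w i) = Xp (w i div 3) * e (w i mod 3)" for i
    using periodic_shift3[OF e, of "w i mod 3" "w i div 3"] by simp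
  have w3: "w (i + 3 * n) = w i + 3 * n" for i n
  proof (induction n rule: int_induct[of _ 0])
    case (step1 n)
    then show ?case using w(1)[of "i + 3 * n"] by (simp add: algebra_simps)
  next
    case (step2 n)
    then show ?case using w(1)[of "i + 3 * (n - 1)"] by (simp add: algebra_simps)
  qed simp
  have ne: "w i mod 3 \<noteq> w j mod 3" if "i mod 3 \<noteq> j mod 3" for i j
  proof
    assume "w i mod 3 = w j mod 3"
    then have "3 dvd w i - w j" by (rule mod_eq_dvd_iff[THEN iffD1])
    then obtain n where "w i - w j = 3 * n" by (rule dvdE)
    then have "w i = w (j + 3 * n)" by (simp add: w3)
    then have "i = j + 3 * n" using w(2) by (simp add: inj_eq)
    then show False using that by simp
  qed
  note m = monomial_refl[of "e 0" "e 1" "e 2"]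
  have "monomial (e 0) (e 1) (e 2) (e (w 0 mod 3)) (e (w 1 mod 3)) (e (w 2 mod 3))"
    using int_mod3_cases[of "w 0"] int_mod3_cases[of "w 1"] int_mod3_cases[of "w 2"]
      ne[of 0 1] ne[of 0 2] ne[of 1 2]
      m monomial_swap[OF m] monomial_cyc[OF m] monomial_cyc[OF monomial_cyc[OF m]] monomial_cyc[OF monomial_swap[OF m]]
      monomial_cyc[OF monomial_cyc[OF monomial_swap[OF m]]]
    by auto
  from monomial_scale[OF this, of "w 0 div 3" "w 1 div 3" "w 2 div 3"] show ?thesis
    by (simp only: ew[symmetric])
qed

definition unroll :: "'a fls \<Rightarrow> 'a fls \<Rightarrow> 'a fls \<Rightarrow> int \<Rightarrow> 'a fls" where
  "unroll x y z i = Xp (i div 3) * (if i mod 3 = 0 then x else if i mod 3 = 1 then y else z)"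

lemma periodic_unroll: "periodic (unroll x y z)"
  by (simp add: periodic_def unroll_def Xp_mult_Xp add.commute)

lemma unroll_simps: "unroll x y z 0 = x" "unroll x y z 1 = y" "unroll x y z 2 = z"
  "unroll x y z 3 = Xp 1 * x" "unroll x y z 4 = Xp 1 * y"
  by (simp_all add: unroll_def)

lemma window_same_chain:
  assumes "periodic e" "periodic e'" "window e = window e'"
  shows "same_chain (e 0) (e 1) (e 2) (e' 0) (e' 1) (e' 2)"
proof -
  have *: "window e 0 = B (e 0) (e 1) (e 2)" "window e 1 = B (Xp 1 * e 0) (e 1) (e 2)"
    "window e 2 = B (Xp 1 * e 0) (Xp 1 * e 1) (e 2)" if "periodic e" for e
  proof -
    have "e 3 = Xp 1 * e 0" "e 4 = Xp 1 * e 1"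
      using that[unfolded periodic_def, rule_format, of 0] that[unfolded periodic_def, rule_format, of 1] by simp_all
    moreover have "window e 1 = B (e 3) (e 1) (e 2)"
      using B_cyc[of "e 1" "e 2" "e 3"] by (simp add: window_def)
    moreover have "window e 2 = B (e 3) (e 4) (e 2)"
      using trans[OF B_cyc[of "e 2" "e 3" "e 4"] B_cyc[of "e 4" "e 2" "e 3"]] by (simp add: window_def)
    ultimately show "window e 0 = B (e 0) (e 1) (e 2)" "window e 1 = B (Xp 1 * e 0) (e 1) (e 2)"
      "window e 2 = B (Xp 1 * e 0) (Xp 1 * e 1) (e 2)"
      by (simp_all add: window_def)
  qed
  show ?thesis using *[OF assms(1)] *[OF assms(2)] assms(3) by (simp add: same_chain_def)
qed

lemma common_apartment:
  assumes "frame x y z" "frame x' y' z'"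
  obtains u v w u' v' w' where "frame u v w" "monomial u v w u' v' w'"
    "same_chain x y z u v w" "same_chain x' y' z' u' v' w'"
proof -
  let ?L = "window (unroll x y z)" and ?M = "window (unroll x' y' z')"
  have L: "lchain ?L" and M: "lchain ?M"
    by (rule lchain_window[OF periodic_unroll]; simp add: unroll_simps assms)+
  obtain e \<pi> where e: "periodic e" "\<And>i. \<pi> (i + 3) = \<pi> i + 3" "bij \<pi>"
    "\<And>i. e i \<in> ?L i" "\<And>i. e i \<notin> ?L (i + 1)" "\<And>i. e i \<in> ?M (\<pi> i)" "\<And>i. e i \<notin> ?M (\<pi> i + 1)"
    by (rule lchain_adapted[OF L M]) (rule that)
  \<comment> \<open>Reading the same vectors in the order of the second chain requires the inverse
    permutation: \<open>e (w i)\<close> lies in the i-th gap of that chain.\<close>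
  define w where "w = inv_into UNIV \<pi>"
  have piw: "\<pi> (w i) = i" for i using e(3) by (simp add: w_def bij_is_surj surj_f_inv_f)
  have w3: "w (i + 3) = w i + 3" for i
    by (rule injD[OF bij_is_inj[OF e(3)]]) (simp add: piw e(2))
  have "inj w" by (rule inj_on_inverseI[of _ \<pi>]) (simp add: piw)
  define e' where "e' i = e (w i)" for i
  have e': "periodic e'" using e(1) by (simp add: periodic_def e'_def w3)
  have frame: "frame (e 0) (e 1) (e 2)"
    by (rule lchain_frame(1)[OF L e(1,4,5)])
  have 1: "?L = window e"
    by (rule ext) (rule lchain_frame(2)[OF L e(1,4,5)])
  have m: "e' i \<in> ?M i" "e' i \<notin> ?M (i + 1)" for i
    using e(6)[of "w i"] e(7)[of "w i"] by (simp_all add: e'_def piw)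
  have 2: "?M = window e'"
    by (rule ext) (rule lchain_frame(2)[OF M e' m])
  have "monomial (e 0) (e 1) (e 2) (e' 0) (e' 1) (e' 2)"
    unfolding e'_def by (rule monomial_reindex[OF e(1) w3 \<open>inj w\<close>])
  then show ?thesis
    using window_same_chain[OF periodic_unroll e(1) 1] window_same_chain[OF periodic_unroll e' 2]
    unfolding unroll_simps by (rule that[OF frame])
qed

section \<open>Thickness and types\<close>

lemma apartment_chamE:
  assumes "frame x y z" "A \<in> apartment x y z"
  obtains u v w where "frame u v w" "apartment u v w = apartment x y z" "A \<subseteq> chamber u v w"
  by (rule apartment_chamber[OF assms(2)]) (rule that, rule monomial_frame, assumption, rule assms(1), rule monomial_apartment)

lemma finite_chamber: "finite (chamber x y z)"
  by (simp add: chamber_def)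

lemma is_A2_tilde_building:
  assumes "frame x0 y0 z0" shows "A2_tilde_building building"
  unfolding A2_tilde_building_def
proof (intro conjI exI)
  let ?A = "{apartment x y z | x y z. frame x y z}"
  show "simplicial_complex building"
    unfolding simplicial_complex_def
  proof (intro ballI conjI allI impI)
    fix A assume "A \<in> building"
    then obtain x y z where *: "frame x y z" "A \<subseteq> chamber x y z" unfolding building_def by blast
    show "finite A" using finite_subset[OF *(2) finite_chamber] .
    show "C \<in> building" if "C \<subseteq> A" for C
      unfolding building_def using *(1) subset_trans[OF that *(2)] by blast
  qed
  show "?A \<noteq> {}" using assms by blast
  show "building = \<Union> ?A"
  proof
    show "building \<subseteq> \<Union> ?A"
    proof
      fix A assume "A \<in> building"
      then obtain x y z where *: "frame x y z" "A \<subseteq> chamber x y z" unfolding building_def by blast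
      then show "A \<in> \<Union> ?A" using sub_chamber_in_apartment[OF *(2)] by blast
    qed
    show "\<Union> ?A \<subseteq> building" using apartment_sub_building by blast
  qed
  show "\<forall>\<Sigma>\<in>?A. \<exists>f. complex_iso f A2_tilde_coxeter_complex \<Sigma>"
    using complex_iso_apt_point by blast
  show "\<forall>A\<in>building. \<forall>C\<in>building. \<exists>\<Sigma>\<in>?A. A \<in> \<Sigma> \<and> C \<in> \<Sigma>"
  proof (intro ballI)
    fix A C assume "A \<in> building" "C \<in> building"
    then obtain x y z x' y' z' where *: "frame x y z" "A \<subseteq> chamber x y z" "frame x' y' z'" "C \<subseteq> chamber x' y' z'"
      unfolding building_def by blast
    obtain u v w u' v' w' where c: "frame u v w" "monomial u v w u' v' w'"
      "same_chain x y z u v w" "same_chain x' y' z' u' v' w'"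
      using common_apartment[OF *(1,3)] .
    have "A \<in> apartment u v w"
      by (rule sub_chamber_in_apartment) (use *(2) same_chain_chamber[OF c(3)] in simp)
    moreover have "C \<in> apartment u v w"
      unfolding monomial_apartment[OF c(2), symmetric]
      by (rule sub_chamber_in_apartment) (use *(4) same_chain_chamber[OF c(4)] in simp)
    ultimately show "\<exists>\<Sigma>\<in>?A. A \<in> \<Sigma> \<and> C \<in> \<Sigma>" using c(1) by blast
  qed
  show "\<forall>\<Sigma>\<in>?A. \<forall>\<Sigma>'\<in>?A. \<forall>A\<in>\<Sigma> \<inter> \<Sigma>'. \<forall>C\<in>\<Sigma> \<inter> \<Sigma>'. \<exists>f. complex_iso f \<Sigma> \<Sigma>' \<and> (\<forall>x\<in>A \<union> C. f x = x)"
  proof (intro ballI)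
    fix \<Sigma> \<Sigma>' A C assume S: "\<Sigma> \<in> ?A" "\<Sigma>' \<in> ?A" "A \<in> \<Sigma> \<inter> \<Sigma>'" "C \<in> \<Sigma> \<inter> \<Sigma>'"
    obtain x y z where xyz: "\<Sigma> = apartment x y z" "frame x y z" using S(1) by blast
    have "A \<in> apartment x y z" using S(3) xyz(1) by blast
    then obtain u v w where 1: "frame u v w" "apartment u v w = apartment x y z" "A \<subseteq> chamber u v w"
      by (rule apartment_chamE[OF xyz(2)])
    obtain x' y' z' where xyz': "\<Sigma>' = apartment x' y' z'" "frame x' y' z'" using S(2) by blast
    have "C \<in> apartment x' y' z'" using S(4) xyz'(1) by blast
    then obtain u' v' w' where 2: "frame u' v' w'" "apartment u' v' w' = apartment x' y' z'" "C \<subseteq> chamber u' v' w'"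
      by (rule apartment_chamE[OF xyz'(2)])
    have \<Sigma>: "\<Sigma> = apartment u v w" "\<Sigma>' = apartment u' v' w'" using 1(2) 2(2) xyz(1) xyz'(1) by simp_all
    \<comment> \<open>A third apartment contains a chamber through A from the first and a chamber
      through C from the second. The required isomorphism is the composite through it; each factor
      fixes every vertex that its two apartments share.\<close>
    obtain r s t r' s' t' where c: "frame r s t" "monomial r s t r' s' t'"
      "same_chain u v w r s t" "same_chain u' v' w' r' s' t'"
      using common_apartment[OF 1(1) 2(1)] .
    have eq: "apartment r' s' t' = apartment r s t" using monomial_apartment[OF c(2)] .
    have A: "A \<in> apartment r s t"
      by (rule sub_chamber_in_apartment) (use 1(3) same_chain_chamber[OF c(3)] in simp)
    have C: "C \<in> apartment r s t"
      unfolding eq[symmetric] by (rule sub_chamber_in_apartment) (use 2(3) same_chain_chamber[OF c(4)] in simp)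
    obtain f where f: "complex_iso f \<Sigma> (apartment r s t)" "\<And>x. x \<in> vertices \<Sigma> \<inter> vertices (apartment r s t) \<Longrightarrow> f x = x"
      unfolding \<Sigma> using apartment_iso_fix[OF 1(1) c(1,3)] by blast
    obtain g where g: "complex_iso g (apartment r s t) \<Sigma>'" "\<And>x. x \<in> vertices (apartment r s t) \<inter> vertices \<Sigma>' \<Longrightarrow> g x = x"
      unfolding \<Sigma> using apartment_iso_fix[OF monomial_frame[OF c(2,1)] 2(1) same_chain_sym[OF c(4)], unfolded eq] by blast
    have "(g \<circ> f) x = x" if "x \<in> A \<union> C" for x
    proof -
      have "x \<in> vertices \<Sigma>" "x \<in> vertices \<Sigma>'" "x \<in> vertices (apartment r s t)"
        using that S(3,4) A C by auto
      then show ?thesis using f(2)[of x] g(2)[of x] by simp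
    qed
    then show "\<exists>f. complex_iso f \<Sigma> \<Sigma>' \<and> (\<forall>x\<in>A \<union> C. f x = x)"
      using complex_iso_comp[OF f(1) g(1)] by blast
  qed
qed


lemma vertices_building: "vertices building = {cls (B x y z) | x y z. frame x y z}"
proof
  show "vertices building \<subseteq> {cls (B x y z) | x y z. frame x y z}"
  proof
    fix c assume "c \<in> vertices building"
    then obtain x y z where *: "frame x y z" "c \<in> chamber x y z" unfolding building_def by blast
    have "frame (Xp 1 * x) y z" "frame (Xp 1 * x) (Xp 1 * y) z"
      using frame_scale[OF *(1), of 1 0 0] frame_scale[OF *(1), of 1 1 0] by simp_all
    then show "c \<in> {cls (B x y z) | x y z. frame x y z}"
      using * unfolding chamber_def by blast
  qed
  show "{cls (B x y z) | x y z. frame x y z} \<subseteq> vertices building"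
  proof
    fix c assume "c \<in> {cls (B x y z) | x y z. frame x y z}"
    then obtain x y z where "frame x y z" "c = cls (B x y z)" by blast
    then have "{c} \<in> building" unfolding building_def chamber_def by blast
    then show "c \<in> vertices building" by blast
  qed
qed

definition coords :: "'a fls \<Rightarrow> 'a fls \<Rightarrow> 'a fls \<Rightarrow> 'a fls set \<Rightarrow> int \<Rightarrow> bool" where
  "coords u v w M n \<longleftrightarrow> (\<exists>a b c. M = B (Xp a * u) (Xp b * v) (Xp c * w) \<and> n = a + b + c)"

text \<open>Permutations leave the sum of the exponents alone and scalings shift it by a constant,
  so the sum, unlike the single exponents, compares any two frames of an apartment.\<close>

lemma monomial_coords:
  assumes "monomial u v w u' v' w'"
  shows "\<exists>n. \<forall>i j l. coords u v w (B (Xp i * u') (Xp j * v') (Xp l * w')) (i + j + l + n)"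
  using assms
proof (induction rule: monomial.induct)
  case monomial_refl
  show ?case by (rule exI[of _ 0]) (auto simp: coords_def)
next
  case (monomial_swap u' v' w')
  then obtain n where n: "coords u v w (B (Xp i * u') (Xp j * v') (Xp l * w')) (i + j + l + n)" for i j l
    by blast
  have "coords u v w (B (Xp i * v') (Xp j * u') (Xp l * w')) (i + j + l + n)" for i j l
    using n[of j i l] B_swap[of "Xp i * v'" "Xp j * u'" "Xp l * w'"] by (simp add: add.commute)
  then show ?case by blast
next
  case (monomial_cyc u' v' w')
  then obtain n where n: "coords u v w (B (Xp i * u') (Xp j * v') (Xp l * w')) (i + j + l + n)" for i j l
    by blast
  have "coords u v w (B (Xp i * v') (Xp j * w') (Xp l * u')) (i + j + l + n)" for i j l
    using n[of l i j] B_cyc[of "Xp i * v'" "Xp j * w'" "Xp l * u'"] by (simp add: add_ac)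
  then show ?case by blast
next
  case (monomial_scale u' v' w' p q r)
  then obtain n where n: "coords u v w (B (Xp i * u') (Xp j * v') (Xp l * w')) (i + j + l + n)" for i j l
    by blast
  have "coords u v w (B (Xp i * (Xp p * u')) (Xp j * (Xp q * v')) (Xp l * (Xp r * w'))) (i + j + l + (n + p + q + r))" for i j l
    using n[of "i + p" "j + q" "l + r"] by (simp add: Xp_mult_Xp add_ac)
  then show ?case by blast
qed

end

section \<open>Vertex types from an index of lattices relative to the base lattice\<close>

lemma three_eq_0: "(3 :: 3) = 0"
  by simp

lemma distinct_mod_3: "(t :: 3) \<noteq> t + 1" "t \<noteq> t + 2" "t + 1 \<noteq> t + 2"
  by simp_all

locale lattice_building = lattices k V for k :: "'a::field set" and V :: "'a fls set" +
  fixes b0 b1 b2 :: "'a fls"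
  assumes base: "frame b0 b1 b2" and base_V: "B b0 b1 b2 = V"
begin

text \<open>For M inside \<open>V\<close> this is the dimension of V/M over k, and in general the
  valuation of the determinant of a change of basis. Frames adapted to the base chain replace
  determinants: one exists for M by \<open>common_apartment\<close>, and the exponents do not depend
  on it by \<open>same_chain_coeff\<close>.\<close>

definition index :: "'a fls set \<Rightarrow> int" where
  "index M = (THE n. \<exists>u v w a b c. frame u v w \<and> same_chain b0 b1 b2 u v w \<and>
     M = B (Xp a * u) (Xp b * v) (Xp c * w) \<and> n = a + b + c)"

lemma index_adapted:
  assumes "frame u v w" "same_chain b0 b1 b2 u v w"
  shows "index (B (Xp a * u) (Xp b * v) (Xp c * w)) = a + b + c"
  unfolding index_def
proof (rule the_equality)
  show "\<exists>u' v' w' a' b' c'. frame u' v' w' \<and> same_chain b0 b1 b2 u' v' w' \<and>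
     B (Xp a * u) (Xp b * v) (Xp c * w) = B (Xp a' * u') (Xp b' * v') (Xp c' * w') \<and> a + b + c = a' + b' + c'"
    using assms by blast
next
  fix n assume "\<exists>u' v' w' a' b' c'. frame u' v' w' \<and> same_chain b0 b1 b2 u' v' w' \<and>
     B (Xp a * u) (Xp b * v) (Xp c * w) = B (Xp a' * u') (Xp b' * v') (Xp c' * w') \<and> n = a' + b' + c'"
  then obtain u' v' w' a' b' c' where *: "frame u' v' w'" "same_chain b0 b1 b2 u' v' w'"
     "B (Xp a * u) (Xp b * v) (Xp c * w) = B (Xp a' * u') (Xp b' * v') (Xp c' * w')" "n = a' + b' + c'"
    by blast
  then show "n = a + b + c"
    using same_chain_coeff[OF assms(1) *(1) same_chain_trans[OF same_chain_sym[OF assms(2)] *(2)] *(3)]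
    by simp
qed

lemma adapted_frame:
  assumes "frame x y z"
  obtains u v w n where "frame u v w" "same_chain b0 b1 b2 u v w"
    "coords u v w (B x y z) n" "coords u v w (B (Xp 1 * x) y z) (n + 1)"
proof -
  obtain u v w u' v' w' where *: "frame u v w" "monomial u v w u' v' w'"
    "same_chain b0 b1 b2 u v w" "same_chain x y z u' v' w'"
    using common_apartment[OF base assms] .
  obtain n where n: "coords u v w (B (Xp i * u') (Xp j * v') (Xp l * w')) (i + j + l + n)" for i j l
    using monomial_coords[OF *(2)] by blast
  have "coords u v w (B x y z) n" "coords u v w (B (Xp 1 * x) y z) (n + 1)"
    using n[of 0 0 0] n[of 1 0 0] *(4) by (simp_all add: same_chain_def add.commute)
  then show ?thesis by (rule that[OF *(1,3)])
qed

lemma index_coords: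
  assumes "frame u v w" "same_chain b0 b1 b2 u v w" "coords u v w M n" shows "index M = n"
  using assms(3) index_adapted[OF assms(1,2)] by (auto simp: coords_def)

lemma index_step: assumes "frame x y z" shows "index (B (Xp 1 * x) y z) = index (B x y z) + 1"
proof -
  obtain u v w n where *: "frame u v w" "same_chain b0 b1 b2 u v w"
    "coords u v w (B x y z) n" "coords u v w (B (Xp 1 * x) y z) (n + 1)"
    using adapted_frame[OF assms] .
  show ?thesis using index_coords[OF *(1-3)] index_coords[OF *(1,2,4)] by simp
qed

lemma index_scale1: assumes "frame x y z" shows "index (B (Xp a * x) y z) = index (B x y z) + a"
proof (induction a rule: int_induct[of _ 0])
  case (step1 a)
  then show ?case using index_step[OF frame_scale1[OF assms, of a]] by (simp add: Xp_mult_Xp add.commute)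
next
  case (step2 a)
  then show ?case using index_step[OF frame_scale1[OF assms, of "a - 1"]] by (simp add: Xp_mult_Xp)
qed simp

lemma index_scale: assumes "frame x y z" shows "index (B (Xp a * x) (Xp b * y) (Xp c * z)) = index (B x y z) + a + b + c"
proof -
  have "index (B (Xp a * x) (Xp b * y) (Xp c * z)) = index (B x (Xp b * y) (Xp c * z)) + a"
    using index_scale1[of x "Xp b * y" "Xp c * z" a] frame_scale[OF assms, of 0 b c] by simp
  also have "B x (Xp b * y) (Xp c * z) = B (Xp b * y) (Xp c * z) x" by (rule B_cyc[symmetric])
  also have "index \<dots> = index (B y (Xp c * z) x) + b"
    using index_scale1[of y "Xp c * z" x b] frame_scale[OF frame_cyc[OF assms], of 0 c 0] by simp
  also have "B y (Xp c * z) x = B (Xp c * z) x y" by (rule B_cyc[symmetric])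
  also have "index \<dots> = index (B z x y) + c"
    by (rule index_scale1[OF frame_cyc[OF frame_cyc[OF assms]]])
  also have "B z x y = B x y z" by (rule trans[OF B_cyc B_cyc])
  finally show ?thesis by simp
qed

lemma index_sc: "frame x y z \<Longrightarrow> index (sc n (B x y z)) = index (B x y z) + 3 * n"
  by (simp add: sc_B index_scale)

text \<open>Scaling by \<open>X\<close> changes the index by 3, so the choice of representative is irrelevant.\<close>

definition vertex_type :: "'a fls set set \<Rightarrow> 3" where
  "vertex_type c = of_int (index (SOME M. M \<in> c))"

lemma vertex_type_cls: assumes "frame x y z" shows "vertex_type (cls (B x y z)) = of_int (index (B x y z))"
proof -
  have "(SOME M. M \<in> cls (B x y z)) \<in> cls (B x y z)"
    by (rule someI[of "\<lambda>M. M \<in> cls (B x y z)"]) (rule mem_cls)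
  then obtain n where "(SOME M. M \<in> cls (B x y z)) = sc n (B x y z)"
    unfolding cls_def by blast
  then have "vertex_type (cls (B x y z)) = of_int (index (B x y z) + 3 * n)"
    unfolding vertex_type_def using index_sc[OF assms] by simp
  also have "\<dots> = of_int (index (B x y z))"
    by (simp only: of_int_add of_int_mult of_int_numeral three_eq_0 mult_zero_left add_0_right)
  finally show ?thesis .
qed

lemma vertex_type_chamber:
  assumes "frame x y z"
  shows "vertex_type (cls (B (Xp 1 * x) y z)) = vertex_type (cls (B x y z)) + 1"
    "vertex_type (cls (B (Xp 1 * x) (Xp 1 * y) z)) = vertex_type (cls (B x y z)) + 2"
proof -
  have 1: "frame (Xp 1 * x) y z" "frame (Xp 1 * x) (Xp 1 * y) z"
    using frame_scale[OF assms, of 1 0 0] frame_scale[OF assms, of 1 1 0] by simp_all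
  show "vertex_type (cls (B (Xp 1 * x) y z)) = vertex_type (cls (B x y z)) + 1"
    unfolding vertex_type_cls[OF assms] vertex_type_cls[OF 1(1)] index_step[OF assms] by simp
  have "index (B (Xp 1 * x) (Xp 1 * y) z) = index (B x y z) + 2"
    using index_scale[OF assms, of 1 1 0] by simp
  then show "vertex_type (cls (B (Xp 1 * x) (Xp 1 * y) z)) = vertex_type (cls (B x y z)) + 2"
    unfolding vertex_type_cls[OF assms] vertex_type_cls[OF 1(2)] by simp
qed

lemma type_function_vertex_type: "type_function building vertex_type"
  unfolding type_function_def
proof
  fix A assume "A \<in> building"
  then obtain x y z where *: "frame x y z" "A \<subseteq> chamber x y z" unfolding building_def by blast
  have "inj_on vertex_type (chamber x y z)"
    unfolding chamber_def inj_on_def using vertex_type_chamber[OF *(1)] distinct_mod_3[of "vertex_type (cls (B x y z))"]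
    by auto
  then show "inj_on vertex_type A" using *(2) by (rule inj_on_subset)
qed

definition F_linear :: "('a fls \<Rightarrow> 'a fls) \<Rightarrow> bool" where
  "F_linear g \<longleftrightarrow> (\<forall>x y. g (x + y) = g x + g y) \<and> (\<forall>c\<in>F. \<forall>x. g (c * x) = c * g x)"

lemma F_linear_B: assumes "F_linear g" shows "g ` B x y z = B (g x) (g y) (g z)"
proof -
  have eq: "g (f * x + h * y + l * z) = f * g x + h * g y + l * g z" if "f \<in> R" "h \<in> R" "l \<in> R" for f h l
    using assms that R_imp_F unfolding F_linear_def by simp
  show ?thesis
  proof
    show "g ` B x y z \<subseteq> B (g x) (g y) (g z)"
      by (rule image_subsetI, erule BE) (simp add: eq BI)
    show "B (g x) (g y) (g z) \<subseteq> g ` B x y z"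
      by (rule subsetI, erule BE) (simp add: eq[symmetric] BI)
  qed
qed

definition frame_map :: "('a fls \<Rightarrow> 'a fls) \<Rightarrow> bool" where
  "frame_map g \<longleftrightarrow> F_linear g \<and> (\<forall>x y z. frame x y z \<longrightarrow> frame (g x) (g y) (g z))"

lemma frame_map_Xp: "frame_map g \<Longrightarrow> g (Xp n * x) = Xp n * g x"
  by (simp add: frame_map_def F_linear_def)

lemma frame_map_frame: "frame_map g \<Longrightarrow> frame x y z \<Longrightarrow> frame (g x) (g y) (g z)"
  by (simp add: frame_map_def)

lemma frame_map_B: "frame_map g \<Longrightarrow> g ` B x y z = B (g x) (g y) (g z)"
  by (simp add: frame_map_def F_linear_B)

definition on_class :: "('a fls \<Rightarrow> 'a fls) \<Rightarrow> 'a fls set set \<Rightarrow> 'a fls set set" where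
  "on_class g c = (\<lambda>L. g ` L) ` c"

lemma on_class_cls: assumes "frame_map g" shows "on_class g (cls (B x y z)) = cls (B (g x) (g y) (g z))"
proof -
  have "g ` sc n (B x y z) = sc n (B (g x) (g y) (g z))" for n
    unfolding sc_B frame_map_B[OF assms] frame_map_Xp[OF assms] ..
  then show ?thesis unfolding on_class_def cls_def image_image by simp
qed

lemma on_class_chamber: "frame_map g \<Longrightarrow> on_class g ` chamber x y z = chamber (g x) (g y) (g z)"
  by (simp add: chamber_def on_class_cls frame_map_Xp)

text \<open>In a frame spanning \<open>V\<close> and adapted to the vertex, the exponents are the
  same before and after applying \<open>g\<close>. So the index changes by index(g V) - index(V),
  which does not depend on the vertex.\<close>

lemma type_rotating_on_class: assumes g: "frame_map g" shows "type_rotating building vertex_type (on_class g)"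
  unfolding type_rotating_def
proof (intro exI ballI)
  fix c assume "c \<in> vertices building"
  then obtain x y z where c: "frame x y z" "c = cls (B x y z)" unfolding vertices_building by blast
  obtain u v w n where *: "frame u v w" "same_chain b0 b1 b2 u v w" "coords u v w (B x y z) n"
    using adapted_frame[OF c(1)] .
  obtain p q r where pqr: "B x y z = B (Xp p * u) (Xp q * v) (Xp r * w)"
    using *(3) by (auto simp: coords_def)
  have V: "V = B u v w" using base_V *(2) by (simp add: same_chain_def)
  have fr: "frame (Xp p * u) (Xp q * v) (Xp r * w)" using frame_scale[OF *(1)] .
  have gfr: "frame (g u) (g v) (g w)" using frame_map_frame[OF g *(1)] .
  have 1: "vertex_type c = of_int (index V) + of_int (p + q + r)"
    unfolding c(2) pqr vertex_type_cls[OF fr] index_scale[OF *(1)] by (simp add: V[symmetric])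
  have "on_class g c = cls (B (Xp p * g u) (Xp q * g v) (Xp r * g w))"
    unfolding c(2) pqr on_class_cls[OF g] frame_map_Xp[OF g] ..
  then have "vertex_type (on_class g c) = of_int (index (B (Xp p * g u) (Xp q * g v) (Xp r * g w)))"
    using vertex_type_cls[OF frame_scale[OF gfr]] by simp
  also have "\<dots> = of_int (index (g ` V)) + of_int (p + q + r)"
    unfolding index_scale[OF gfr] by (simp add: frame_map_B[OF g, symmetric] V[symmetric])
  finally show "vertex_type (on_class g c) = vertex_type c + (of_int (index (g ` V)) - of_int (index V))"
    unfolding 1 by simp
qed

section \<open>Thickness\<close>

lemma cls_ne: assumes "frame x y z" "frame x' y' z'" "index (B x y z) = index (B x' y' z')" "B x y z \<noteq> B x' y' z'"
  shows "cls (B x y z) \<noteq> cls (B x' y' z')"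
proof
  assume "cls (B x y z) = cls (B x' y' z')"
  then obtain n where n: "B x' y' z' = sc n (B x y z)" unfolding cls_eq_iff by blast
  then have "n = 0" using index_sc[OF assms(1), of n] assms(3) by simp
  then show False using n assms(4) by simp
qed

lemma B_add: "B x y (y + z) = B x y z"
proof
  show "B x y (y + z) \<subseteq> B x y z"
    by (rule B_least[OF omod_B]) (simp_all add: omodD(2)[OF omod_B])
  have "(y + z) - y \<in> B x y (y + z)" by (rule omodD(5)[OF omod_B]) simp_all
  then show "B x y z \<subseteq> B x y (y + z)" by (intro B_least[OF omod_B]) simp_all
qed

lemma frame_add: assumes "frame x y z" shows "frame x y (y + z)"
proof -
  have "indep x y (y + z)"
    unfolding indep_def
  proof (intro ballI impI)
    fix f g h assume *: "f \<in> F" "g \<in> F" "h \<in> F" "f * x + g * y + h * (y + z) = 0"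
    have "f * x + (g + h) * y + h * z = 0" using *(4) by (simp add: algebra_simps)
    then have "f = 0 \<and> g + h = 0 \<and> h = 0"
      using assms *(1-3) F_add unfolding frame_def indep_def by blast
    then show "f = 0 \<and> g = 0 \<and> h = 0" by auto
  qed
  then show ?thesis using assms by (simp add: frame_def B_add)
qed

text \<open>Shifting the periodic chain makes any two vertices of a chamber the first two, so a
  single kind of panel remains to be treated.\<close>

lemma panel_frame:
  assumes "P \<in> building" "card P = 2"
  obtains x y z where "frame x y z" "P = {cls (B x y z), cls (B (Xp 1 * x) y z)}"
proof -
  obtain x y z where *: "frame x y z" "P \<subseteq> chamber x y z" using assms(1) unfolding building_def by blast
  obtain p q where pq: "P = {p, q}" "p \<noteq> q" using assms(2) card_2_iff by metis
  have 1: "frame y z (Xp 1 * x)" using frame_cyc[OF frame_scale1[OF *(1)]] .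
  have 2: "frame z (Xp 1 * x) (Xp 1 * y)" using frame_cyc[OF frame_scale1[OF 1]] .
  have e1: "B y z (Xp 1 * x) = B (Xp 1 * x) y z" by (rule B_cyc)
  have e2: "B (Xp 1 * y) z (Xp 1 * x) = B (Xp 1 * x) (Xp 1 * y) z" by (rule B_cyc)
  have e3: "B z (Xp 1 * x) (Xp 1 * y) = B (Xp 1 * x) (Xp 1 * y) z" by (rule trans[OF B_cyc B_cyc])
  have "B (Xp 1 * z) (Xp 1 * x) (Xp 1 * y) = sc 1 (B x y z)" unfolding sc_B by (rule trans[OF B_cyc B_cyc])
  then have e4: "cls (B (Xp 1 * z) (Xp 1 * x) (Xp 1 * y)) = cls (B x y z)" by simp
  have "P = {cls (B x y z), cls (B (Xp 1 * x) y z)} \<or>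
    P = {cls (B (Xp 1 * x) y z), cls (B (Xp 1 * x) (Xp 1 * y) z)} \<or>
    P = {cls (B (Xp 1 * x) (Xp 1 * y) z), cls (B x y z)}"
    using *(2) pq unfolding chamber_def by auto
  then show ?thesis
    using that[OF *(1)] that[OF 1, unfolded e1 e2] that[OF 2, unfolded e3 e4] by blast
qed

lemma chamber_card: assumes "frame x y z" shows "card (chamber x y z) = 3"
    "cls (B (Xp 1 * x) (Xp 1 * y) z) \<notin> {cls (B x y z), cls (B (Xp 1 * x) y z)}"
proof -
  let ?a = "cls (B x y z)" and ?b = "cls (B (Xp 1 * x) y z)" and ?c = "cls (B (Xp 1 * x) (Xp 1 * y) z)"
  have ne: "?a \<noteq> ?b" "?a \<noteq> ?c" "?b \<noteq> ?c"
    using vertex_type_chamber[OF assms] distinct_mod_3[of "vertex_type ?a"] by metis+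
  then show "card (chamber x y z) = 3" unfolding chamber_def by simp
  show "?c \<notin> {?a, ?b}" using ne by auto
qed

text \<open>The chambers on this panel correspond to the lines in the plane over k spanned by y and
  z modulo X L. The lines through z, y and y + z are distinct over every field; equal indices let
  the distinct lattices have distinct classes.\<close>

lemma thick_building: "thick building"
  unfolding thick_def
proof (intro ballI impI)
  fix P assume "P \<in> building" "card P = 2"
  then obtain x y z where fr: "frame x y z" and P: "P = {cls (B x y z), cls (B (Xp 1 * x) y z)}"
    by (rule panel_frame)
  have fr2: "frame x z y" using frame_swap[OF frame_cyc[OF frame_cyc[OF fr]]] .
  have unroll: "frame x y (y + z)" using frame_add[OF fr] .
  let ?T1 = "B (Xp 1 * x) (Xp 1 * y) z" and ?T2 = "B (Xp 1 * x) (Xp 1 * z) y"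
    and ?T3 = "B (Xp 1 * x) (Xp 1 * y) (y + z)"
  have sw: "B a z y = B a y z" for a
    by (rule trans[OF B_cyc[symmetric] trans[OF B_swap B_cyc]])
  have fT: "frame (Xp 1 * x) (Xp 1 * y) z" "frame (Xp 1 * x) (Xp 1 * z) y" "frame (Xp 1 * x) (Xp 1 * y) (y + z)"
    using frame_scale[OF fr, of 1 1 0] frame_scale[OF fr2, of 1 1 0] frame_scale[OF unroll, of 1 1 0] by simp_all
  have n: "index ?T1 = index (B x y z) + 2" "index ?T2 = index (B x y z) + 2" "index ?T3 = index (B x y z) + 2"
    using index_scale[OF fr, of 1 1 0] index_scale[OF fr2, of 1 1 0] index_scale[OF unroll, of 1 1 0]
    unfolding sw B_add by simp_all
  have y1: "y \<notin> ?T1"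
    using not_mem_B[of y z "Xp 1 * x"] frame_cyc[OF frame_scale1[OF fr, of 1]] B_cyc[of "Xp 1 * y" z "Xp 1 * x"]
    unfolding frame_def by metis
  have y3: "y \<notin> ?T3"
    using not_mem_B[of y "y + z" "Xp 1 * x"] frame_cyc[OF frame_scale1[OF unroll, of 1]] B_cyc[of "Xp 1 * y" "y + z" "Xp 1 * x"]
    unfolding frame_def by metis
  have y2: "y \<in> ?T2" by simp
  have T13: "?T1 \<noteq> ?T3"
  proof
    assume eq: "?T1 = ?T3"
    have "y + z \<in> ?T1" unfolding eq by simp
    then have "(y + z) - z \<in> ?T1" by (rule omodD(5)[OF omod_B]) simp
    then show False using y1 by simp
  qed
  have ne: "cls ?T1 \<noteq> cls ?T2" "cls ?T1 \<noteq> cls ?T3" "cls ?T2 \<noteq> cls ?T3"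
    using cls_ne[OF fT(1,2)] cls_ne[OF fT(1,3)] cls_ne[OF fT(2,3)] n y1 y2 y3 T13 by metis+
  have ch: "chamber x y z = insert (cls ?T1) P" "chamber x z y = insert (cls ?T2) P" "chamber x y (y + z) = insert (cls ?T3) P"
    unfolding chamber_def P sw B_add by blast+
  have out: "cls ?T1 \<notin> P" "cls ?T2 \<notin> P" "cls ?T3 \<notin> P"
    using chamber_card(2)[OF fr] chamber_card(2)[OF fr2] chamber_card(2)[OF unroll] unfolding P sw B_add by blast+
  have "chamber a b c \<in> {C \<in> building. card C = 3 \<and> P \<subseteq> C}" if "frame a b c" "P \<subseteq> chamber a b c" for a b c
    using that chamber_card(1)[OF that(1)] unfolding building_def by blast
  then have "{insert (cls ?T1) P, insert (cls ?T2) P, insert (cls ?T3) P} \<subseteq> {C \<in> building. card C = 3 \<and> P \<subseteq> C}"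
    using fr fr2 unroll ch by (metis (no_types, lifting) empty_subsetI insert_subset subset_insertI)
  moreover have "card {insert (cls ?T1) P, insert (cls ?T2) P, insert (cls ?T3) P} = 3"
  proof -
    have "insert (cls ?T1) P \<noteq> insert (cls ?T2) P" "insert (cls ?T1) P \<noteq> insert (cls ?T3) P"
      "insert (cls ?T2) P \<noteq> insert (cls ?T3) P"
      using ne out by blast+
    then show ?thesis by simp
  qed
  ultimately show "\<exists>T. T \<subseteq> {C \<in> building. card C = 3 \<and> P \<subseteq> C} \<and> card T = 3"
    by (intro exI[of _ "{insert (cls ?T1) P, insert (cls ?T2) P, insert (cls ?T3) P}"]) simp
qed

end

section \<open>Skew polynomials acting on Laurent series\<close>

locale cyclic_cubic =
  fixes K :: "'a::field set" and sig :: "'a \<Rightarrow> 'a"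
  assumes K: "subfield_of K"
    and sig_add: "sig (a + b) = sig a + sig b" and sig_mult: "sig (a * b) = sig a * sig b"
    and sig_1 [simp]: "sig 1 = 1" and sig3 [simp]: "sig (sig (sig a)) = a"
    and sig_K [simp]: "a \<in> K \<Longrightarrow> sig a \<in> K"
    and three_ne_0: "(3 :: 'a) \<noteq> 0" and sig_nontrivial: "\<exists>a\<in>K. sig a \<noteq> a"
begin

interpretation K: subfield_of K by (rule K)

lemma sig_0 [simp]: "sig 0 = 0"
  using sig_add[of 0 0] by (metis add.right_neutral add_left_cancel)

lemma sig_uminus: "sig (- a) = - sig a"
  using sig_add[of a "- a"] by (simp add: eq_neg_iff_add_eq_0 add.commute)

lemma sig_diff: "sig (a - b) = sig a - sig b"
  using sig_add[of a "- b"] by (simp add: sig_uminus)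

lemma sig_eq_iff [simp]: "sig a = sig b \<longleftrightarrow> a = b"
  by (metis sig3)

lemma sig_eq_0_iff [simp]: "sig a = 0 \<longleftrightarrow> a = 0"
  using sig_eq_iff[of a 0] by simp

lemma sig_inverse: "sig (inverse a) = inverse (sig a)"
proof (cases "a = 0")
  case False
  then have "sig (inverse a) * sig a = 1" by (simp flip: sig_mult)
  then show ?thesis by (metis inverse_unique inverse_inverse_eq)
qed simp

lemma sig_divide: "sig (a / b) = sig a / sig b"
  by (simp add: divide_inverse sig_mult sig_inverse)

lemma sig_sum: "sig (sum f A) = (\<Sum>i\<in>A. sig (f i))"
  by (induction A rule: infinite_finite_induct) (simp_all add: sig_add)

definition k0 :: "'a set" where "k0 = {a \<in> K. sig a = a}"

lemma subfield_k0: "subfield_of k0"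
  by unfold_locales (auto simp: k0_def sig_add sig_mult sig_uminus sig_inverse)

definition V :: "'a fls set" where "V = K.R"

lemma V_iff: "f \<in> V \<longleftrightarrow> (\<forall>n. f $$ n \<in> K) \<and> (\<forall>n<0. f $$ n = 0)"
  by (simp add: V_def K.R_def K.F_def)

sublocale subfield_of k0 by (rule subfield_k0)

lemma R_subset_V: "R \<subseteq> V"
proof
  fix f assume "f \<in> R"
  then have "f $$ n \<in> k0" "n < 0 \<Longrightarrow> f $$ n = 0" for n by (simp_all add: R_def F_def)
  then show "f \<in> V" by (simp add: V_iff k0_def)
qed

sublocale lattices k0 V
proof unfold_locales
  show "omod V" unfolding omod_def V_def
    using R_subset_V by (auto simp: V_def)
qed (simp add: V_iff)

definition sigma :: "'a fls \<Rightarrow> 'a fls" where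
  "sigma f = Abs_fls (\<lambda>n. sig (f $$ n))"

lemma sigma_nth [simp]: "sigma f $$ n = sig (f $$ n)"
proof -
  have "\<forall>\<^sub>\<infinity>n. f $$ (- int n) = 0" by simp
  then have "\<forall>\<^sub>\<infinity>n. sig (f $$ (- int n)) = 0" by simp
  then show ?thesis unfolding sigma_def by (rule nth_Abs_fls)
qed

lemma sigma_add: "sigma (f + g) = sigma f + sigma g"
  by (rule fls_eqI) (simp add: sig_add)

lemma sigma_diff: "sigma (f - g) = sigma f - sigma g"
  by (rule fls_eqI) (simp add: sig_diff)

lemma sigma_0 [simp]: "sigma 0 = 0"
  by (rule fls_eqI) simp

lemma sigma_const: "sigma (fls_const c) = fls_const (sig c)"
  by (rule fls_eqI) simp

lemma sigma_sigma_sigma [simp]: "sigma (sigma (sigma f)) = f"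
  by (rule fls_eqI) simp

lemma sigma_Xp [simp]: "sigma (Xp n) = Xp n"
  by (rule fls_eqI) (simp add: Xp_nth_eq)

lemma sigma_1 [simp]: "sigma 1 = 1"
  using sigma_Xp[of 0] by simp

lemma sigma_subdegree [simp]: "fls_subdegree (sigma f) = fls_subdegree f"
proof (cases "f = 0")
  case False
  show ?thesis
  proof (rule fls_subdegree_eqI)
    show "sigma f $$ fls_subdegree f \<noteq> 0" using False by (simp add: nth_fls_subdegree_nonzero)
  qed simp
qed simp

lemma sigma_mult: "sigma (f * g) = sigma f * sigma g"
  by (rule fls_eqI) (simp add: fls_times_nth(1) sig_sum sig_mult)

lemma sigma_F: assumes "c \<in> F" shows "sigma c = c"
proof (rule fls_eqI)
  fix n
  have "c $$ n \<in> k0" using assms by (simp add: F_def)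
  then show "sigma c $$ n = c $$ n" by (simp add: k0_def)
qed

lemma sigma_V: "f \<in> V \<Longrightarrow> sigma f \<in> V"
  by (simp add: V_iff)

definition s :: "'a fls" where "s = 1 - Xp 1"

definition t :: "'a fls" where "t = 1 - s ^ 3"

lemma s_R: "s \<in> R"
  by (simp add: s_def)

lemma t_R: "t \<in> R"
  unfolding t_def using s_R by (simp add: power3_eq_cube)

lemma sigma_s [simp]: "sigma s = s"
  by (simp add: s_def sigma_diff)

text \<open>The cofactor in 1 - (1 - X)^3 = X (3 - 3 X + X^2). Its constant term 3 must be nonzero
  for it to be a unit.\<close>

definition eta :: "'a fls" where "eta = 3 - 3 * Xp 1 + Xp 1 * Xp 1"

lemma three_R: "3 \<in> R"
  using R_add[OF R_add[OF R_1 R_1] R_1] by simp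

lemma t_eta: "t = Xp 1 * eta"
  by (simp add: t_def s_def eta_def power3_eq_cube algebra_simps)

lemma eta_R: "eta \<in> R"
  unfolding eta_def using three_R by simp

lemma eta_0: "eta $$ 0 = 3"
  by (simp add: eta_def Xp_nth_eq mult.commute[of 3])

lemma eta_nonzero: "eta \<noteq> 0"
  using eta_0 three_ne_0 by auto

text \<open>The inverse exists among all Laurent series; that its coefficients stay in
  \<open>k0\<close> follows from the three-term recursion that \<open>eta * g = 1\<close> imposes,
  solved for the newest coefficient by dividing by 3.\<close>

lemma inverse_eta_R: "inverse eta \<in> R"
proof -
  define g where "g = inverse eta"
  have eg: "eta * g = 1" using eta_nonzero by (simp add: g_def)
  have sub: "fls_subdegree eta = 0"
    by (rule fls_subdegree_eqI) (use eta_0 three_ne_0 eta_R in \<open>auto simp: R_def\<close>)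
  have neg: "g $$ n = 0" if "n < 0" for n
    using that sub unfolding g_def by (intro fls_eq0_below_subdegree) simp
  have three: "(3 * f) $$ n = 3 * f $$ n" for f :: "'a fls" and n
  proof -
    have "3 * f = f + f + f" by simp
    then have "(3 * f) $$ n = f $$ n + f $$ n + f $$ n" by (simp only: fls_plus_nth)
    then show ?thesis by simp
  qed
  have "3 * g - 3 * (Xp 1 * g) + Xp 1 * (Xp 1 * g) = 1"
    using eg unfolding eta_def by (simp only: distrib_right left_diff_distrib mult.assoc)
  then have "(3 * g - 3 * (Xp 1 * g) + Xp 1 * (Xp 1 * g)) $$ n = (1 :: 'a fls) $$ n" for n by (simp only:)
  then have "3 * g $$ n - 3 * g $$ (n - 1) + g $$ (n - 1 - 1) = (if n = 0 then 1 else 0)" for n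
    by (simp only: fls_plus_nth fls_minus_nth three Xp_nth fls_one_nth)
  from this[symmetric] have rec: "3 * g $$ n = 3 * g $$ (n - 1) - g $$ (n - 1 - 1) + (if n = 0 then 1 else 0)" for n
    by simp
  have 3: "(3 :: 'a) \<in> k0"
    using add_mem[OF add_mem[OF one_mem one_mem] one_mem] by simp
  have "g $$ int n \<in> k0" for n
  proof (induction n rule: less_induct)
    case (less n)
    have prev: "g $$ (int n - int j) \<in> k0" if "j > 0" for j
      using less.IH[of "n - j"] neg[of "int n - int j"] that by (cases "j \<le> n") (auto simp: of_nat_diff)
    have "3 * g $$ int n \<in> k0"
      unfolding rec[of "int n"] using prev[of 1] prev[of 2] 3 by (auto simp: diff_diff_eq)
    then have "3 * g $$ int n / 3 \<in> k0" using 3 by (intro divide_mem)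
    then show ?case using three_ne_0 by simp
  qed
  then have "g $$ n \<in> k0" for n using neg[of n] by (cases n) auto
  then show ?thesis using neg unfolding g_def[symmetric] by (simp add: R_def F_def)
qed

lemma t_nonzero: "t \<noteq> 0"
  using eta_nonzero by (simp add: t_eta)

lemma omod_pow: "omod L \<Longrightarrow> c \<in> R \<Longrightarrow> x \<in> L \<Longrightarrow> c ^ m * x \<in> L"
  by (induction m) (simp_all add: omodD(3) mult.assoc)

lemma Xp_1_power: "Xp 1 ^ m = Xp (int m)"
  by (induction m) (simp_all add: Xp_add)

lemma t_image: assumes "omod L" shows "(\<lambda>f. t ^ m * f) ` L = sc (int m) L"
proof
  show "(\<lambda>f. t ^ m * f) ` L \<subseteq> sc (int m) L"
  proof
    fix v assume "v \<in> (\<lambda>f. t ^ m * f) ` L"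
    then obtain f where "f \<in> L" "v = t ^ m * f" by blast
    moreover have "t ^ m * f = Xp (int m) * (eta ^ m * f)"
      by (simp add: t_eta power_mult_distrib Xp_1_power mult.assoc)
    ultimately show "v \<in> sc (int m) L" using omod_pow[OF assms eta_R] by (simp add: mem_sc)
  qed
  show "sc (int m) L \<subseteq> (\<lambda>f. t ^ m * f) ` L"
  proof
    fix v assume "v \<in> sc (int m) L"
    then obtain f where f: "f \<in> L" "v = Xp (int m) * f" unfolding sc_def by blast
    have "t ^ m * (inverse eta ^ m * f) = Xp (int m) * ((eta * inverse eta) ^ m * f)"
      by (simp add: t_eta power_mult_distrib Xp_1_power mult_ac)
    also have "\<dots> = v" using eta_nonzero f(2) by simp
    finally have "v = t ^ m * (inverse eta ^ m * f)" ..
    moreover have "inverse eta ^ m * f \<in> L" using omod_pow[OF assms inverse_eta_R f(1)] .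
    ultimately show "v \<in> (\<lambda>f. t ^ m * f) ` L" by blast
  qed
qed

text \<open>The variable of the skew polynomial ring acts as \<open>z_op\<close>, its other elements through \<open>act\<close>.\<close>

definition z_op :: "'a fls \<Rightarrow> 'a fls" where "z_op f = s * sigma f"

definition act :: "'a poly \<Rightarrow> 'a fls \<Rightarrow> 'a fls" where
  "act p f = (\<Sum>i\<le>degree p. fls_const (coeff p i) * (z_op ^^ i) f)"

lemma act_bound: assumes "degree p \<le> n" shows "act p f = (\<Sum>i\<le>n. fls_const (coeff p i) * (z_op ^^ i) f)"
  unfolding act_def
  by (rule sum.mono_neutral_left) (use assms in \<open>auto simp: coeff_eq_0\<close>)

lemma act_0 [simp]: "act 0 f = 0"
  by (simp add: act_def)

lemma act_pCons: "act (pCons a p) f = fls_const a * f + act p (z_op f)"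
proof -
  have "act (pCons a p) f = (\<Sum>i\<le>Suc (degree p). fls_const (coeff (pCons a p) i) * (z_op ^^ i) f)"
    by (rule act_bound) simp
  also have "\<dots> = fls_const a * f + (\<Sum>i\<le>degree p. fls_const (coeff p i) * (z_op ^^ i) (z_op f))"
    by (subst sum.atMost_Suc_shift) (simp add: funpow_swap1)
  finally show ?thesis by (simp add: act_def)
qed

lemma z_op_add: "z_op (f + g) = z_op f + z_op g"
  by (simp add: z_op_def sigma_add algebra_simps)

lemma act_add: "act p (f + g) = act p f + act p g"
  by (induction p arbitrary: f g) (simp_all add: act_pCons z_op_add algebra_simps)

lemma z_op_z_op_z_op: "z_op (z_op (z_op f)) = s ^ 3 * f"
  by (simp add: z_op_def sigma_mult power3_eq_cube mult.assoc)

lemma z_op_mult: "z_op (c * f) = sigma c * z_op f"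
  by (simp add: z_op_def sigma_mult)

lemma act_mult: "c \<in> F \<Longrightarrow> act p (c * f) = c * act p f"
proof (induction p arbitrary: f)
  case (pCons a p)
  then show ?case by (simp add: act_pCons z_op_mult sigma_F distrib_left mult.left_commute)
qed simp

lemma act_poly_add: "act (p + q) f = act p f + act q f"
proof -
  define n where "n = max (degree p) (degree q)"
  have "degree (p + q) \<le> n" unfolding n_def by (rule degree_add_le_max)
  moreover have "degree p \<le> n" "degree q \<le> n" by (simp_all add: n_def)
  ultimately show ?thesis
    by (simp add: act_bound[of _ n] fls_plus_const[symmetric] sum.distrib distrib_right)
qed

lemma act_smult: "act (smult c p) f = fls_const c * act p f"
  by (induction p arbitrary: f) (simp_all add: act_pCons algebra_simps flip: fls_const_mult_const)

lemma coeffs_in_K_pCons: "(\<forall>i. coeff (pCons a p) i \<in> K) \<longleftrightarrow> a \<in> K \<and> (\<forall>i. coeff p i \<in> K)"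
  by (auto simp: coeff_pCons split: nat.splits)

lemma z_op_V: "f \<in> V \<Longrightarrow> z_op f \<in> V"
  unfolding z_op_def using omodD(3)[OF omod_V s_R sigma_V] .

lemma const_V: "c \<in> K \<Longrightarrow> f \<in> V \<Longrightarrow> fls_const c * f \<in> V"
  by (simp add: V_iff)

lemma act_V: "\<forall>i. coeff p i \<in> K \<Longrightarrow> f \<in> V \<Longrightarrow> act p f \<in> V"
proof (induction p arbitrary: f)
  case 0
  then show ?case by (simp add: omodD(1)[OF omod_V])
next
  case (pCons a p)
  then have "a \<in> K" "\<forall>i. coeff p i \<in> K" unfolding coeffs_in_K_pCons by auto
  then show ?case
    unfolding act_pCons using pCons.IH[OF _ z_op_V] pCons.prems(2) by (intro omodD(2)[OF omod_V] const_V) auto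
qed

text \<open>Left multiplication by z, according to the rule z a = \<sigma>(a) z.\<close>

definition z_mult :: "'a poly \<Rightarrow> 'a poly" where "z_mult p = pCons 0 (map_poly sig p)"

text \<open>The product of K[z; \<sigma>], with skew polynomials stored as ordinary polynomials
  whose coefficients stand on the left. Identities between products are obtained from the faithful
  action instead of from ring axioms.\<close>

definition skew_mult :: "'a poly \<Rightarrow> 'a poly \<Rightarrow> 'a poly" where
  "skew_mult p q = (\<Sum>i\<le>degree p. smult (coeff p i) ((z_mult ^^ i) q))"

lemma skew_mult_pCons: "skew_mult (pCons a p) q = smult a q + skew_mult p (z_mult q)"
proof -
  have bound: "skew_mult p q = (\<Sum>i\<le>n. smult (coeff p i) ((z_mult ^^ i) q))" if "degree p \<le> n" for p q n
    unfolding skew_mult_def by (rule sum.mono_neutral_left) (use that in \<open>auto simp: coeff_eq_0\<close>)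
  have "skew_mult (pCons a p) q = (\<Sum>i\<le>Suc (degree p). smult (coeff (pCons a p) i) ((z_mult ^^ i) q))"
    by (rule bound) simp
  also have "\<dots> = smult a q + (\<Sum>i\<le>degree p. smult (coeff p i) ((z_mult ^^ i) (z_mult q)))"
    by (subst sum.atMost_Suc_shift) (simp add: funpow_swap1)
  finally show ?thesis by (simp add: skew_mult_def)
qed

lemma skew_mult_0 [simp]: "skew_mult 0 q = 0"
  by (simp add: skew_mult_def)

lemma map_poly_sig_pCons: "map_poly sig (pCons a p) = pCons (sig a) (map_poly sig p)"
  by (simp add: map_poly_pCons)

lemma act_z_mult: "act (z_mult p) f = z_op (act p f)"
  unfolding z_mult_def
proof (induction p arbitrary: f)
  case (pCons a p)
  have "act (pCons 0 (map_poly sig (pCons a p))) f = fls_const (sig a) * z_op f + act (map_poly sig p) (z_op (z_op f))"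
    unfolding map_poly_sig_pCons by (simp add: act_pCons)
  also have "act (map_poly sig p) (z_op (z_op f)) = z_op (act p (z_op f))"
    using pCons.IH[of "z_op f"] by (simp add: act_pCons)
  finally show ?case by (simp add: act_pCons z_op_add z_op_mult sigma_const)
qed (simp add: z_op_def act_pCons)

lemma act_skew_mult: "act (skew_mult p q) f = act p (act q f)"
  by (induction p arbitrary: q f) (simp_all add: skew_mult_pCons act_poly_add act_smult act_pCons act_z_mult)

lemma coeff_z_mult: "coeff (z_mult q) 0 = 0" "coeff (z_mult q) (Suc n) = sig (coeff q n)"
  by (simp_all add: z_mult_def coeff_map_poly)

lemma z_mult_eq_0_iff: "z_mult q = 0 \<longleftrightarrow> q = 0"
  by (simp add: z_mult_def map_poly_eq_0_iff)

lemma degree_z_mult: "q \<noteq> 0 \<Longrightarrow> degree (z_mult q) = Suc (degree q)"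
  by (simp add: z_mult_def map_poly_eq_0_iff degree_map_poly)

lemma coeff_skew_mult_0: "coeff (skew_mult p q) 0 = coeff p 0 * coeff q 0"
proof (cases p)
  case (pCons a p')
  have "coeff (skew_mult r (z_mult q)) 0 = 0" for r q
    by (induction r arbitrary: q) (simp_all add: skew_mult_pCons coeff_z_mult)
  then show ?thesis by (simp add: pCons skew_mult_pCons)
qed

lemma coeff_skew_mult_K:
  assumes "\<forall>i. coeff p i \<in> K" "\<forall>i. coeff q i \<in> K" shows "\<forall>i. coeff (skew_mult p q) i \<in> K"
  using assms
proof (induction p arbitrary: q)
  case (pCons a p)
  have 1: "a \<in> K" "\<forall>i. coeff p i \<in> K" using pCons.prems(1) unfolding coeffs_in_K_pCons by auto
  have "coeff (z_mult q) i \<in> K" for i using pCons.prems(2) by (cases i) (simp_all add: coeff_z_mult)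
  then have "\<forall>i. coeff (skew_mult p (z_mult q)) i \<in> K" using pCons.IH 1(2) by blast
  then show ?case using 1(1) pCons.prems(2) by (simp add: skew_mult_pCons)
qed simp

text \<open>Since \<sigma> is injective, left multiplication by z raises the degree by exactly one,
  so the top term of \<open>p\<close> always dominates.\<close>

lemma degree_skew_mult: assumes "p \<noteq> 0" "q \<noteq> 0" shows "skew_mult p q \<noteq> 0 \<and> degree (skew_mult p q) = degree p + degree q"
  using assms
proof (induction p arbitrary: q)
  case (pCons a p)
  show ?case
  proof (cases "p = 0")
    case True
    then show ?thesis using pCons by (simp add: skew_mult_pCons)
  next
    case False
    have *: "skew_mult p (z_mult q) \<noteq> 0" "degree (skew_mult p (z_mult q)) = degree p + Suc (degree q)"
      using pCons.IH[OF False, of "z_mult q"] pCons.prems(2) by (simp_all add: z_mult_eq_0_iff degree_z_mult)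
    have "degree (smult a q) < degree (skew_mult p (z_mult q))"
      unfolding *(2) using degree_smult_le[of a q] by linarith
    then have d: "degree (skew_mult (pCons a p) q) = degree (skew_mult p (z_mult q))"
      unfolding skew_mult_pCons by (rule degree_add_eq_right)
    moreover have "degree (skew_mult (pCons a p) q) \<noteq> 0" unfolding d *(2) by simp
    then have "skew_mult (pCons a p) q \<noteq> 0" by auto
    ultimately show ?thesis using False *(2) by simp
  qed
qed simp

text \<open>As s is fixed by \<sigma>, z multiplies powers of s by s. On them a skew polynomial
  therefore acts by its ordinary value at s = 1 - X, and this value vanishes only for the zero
  polynomial.\<close>

lemma act_pow_s: "act p (s ^ j) = s ^ j * fps_to_fls (fps_of_poly (pcompose p [:1, -1:]))"
proof (induction p arbitrary: j)
  case (pCons a p)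
  have z: "z_op (s ^ j) = s ^ Suc j"
  proof -
    have "sigma (s ^ j) = s ^ j" for j by (induction j) (simp_all add: sigma_mult)
    then show ?thesis by (simp add: z_op_def)
  qed
  have X: "fps_to_fls (fps_of_poly [:1, -1:]) = s"
  proof (rule fls_eqI)
    fix n show "fps_to_fls (fps_of_poly [:1, - 1 :: 'a:]) $$ n = s $$ n"
      by (auto simp: s_def Xp_nth_eq coeff_pCons nat_diff_split split: nat.splits)
  qed
  have c: "fps_to_fls (fps_of_poly [:a:]) = fls_const a"
    by (simp add: fps_of_poly_const fps_const_to_fls)
  show ?case
    unfolding act_pCons z pCons.IH pcompose_pCons fps_of_poly_add fps_of_poly_mult fps_to_fls_plus
      fls_times_fps_to_fls X c by (simp add: algebra_simps)
qed simp

lemma act_inj: assumes "\<And>f. act p f = act q f" shows "p = q"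
proof -
  have "act (p - q) 1 = 0"
    using assms[of 1] act_poly_add[of "p - q" q 1] by simp
  then have "fps_of_poly (pcompose (p - q) [:1, -1:]) = 0"
    using act_pow_s[of "p - q" 0] by simp
  then have "pcompose (p - q) [:1, -1:] = 0"
    using fps_of_poly_eq_iff[of _ 0] by (metis fps_of_poly_0)
  then have "p - q = 0" by (rule pcompose_eq_0) simp
  then show ?thesis by simp
qed

lemma act_1 [simp]: "act 1 f = f"
  by (simp add: one_pCons act_pCons)

text \<open>Faithfulness turns the hypothesis into \<open>skew_mult p q = 1\<close>, and degrees
  add.\<close>

lemma unit_const:
  assumes "\<And>f. act p (act q f) = f" shows "degree p = 0"
proof -
  have 1: "skew_mult p q = 1" by (rule act_inj) (simp add: act_skew_mult assms)
  have "p \<noteq> 0" using assms[of 1] by auto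
  moreover have "q \<noteq> 0" using assms[of 1] act_mult[of 0 p 0] by auto
  ultimately have "skew_mult p q \<noteq> 0 \<and> degree (skew_mult p q) = degree p + degree q" by (rule degree_skew_mult)
  then show ?thesis using 1 by simp
qed

section \<open>A group acting on the lattice classes\<close>

definition gen :: 'a where "gen = (SOME a. a \<in> K \<and> sig a \<noteq> a)"

lemma gen: "gen \<in> K" "sig gen \<noteq> gen" "sig (sig gen) \<noteq> gen" "sig (sig gen) \<noteq> sig gen"
proof -
  have "\<exists>a. a \<in> K \<and> sig a \<noteq> a" using sig_nontrivial by blast
  then have *: "gen \<in> K \<and> sig gen \<noteq> gen" unfolding gen_def by (rule someI_ex)
  then show "gen \<in> K" "sig gen \<noteq> gen" "sig (sig gen) \<noteq> sig gen" by auto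
  show "sig (sig gen) \<noteq> gen"
  proof
    assume "sig (sig gen) = gen"
    then have "sig (sig (sig gen)) = sig gen" by simp
    then show False using * by simp
  qed
qed

text \<open>Applying \<sigma> shows that the quadratic also vanishes at the two other conjugates of
  \<open>gen\<close>; since these are distinct, divided differences eliminate the coefficients from
  the top.\<close>

lemma gen_indep:
  assumes "c0 \<in> k0" "c1 \<in> k0" "c2 \<in> k0" "c0 + c1 * gen + c2 * gen ^ 2 = 0"
  shows "c0 = 0" "c1 = 0" "c2 = 0"
proof -
  let ?a = gen and ?b = "sig gen" and ?c = "sig (sig gen)"
  have fixed: "sig c0 = c0" "sig c1 = c1" "sig c2 = c2" using assms by (auto simp: k0_def)
  have 0: "c0 + c1 * ?a + c2 * (?a * ?a) = 0" using assms(4) by (simp add: power2_eq_square)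
  have 1: "c0 + c1 * ?b + c2 * (?b * ?b) = 0"
    using arg_cong[OF 0, of sig] by (simp add: sig_add sig_mult fixed)
  have "(?a - ?b) * (c1 + c2 * (?a + ?b)) = 0" using 0 1 by algebra
  then have 2: "c1 + c2 * (?a + ?b) = 0" using gen(2) by simp
  have 3: "c1 + c2 * (?b + ?c) = 0"
    using arg_cong[OF 2, of sig] by (simp add: sig_add sig_mult fixed)
  have "(?a - ?c) * c2 = 0" using 2 3 by algebra
  then show "c2 = 0" using gen(3) by simp
  then show "c1 = 0" using 2 by simp
  then show "c0 = 0" using 0 \<open>c2 = 0\<close> by simp
qed

text \<open>Newton interpolation at the conjugates of \<open>gen\<close>: the divided differences are invariant.\<close>

lemma gen_span:
  assumes y: "y \<in> K"
  shows "\<exists>c0\<in>k0. \<exists>c1\<in>k0. \<exists>c2\<in>k0. y = c0 + c1 * gen + c2 * gen ^ 2"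
proof -
  let ?a = gen and ?b = "sig gen" and ?c = "sig (sig gen)"
  let ?y1 = "sig y" and ?y2 = "sig (sig y)"
  have ne: "?a - ?b \<noteq> 0" "?b - ?c \<noteq> 0" "?c - ?a \<noteq> 0" "?a - ?c \<noteq> 0" using gen(2-4) by auto
  define d0 d1 d2 where "d0 = (y - ?y1) / (?a - ?b)" and "d1 = (?y1 - ?y2) / (?b - ?c)"
    and "d2 = (?y2 - y) / (?c - ?a)"
  have d: "d0 * (?a - ?b) = y - ?y1" "d1 * (?b - ?c) = ?y1 - ?y2" "d2 * (?c - ?a) = ?y2 - y"
    using ne by (simp_all add: d0_def d1_def d2_def)
  have sd: "sig d0 = d1" "sig d1 = d2" by (simp_all add: d0_def d1_def d2_def sig_divide sig_diff)
  define c2 where "c2 = (d0 - d1) / (?a - ?c)"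
  have c2: "c2 * (?a - ?c) = d0 - d1" using ne by (simp add: c2_def)
  have "sig c2 = (d1 - d2) / (?b - ?a)" by (simp add: c2_def sig_divide sig_diff sd)
  \<comment> \<open>The numerators of \<open>d0\<close>, \<open>d1\<close>, \<open>d2\<close> add up
    to zero; this relation makes the second divided difference symmetric in the conjugates.\<close>
  moreover have "(d1 - d2) * (?c - ?a) = c2 * (?b - ?a) * (?c - ?a)" using d c2 by algebra
  then have "d1 - d2 = c2 * (?b - ?a)" using ne(3) by simp
  ultimately have f2: "sig c2 = c2" using ne(1) by auto
  define c1 where "c1 = d0 - c2 * (?a + ?b)"
  have f1: "sig c1 = c1"
  proof -
    have "sig c1 = d1 - c2 * (?b + ?c)" by (simp add: c1_def sig_diff sig_mult sig_add sd f2)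
    also have "\<dots> = c1" using c2 unfolding c1_def by algebra
    finally show ?thesis .
  qed
  define c0 where "c0 = y - c1 * ?a - c2 * (?a * ?a)"
  have f0: "sig c0 = c0"
  proof -
    have "sig c0 = ?y1 - c1 * ?b - c2 * (?b * ?b)" by (simp add: c0_def sig_diff sig_mult f1 f2)
    also have "\<dots> = c0" using d(1) unfolding c0_def c1_def by algebra
    finally show ?thesis .
  qed
  have dK: "d0 \<in> K" "d1 \<in> K" unfolding d0_def d1_def using y gen(1) by simp_all
  then have K2: "c2 \<in> K" unfolding c2_def using gen(1) by simp
  then have K1: "c1 \<in> K" unfolding c1_def using dK gen(1) by simp
  then have K0: "c0 \<in> K" unfolding c0_def using K2 y gen(1) by simp
  have "y = c0 + c1 * gen + c2 * gen ^ 2" by (simp add: c0_def power2_eq_square)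
  then show ?thesis using K0 K1 K2 f0 f1 f2 unfolding k0_def by blast
qed

section \<open>K[[X]] as the base lattice\<close>

lemma one_V: "1 \<in> V"
  by (simp add: V_iff)

text \<open>Both claims are checked at each power of X, where they say that 1, gen, gen^2 form a
  basis of \<open>K\<close> over \<open>k0\<close>.\<close>

lemma gen_frame: "indep 1 (fls_const gen) (fls_const (gen ^ 2))"
    "B 1 (fls_const gen) (fls_const (gen ^ 2)) = V"
proof -
  show "indep 1 (fls_const gen) (fls_const (gen ^ 2))"
    unfolding indep_def
  proof (intro ballI impI)
    fix f g h assume *: "f \<in> F" "g \<in> F" "h \<in> F" "f * 1 + g * fls_const gen + h * fls_const (gen ^ 2) = 0"
    have "f $$ n + g $$ n * gen + h $$ n * gen ^ 2 = 0" for n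
      using arg_cong[OF *(4), of "\<lambda>f. f $$ n"] by simp
    moreover have "f $$ n \<in> k0" "g $$ n \<in> k0" "h $$ n \<in> k0" for n using *(1-3) by (simp_all add: F_def)
    ultimately have "f $$ n = 0" "g $$ n = 0" "h $$ n = 0" for n using gen_indep by blast+
    then show "f = 0 \<and> g = 0 \<and> h = 0" by (simp add: fls_eq_iff)
  qed
  show "B 1 (fls_const gen) (fls_const (gen ^ 2)) = V"
  proof
    show "B 1 (fls_const gen) (fls_const (gen ^ 2)) \<subseteq> V"
      by (rule B_least[OF omod_V]) (use gen(1) in \<open>auto simp: V_iff power2_eq_square\<close>)
    show "V \<subseteq> B 1 (fls_const gen) (fls_const (gen ^ 2))"
    proof
      fix f assume f: "f \<in> V"
      have "\<forall>n::nat. \<exists>c. fst c \<in> k0 \<and> fst (snd c) \<in> k0 \<and> snd (snd c) \<in> k0 \<and>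
          f $$ int n = fst c + fst (snd c) * gen + snd (snd c) * gen ^ 2"
      proof
        fix n :: nat
        have "f $$ int n \<in> K" using f by (simp add: V_iff)
        then obtain c0 c1 c2 where "c0 \<in> k0" "c1 \<in> k0" "c2 \<in> k0" "f $$ int n = c0 + c1 * gen + c2 * gen ^ 2"
          using gen_span by blast
        then show "\<exists>c. fst c \<in> k0 \<and> fst (snd c) \<in> k0 \<and> snd (snd c) \<in> k0 \<and>
          f $$ int n = fst c + fst (snd c) * gen + snd (snd c) * gen ^ 2"
          by (intro exI[of _ "(c0, c1, c2)"]) simp
      qed
      then obtain c where c: "\<forall>n::nat. fst (c n) \<in> k0 \<and> fst (snd (c n)) \<in> k0 \<and> snd (snd (c n)) \<in> k0 \<and>
          f $$ int n = fst (c n) + fst (snd (c n)) * gen + snd (snd (c n)) * gen ^ 2"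
        by (rule choice[THEN exE])
      define g where "g u = fps_to_fls (Abs_fps u)" for u :: "nat \<Rightarrow> 'a"
      have gR: "g u \<in> R" if "\<forall>n. u n \<in> k0" for u using that by (simp add: g_def R_def F_def)
      have "f = g (\<lambda>n. fst (c n)) * 1 + g (\<lambda>n. fst (snd (c n))) * fls_const gen +
          g (\<lambda>n. snd (snd (c n))) * fls_const (gen ^ 2)"
      proof (rule fls_eqI)
        fix n :: int
        have "f $$ n = 0" if "n < 0" using f that by (simp add: V_iff)
        moreover have "f $$ n = fst (c (nat n)) + fst (snd (c (nat n))) * gen + snd (snd (c (nat n))) * gen ^ 2" if "n \<ge> 0"
          using c[rule_format, of "nat n"] that by simp
        ultimately show "f $$ n = (g (\<lambda>n. fst (c n)) * 1 + g (\<lambda>n. fst (snd (c n))) * fls_const gen +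
          g (\<lambda>n. snd (snd (c n))) * fls_const (gen ^ 2)) $$ n"
          by (cases "n < 0") (simp_all add: g_def)
      qed
      moreover have "g (\<lambda>n. fst (c n)) \<in> R" "g (\<lambda>n. fst (snd (c n))) \<in> R" "g (\<lambda>n. snd (snd (c n))) \<in> R"
        using c by (auto intro!: gR)
      ultimately show "f \<in> B 1 (fls_const gen) (fls_const (gen ^ 2))" by (metis BI)
    qed
  qed
qed

lemma bounded_V: "bounded V"
  by (rule boundedI[of 0 _ 0]) simp_all

sublocale lattice_building k0 V 1 "fls_const gen" "fls_const (gen ^ 2)"
  by unfold_locales (simp_all add: frame_def gen_frame bounded_V)

text \<open>\<open>p\<close> is the group element; its cofactor \<open>q\<close> is carried along
  because modulo powers of t it is the inverse of \<open>p\<close>.\<close>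

definition inverse_pair :: "'a poly \<Rightarrow> 'a poly \<Rightarrow> nat \<Rightarrow> bool" where
  "inverse_pair p q m \<longleftrightarrow> (\<forall>i. coeff p i \<in> K) \<and> (\<forall>i. coeff q i \<in> K) \<and> coeff p 0 = 1 \<and> coeff q 0 = 1 \<and>
     (\<forall>f. act p (act q f) = t ^ m * f) \<and> (\<forall>f. act q (act p f) = t ^ m * f)"

lemma inverse_pair_sym: "inverse_pair p q m \<Longrightarrow> inverse_pair q p m"
  by (simp add: inverse_pair_def)

lemma inverse_pairD:
  assumes "inverse_pair p q m"
  shows "act p (act q f) = t ^ m * f" "act q (act p f) = t ^ m * f" "f \<in> V \<Longrightarrow> act p f \<in> V"
  using assms act_V by (simp_all add: inverse_pair_def)

lemma t_F: "t ^ m \<in> F"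
  using R_imp_F[OF t_R] by (induction m) auto

lemma inverse_pair_skew_mult:
  assumes "inverse_pair p q m" "inverse_pair p' q' m'"
  shows "inverse_pair (skew_mult p p') (skew_mult q' q) (m + m')"
  unfolding inverse_pair_def
proof (intro conjI allI)
  show "coeff (skew_mult p p') i \<in> K" for i using assms coeff_skew_mult_K unfolding inverse_pair_def by blast
  show "coeff (skew_mult q' q) i \<in> K" for i using assms coeff_skew_mult_K unfolding inverse_pair_def by blast
  show "coeff (skew_mult p p') 0 = 1" "coeff (skew_mult q' q) 0 = 1"
    using assms by (simp_all add: coeff_skew_mult_0 inverse_pair_def)
  show "act (skew_mult p p') (act (skew_mult q' q) f) = t ^ (m + m') * f" for f
    unfolding act_skew_mult inverse_pairD[OF assms(2)] act_mult[OF t_F] inverse_pairD[OF assms(1)]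
    by (simp add: power_add mult_ac)
  show "act (skew_mult q' q) (act (skew_mult p p') f) = t ^ (m + m') * f" for f
    unfolding act_skew_mult inverse_pairD[OF assms(1)] act_mult[OF t_F] inverse_pairD[OF assms(2)]
    by (simp add: power_add mult_ac)
qed

lemma act_eq_0: assumes "inverse_pair p q m" "act p f = 0" shows "f = 0"
proof -
  have "act q (act p f) = 0" unfolding assms(2) using act_mult[of 0 q 0] by simp
  then show ?thesis using inverse_pairD(2)[OF assms(1), of f] t_nonzero by simp
qed

lemma F_linear_act: "F_linear (act p)"
  by (simp add: F_linear_def act_add act_mult)

lemma act_image_B: "act p ` B x y z = B (act p x) (act p y) (act p z)"
  by (rule F_linear_B[OF F_linear_act])

lemma act_sc: "act p ` sc n L = sc n (act p ` L)"
  by (simp add: sc_def image_image act_mult)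

text \<open>Since p and q preserve \<open>V\<close> and p q = t^m, the image p V lies between t^m V
  and \<open>V\<close>; this keeps images of lattices commensurable with \<open>V\<close>.\<close>

lemma frame_map_act: assumes pq: "inverse_pair p q m" shows "frame_map (act p)"
  unfolding frame_map_def
proof (intro conjI allI impI)
  fix x y z assume fr: "frame x y z"
  have "indep (act p x) (act p y) (act p z)"
    unfolding indep_def
  proof (intro ballI impI)
    fix f g h assume *: "f \<in> F" "g \<in> F" "h \<in> F" "f * act p x + g * act p y + h * act p z = 0"
    then have "act p (f * x + g * y + h * z) = 0" by (simp add: act_add act_mult)
    then have "f * x + g * y + h * z = 0" by (rule act_eq_0[OF pq])
    then show "f = 0 \<and> g = 0 \<and> h = 0" using fr *(1-3) unfolding frame_def indep_def by blast
  qed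
  moreover have "bounded (act p ` B x y z)"
  proof -
    obtain n where n: "sc n V \<subseteq> B x y z" "B x y z \<subseteq> sc (- n) V"
      using fr unfolding frame_def bounded_def by blast
    have pV: "act p ` V \<subseteq> V" using inverse_pairD(3)[OF pq] by blast
    have qV: "act q ` V \<subseteq> V" using inverse_pairD(3)[OF inverse_pair_sym[OF pq]] by blast
    have "act p ` B x y z \<subseteq> sc (- n) (act p ` V)" using image_mono[OF n(2), of "act p"] by (simp add: act_sc)
    then have up: "act p ` B x y z \<subseteq> sc (- n) V" using sc_mono[OF pV] by blast
    have "sc (int m) V = (\<lambda>f. t ^ m * f) ` V" by (rule t_image[OF omod_V, symmetric])
    also have "\<dots> = act p ` act q ` V" by (simp add: image_image inverse_pairD(1)[OF pq])
    also have "\<dots> \<subseteq> act p ` V" by (rule image_mono[OF qV])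
    finally have "sc n (sc (int m) V) \<subseteq> sc n (act p ` V)" by (rule sc_mono)
    also have "\<dots> \<subseteq> act p ` B x y z" using image_mono[OF n(1), of "act p"] by (simp add: act_sc)
    finally show ?thesis using up by (intro boundedI) simp_all
  qed
  ultimately show "frame (act p x) (act p y) (act p z)"
    by (simp add: frame_def act_image_B)
qed (rule F_linear_act)

lemma cls_t_image: "omod L \<Longrightarrow> cls ((\<lambda>f. t ^ m * f) ` L) = cls L"
  by (simp add: t_image)

lemma on_class_inverse_pair:
  assumes pq: "inverse_pair p q m" and c: "c \<in> vertices building"
  shows "on_class (act p) (on_class (act q) c) = c"
proof -
  obtain x y z where *: "frame x y z" "c = cls (B x y z)" using c unfolding vertices_building by blast
  have "on_class (act p) (on_class (act q) c) = cls (B (act p (act q x)) (act p (act q y)) (act p (act q z)))"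
    unfolding *(2) on_class_cls[OF frame_map_act[OF inverse_pair_sym[OF pq]]] on_class_cls[OF frame_map_act[OF pq]] ..
  also have "B (act p (act q x)) (act p (act q y)) (act p (act q z)) = act p ` act q ` B x y z"
    by (simp only: act_image_B)
  also have "\<dots> = (\<lambda>f. t ^ m * f) ` B x y z" by (simp add: image_image inverse_pairD(1)[OF pq])
  also have "cls \<dots> = c" unfolding *(2) by (rule cls_t_image[OF omod_B])
  finally show ?thesis .
qed

lemma on_class_vertex: "frame_map g \<Longrightarrow> c \<in> vertices building \<Longrightarrow> on_class g c \<in> vertices building"
  unfolding vertices_building using on_class_cls frame_map_frame by blast

lemma on_class_building: assumes "frame_map g" "A \<in> building" shows "on_class g ` A \<in> building"
proof -
  obtain x y z where "frame x y z" "A \<subseteq> chamber x y z" using assms(2) unfolding building_def by blast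
  then have "on_class g ` A \<subseteq> chamber (g x) (g y) (g z)" "frame (g x) (g y) (g z)"
    using on_class_chamber[OF assms(1), of x y z] frame_map_frame[OF assms(1)] by blast+
  then show ?thesis unfolding building_def by blast
qed

lemma on_class_iso: assumes pq: "inverse_pair p q m" shows "complex_iso (on_class (act p)) building building"
  unfolding complex_iso_def
proof
  have hp: "frame_map (act p)" and hq: "frame_map (act q)"
    using frame_map_act[OF pq] frame_map_act[OF inverse_pair_sym[OF pq]] .
  show "bij_betw (on_class (act p)) (vertices building) (vertices building)"
  proof (rule bij_betw_byWitness[where f' = "on_class (act q)"])
    show "\<forall>c\<in>vertices building. on_class (act q) (on_class (act p) c) = c"
      using on_class_inverse_pair[OF inverse_pair_sym[OF pq]] by blast
    show "\<forall>c\<in>vertices building. on_class (act p) (on_class (act q) c) = c"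
      using on_class_inverse_pair[OF pq] by blast
    show "on_class (act p) ` vertices building \<subseteq> vertices building" using on_class_vertex[OF hp] by blast
    show "on_class (act q) ` vertices building \<subseteq> vertices building" using on_class_vertex[OF hq] by blast
  qed
  show "(\<lambda>A. on_class (act p) ` A) ` building = building"
  proof
    show "(\<lambda>A. on_class (act p) ` A) ` building \<subseteq> building" using on_class_building[OF hp] by blast
    show "building \<subseteq> (\<lambda>A. on_class (act p) ` A) ` building"
    proof
      fix A assume A: "A \<in> building"
      have "on_class (act p) ` (on_class (act q) ` A) = A"
      proof -
        have "on_class (act p) (on_class (act q) c) = c" if "c \<in> A" for c
          using on_class_inverse_pair[OF pq] that A by blast
        then show ?thesis by (simp add: image_image)
      qed
      then show "A \<in> (\<lambda>A. on_class (act p) ` A) ` building" using on_class_building[OF hq A] by blast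
    qed
  qed
qed

text \<open>s has constant term 1, so on V / X V, which is \<open>K\<close>, the variable z acts as
  \<sigma>.\<close>

lemma z_op_V_0: assumes "f \<in> V" shows "z_op f $$ 0 = sig (f $$ 0)"
proof -
  have "z_op f = sigma f - Xp 1 * sigma f" by (simp add: z_op_def s_def algebra_simps)
  then show ?thesis using assms by (simp add: V_iff)
qed

text \<open>
  Since \<open>\<sigma>\<^sup>3 = 1\<close>, skew and ordinary multiplication by \<open>1 - z\<^sup>3\<close> agree.
\<close>

lemma divide_by_t:
  assumes "\<forall>i. coeff p i \<in> K"
  shows "\<exists>q r0 r1 r2. (\<forall>i. coeff q i \<in> K) \<and> r0 \<in> K \<and> r1 \<in> K \<and> r2 \<in> K \<and>
    p = q * [:1, 0, 0, -1:] + [:r0, r1, r2:]"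
  using assms
proof (induction p)
  case 0
  show ?case by (rule exI[of _ 0], rule exI[of _ 0], rule exI[of _ 0], rule exI[of _ 0]) simp
next
  case (pCons a p)
  have a: "a \<in> K" "\<forall>i. coeff p i \<in> K" using pCons.prems unfolding coeffs_in_K_pCons by auto
  then obtain q r0 r1 r2 where q: "\<forall>i. coeff q i \<in> K" "r0 \<in> K" "r1 \<in> K" "r2 \<in> K"
    "p = q * [:1, 0, 0, -1:] + [:r0, r1, r2:]" using pCons.IH by blast
  have "pCons a p = pCons (- r2) q * [:1, 0, 0, -1:] + [:a + r2, r0, r1:]"
    unfolding q(5) by (simp add: mult_pCons_left)
  moreover have "\<forall>i. coeff (pCons (- r2) q) i \<in> K" unfolding coeffs_in_K_pCons using q by simp
  moreover have "a + r2 \<in> K" using a(1) q(4) by simp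
  ultimately show ?case using q(2,3) by blast
qed

text \<open>Independence of the characters 1, \<sigma>, \<sigma>^2. Testing on 1, gen, gen^2 gives a
  Vandermonde system in the three distinct conjugates of \<open>gen\<close>.\<close>

lemma dedekind:
  assumes r: "r0 \<in> K" "r1 \<in> K" "r2 \<in> K"
    and *: "\<And>u. u \<in> K \<Longrightarrow> r0 * u + r1 * sig u + r2 * sig (sig u) = 0"
  shows "r0 = 0 \<and> r1 = 0 \<and> r2 = 0"
proof -
  let ?a = gen and ?b = "sig gen" and ?c = "sig (sig gen)"
  have 0: "r0 + r1 + r2 = 0" using *[of 1] by simp
  have 1: "r0 * ?a + r1 * ?b + r2 * ?c = 0" using *[of ?a] gen(1) by simp
  have 2: "r0 * (?a * ?a) + r1 * (?b * ?b) + r2 * (?c * ?c) = 0"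
    using *[of "?a * ?a"] gen(1) by (simp add: sig_mult)
  have "r2 * ((?c - ?a) * (?c - ?b)) = 0" using 0 1 2 by algebra
  then have r2: "r2 = 0" using gen(3,4) by simp
  have "r1 * (?b - ?a) = 0" using 0 1 r2 by algebra
  then have "r1 = 0" using gen(2) by simp
  then show ?thesis using r2 0 by simp
qed

lemma act_t_mult: assumes d: "d = [:1, 0, 0, -1:]" shows "act (q * d) f = t * act q f"
proof -
  have ad: "act d f = t * f" for f
    by (simp add: d act_pCons z_op_z_op_z_op t_def algebra_simps)
  show ?thesis
    by (induction q arbitrary: f)
      (simp_all add: mult_pCons_left act_poly_add act_smult act_pCons ad algebra_simps)
qed

lemma sc_1_V_iff: "f \<in> sc 1 V \<longleftrightarrow> f \<in> V \<and> f $$ 0 = 0"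
proof
  assume f: "f \<in> sc 1 V"
  then have "\<forall>n<0. (Xp (- 1) * f) $$ n = 0" unfolding mem_sc V_iff by blast
  then have "(Xp (- 1) * f) $$ (- 1) = 0" by (elim allE[of _ "- 1"]) (erule mp, simp)
  then show "f \<in> V \<and> f $$ 0 = 0" using f omod_sc_subset[OF omod_V, of 1] by auto
next
  assume "f \<in> V \<and> f $$ 0 = 0"
  then show "f \<in> sc 1 V" unfolding mem_sc V_def using K.R_Xp_1 by blast
qed

text \<open>Modulo t only a remainder r0 + r1 z + r2 z^2 is left, and on V / X V it acts as r0 + r1
  \<sigma> + r2 \<sigma>^2. If p V lies in X V this operator is zero, and \<open>dedekind\<close>
  kills the remainder. Division by 1 - z^3 does not change the constant term.\<close>

lemma act_div_t:
  assumes p: "\<forall>i. coeff p i \<in> K" and im: "act p ` V \<subseteq> sc 1 V"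
  obtains p' where "\<forall>i. coeff p' i \<in> K" "coeff p' 0 = coeff p 0" "\<And>f. act p f = t * act p' f"
proof -
  obtain q r0 r1 r2 where q: "\<forall>i. coeff q i \<in> K" and r: "r0 \<in> K" "r1 \<in> K" "r2 \<in> K"
    and pq: "p = q * [:1, 0, 0, -1:] + [:r0, r1, r2:]" using divide_by_t[OF p] by blast
  have act: "act p f = t * act q f + (fls_const r0 * f + (fls_const r1 * z_op f + fls_const r2 * z_op (z_op f)))" for f
    unfolding pq act_poly_add act_t_mult[OF refl] by (simp add: act_pCons)
  have "r0 * u + r1 * sig u + r2 * sig (sig u) = 0" if "u \<in> K" for u
  proof -
    have cV: "fls_const u \<in> V" using that by (simp add: V_iff)
    have "act p (fls_const u) $$ 0 = 0" using sc_1_V_iff im cV by blast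
    moreover have "t * act q (fls_const u) \<in> sc 1 V"
      using t_image[OF omod_V, of 1] act_V[OF q cV] by auto
    then have "(t * act q (fls_const u)) $$ 0 = 0" by (simp add: sc_1_V_iff)
    ultimately show ?thesis
      unfolding act using cV z_op_V[OF cV] by (simp add: z_op_V_0 add.assoc)
  qed
  then have "r0 = 0 \<and> r1 = 0 \<and> r2 = 0" by (rule dedekind[OF r])
  then have "coeff q 0 = coeff p 0" "act p f = t * act q f" for f
    using act by (simp_all add: pq coeff_mult)
  then show ?thesis using that q by blast
qed

lemma act_div_t_power:
  assumes "\<forall>i. coeff p i \<in> K" "act p ` V = sc (int n) V"
  shows "\<exists>p'. (\<forall>i. coeff p' i \<in> K) \<and> coeff p' 0 = coeff p 0 \<and> (\<forall>f. act p f = t ^ n * act p' f)"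
  using assms
proof (induction n arbitrary: p)
  case 0
  then show ?case by (intro exI[of _ p]) simp
next
  case (Suc n)
  have "act p ` V \<subseteq> sc 1 V"
    unfolding Suc.prems(2) by (rule sc_V_mono) simp
  then obtain q where q: "\<forall>i. coeff q i \<in> K" "coeff q 0 = coeff p 0" "\<And>f. act p f = t * act q f"
    by (rule act_div_t[OF Suc.prems(1)]) (rule that)
  have "(\<lambda>f. t * f) ` act q ` V = act p ` V" by (simp add: image_image q(3))
  also have "\<dots> = sc 1 (sc (int n) V)" using Suc.prems(2) by simp
  also have "\<dots> = (\<lambda>f. t * f) ` sc (int n) V" using t_image[OF omod_sc[OF omod_V], of 1 "int n"] by simp
  finally have "act q ` V = sc (int n) V"
    using inj_image_eq_iff[of "\<lambda>f. t * f"] t_nonzero by (simp add: inj_def)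
  then obtain p' where "\<forall>i. coeff p' i \<in> K" "coeff p' 0 = coeff q 0" "\<forall>f. act q f = t ^ n * act p' f"
    using Suc.IH[OF q(1)] by blast
  then show ?case using q by (intro exI[of _ p']) (simp add: mult.assoc)
qed

lemma sc_V_subset_V: assumes "sc n V \<subseteq> V" shows "0 \<le> n"
proof (rule ccontr)
  assume "\<not> 0 \<le> n"
  moreover have "Xp n * 1 \<in> V" using one_V assms unfolding sc_def by blast
  then have "n < 0 \<Longrightarrow> Xp n $$ n = (0 :: 'a)" by (simp add: V_iff)
  ultimately show False by (simp add: Xp_nth_eq)
qed

text \<open>If p V = X^n V then the cofactor satisfies q V = X^(m - n) V, and both exponents are
  nonnegative. Dividing p by t^n and q by t^(m - n) leaves two elements with product 1, so the first
  is constant, hence 1, and p acts as a power of t.\<close>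

lemma stabilizer_trivial:
  assumes pq: "inverse_pair p q m" and st: "cls (act p ` V) = cls V" and c: "c \<in> vertices building"
  shows "on_class (act p) c = c"
proof -
  obtain n where n: "act p ` V = sc n V" using st[symmetric] unfolding cls_eq_iff by blast
  have qp: "act q ` act p ` V = sc (int m) V"
    unfolding t_image[OF omod_V, symmetric] by (simp add: image_image inverse_pairD(2)[OF pq])
  have "sc n (act q ` V) = sc n (sc (int m - n) V)" using qp unfolding n act_sc by simp
  then have n': "act q ` V = sc (int m - n) V" by (simp only: sc_inj)
  have "0 \<le> n" by (rule sc_V_subset_V) (use inverse_pairD(3)[OF pq] n[symmetric] in auto)
  then obtain i where i: "n = int i" using nonneg_int_cases by blast
  have "0 \<le> int m - n" by (rule sc_V_subset_V) (use inverse_pairD(3)[OF inverse_pair_sym[OF pq]] n'[symmetric] in auto)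
  then obtain j where j: "int m - n = int j" using nonneg_int_cases by blast
  have m: "m = i + j" using i j by simp
  have K: "\<forall>i. coeff p i \<in> K" "\<forall>i. coeff q i \<in> K" and p0: "coeff p 0 = 1" using pq by (auto simp: inverse_pair_def)
  obtain p' where p': "coeff p' 0 = 1" "\<And>f. act p f = t ^ i * act p' f"
    using act_div_t_power[OF K(1), of i] n i p0 by auto
  obtain q' where q': "\<And>f. act q f = t ^ j * act q' f"
    using act_div_t_power[OF K(2), of j] n' j by auto
  have "act p' (act q' f) = f" for f
  proof -
    have "t ^ m * f = act p (act q f)" using inverse_pairD(1)[OF pq] by simp
    also have "\<dots> = t ^ i * (t ^ j * act p' (act q' f))" by (simp add: p' q' act_mult[OF t_F])
    also have "\<dots> = t ^ m * act p' (act q' f)" by (simp add: m power_add)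
    finally show ?thesis using t_nonzero by simp
  qed
  then have "degree p' = 0" by (rule unit_const)
  then have "p' = 1" using p'(1) by (metis degree_eq_zeroE coeff_pCons_0 one_pCons)
  then have ap: "act p f = t ^ i * f" for f using p'(2) by simp
  obtain x y z where xyz: "frame x y z" "c = cls (B x y z)" using c unfolding vertices_building by blast
  have "on_class (act p) c = cls (act p ` B x y z)"
    unfolding xyz(2) on_class_cls[OF frame_map_act[OF pq]] act_image_B ..
  also have "act p ` B x y z = (\<lambda>f. t ^ i * f) ` B x y z" by (simp add: ap)
  finally show ?thesis unfolding xyz(2) cls_t_image[OF omod_B] .
qed

section \<open>Transitivity and links\<close>

text \<open>With w = c z one has w^2 = c \<sigma>(c) z^2, and w^3 = - z^3 by the norm condition. The
  cofactor is 1 - w + w^2, as in 1 + w^3 = (1 + w)(1 - w + w^2).\<close>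

lemma inverse_pair_linear:
  assumes c: "c \<in> K" "c * sig c * sig (sig c) = -1"
  shows "inverse_pair [:1, c:] [:1, - c, c * sig c:] 1"
  unfolding inverse_pair_def
proof (intro conjI allI)
  show "coeff [:1, c:] i \<in> K" "coeff [:1, - c, c * sig c:] i \<in> K" for i
    using c(1) by (auto simp: coeff_pCons split: nat.splits)
  have z: "z_op (fls_const a * f) = fls_const (sig a) * z_op f" for a f
    by (simp add: z_op_mult sigma_const)
  have tf: "t * f = f - s ^ 3 * f" for f by (simp add: t_def algebra_simps)
  have zd: "z_op (f + g) = z_op f + z_op g" for f g by (rule z_op_add)
  have n: "fls_const c * (fls_const (sig c) * fls_const (sig (sig c))) = - 1"
    using c(2) by (simp add: mult.assoc)
  have p: "act [:1, c:] f = f + fls_const c * z_op f" for f by (simp add: act_pCons)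
  have q: "act [:1, - c, c * sig c:] f = f + (fls_const (- c) * z_op f + fls_const (c * sig c) * z_op (z_op f))" for f
    by (simp add: act_pCons)
  show "act [:1, c:] (act [:1, - c, c * sig c:] f) = t ^ 1 * f" for f
  proof -
    have "act [:1, c:] (act [:1, - c, c * sig c:] f) =
        f + (fls_const c * (fls_const (sig c) * fls_const (sig (sig c)))) * (s ^ 3 * f)"
      unfolding p q zd z z_op_z_op_z_op by (simp add: sig_mult sig_uminus algebra_simps flip: fls_const_mult_const)
    then show ?thesis unfolding n by (simp add: tf)
  qed
  show "act [:1, - c, c * sig c:] (act [:1, c:] f) = t ^ 1 * f" for f
  proof -
    have "act [:1, - c, c * sig c:] (act [:1, c:] f) =
        f + (fls_const c * (fls_const (sig c) * fls_const (sig (sig c)))) * (s ^ 3 * f)"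
      unfolding p q zd z z_op_z_op_z_op by (simp add: sig_mult sig_uminus algebra_simps flip: fls_const_mult_const)
    then show ?thesis unfolding n by (simp add: tf)
  qed
qed simp_all

definition Tr :: "'a \<Rightarrow> 'a" where "Tr u = u + sig u + sig (sig u)"

text \<open>Modulo X V the sublattice is a plane in \<open>K\<close> over \<open>k0\<close>, and it
  is determined by the element \<beta> orthogonal to it for the trace form. The image of 1 + c z
  modulo X is the set of (h - \<sigma>(h)) / \<beta>, which by additive Hilbert 90 is the same
  plane.\<close>

lemma neighbour:
  assumes fr: "frame x y z" and BV: "B x y z = V"
  shows "\<exists>p q m. inverse_pair p q m \<and> B (Xp 1 * x) y z = act p ` V"
proof -
  define u where "u = y $$ 0"
  define v where "v = z $$ 0"
  have yz: "y \<in> V" "z \<in> V" "x \<in> V" unfolding BV[symmetric] by (rule B_mem)+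
  have uv: "u \<in> K" "v \<in> K" using yz by (auto simp: u_def v_def V_iff)
  have scV: "sc 1 V = B (Xp 1 * x) (Xp 1 * y) (Xp 1 * z)" by (simp only: BV[symmetric] sc_B)
  have y_out: "y \<notin> B (Xp 1 * y) z x"
    using frame_cyc[OF fr] unfolding frame_def by (intro not_mem_B) blast
  have z_out: "z \<notin> B (Xp 1 * z) x y"
    using frame_cyc[OF frame_cyc[OF fr]] unfolding frame_def by (intro not_mem_B) blast
  have "sc 1 V = B (Xp 1 * y) (Xp 1 * z) (Xp 1 * x)"
    unfolding scV by (rule B_cyc[symmetric])
  then have sub_y: "sc 1 V \<subseteq> B (Xp 1 * y) z x"
    using B_scale_subset[of 1 1 0 1 0 1 y z x] by simp
  have "sc 1 V = B (Xp 1 * z) (Xp 1 * x) (Xp 1 * y)"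
    unfolding scV by (rule trans[OF B_cyc B_cyc, symmetric])
  then have sub_z: "sc 1 V \<subseteq> B (Xp 1 * z) x y"
    using B_scale_subset[of 1 1 0 1 0 1 z x y] by simp
  \<comment> \<open>\<open>\<beta>\<close> is orthogonal to \<open>u\<close> and \<open>v\<close> for the trace form, and \<open>1 + c \<sigma>\<close> below is \<open>1 - \<sigma>\<close> conjugated by \<open>\<beta>\<close>.\<close>
  define \<beta> where "\<beta> = sig u * sig (sig v) - sig (sig u) * sig v"
  have \<beta>K: "\<beta> \<in> K" using uv by (simp add: \<beta>_def)
  \<comment> \<open>Otherwise v / u would be fixed by \<sigma>, and subtracting a multiple of y from
    z over \<open>k0\<close> would land in X V, although y and z belong to a basis.\<close>
  have \<beta>0: "\<beta> \<noteq> 0"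
  proof
    assume b: "\<beta> = 0"
    have u0: "u \<noteq> 0"
    proof
      assume "u = 0"
      then have "y \<in> sc 1 V" using yz(1) unfolding u_def sc_1_V_iff by blast
      then show False using y_out sub_y by blast
    qed
    define c where "c = v / u"
    have "sig c = sig (sig c)" using b u0 by (simp add: c_def sig_divide \<beta>_def field_simps)
    then have "c = sig c" by simp
    then have ck: "c \<in> k0" using uv by (simp add: k0_def c_def)
    have "z - fls_const c * y \<in> V"
      using yz ck by (intro omodD(5)[OF omod_V] omodD(3)[OF omod_V]) simp_all
    moreover have "(z - fls_const c * y) $$ 0 = 0" using u0 by (simp add: c_def u_def v_def)
    ultimately have 1: "z - fls_const c * y \<in> B (Xp 1 * z) x y" using sub_z sc_1_V_iff by blast
    have "fls_const c * y \<in> B (Xp 1 * z) x y" using ck by (intro omodD(3)[OF omod_B]) simp_all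
    then have "(z - fls_const c * y) + fls_const c * y \<in> B (Xp 1 * z) x y" by (rule omodD(2)[OF omod_B 1])
    then show False using z_out by simp
  qed
  define c where "c = - (sig \<beta> / \<beta>)"
  have c: "c \<in> K" "c * sig c * sig (sig c) = -1"
    using \<beta>K \<beta>0 by (simp_all add: c_def sig_uminus sig_divide)
  let ?p = "[:1, c:]"
  have pq: "inverse_pair ?p [:1, - c, c * sig c:] 1" by (rule inverse_pair_linear[OF c])
  have p0: "act ?p f $$ 0 = f $$ 0 + c * sig (f $$ 0)" if "f \<in> V" for f
    using z_op_V_0[OF that] by (simp add: act_pCons)
  have pV: "act ?p f \<in> V" if "f \<in> V" for f by (rule inverse_pairD(3)[OF pq that])
  have om: "omod (act ?p ` V)"
    using omod_B[of "act ?p x" "act ?p y" "act ?p z"] unfolding act_image_B[symmetric] BV .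
  have "sc 1 V = (\<lambda>f. t ^ 1 * f) ` V" using t_image[OF omod_V, of 1] by simp
  also have "\<dots> = act ?p ` act [:1, - c, c * sig c:] ` V" by (simp only: image_image inverse_pairD(1)[OF pq])
  also have "\<dots> \<subseteq> act ?p ` V" using inverse_pairD(3)[OF inverse_pair_sym[OF pq]] by (intro image_mono) blast
  finally have XV: "sc 1 V \<subseteq> act ?p ` V" .
  have lift: "g \<in> act ?p ` V" if g: "g \<in> V" and tr: "Tr (\<beta> * g $$ 0) = 0" for g
  proof -
    define h where "h = \<beta> * g $$ 0"
    have hK: "h \<in> K" using g \<beta>K by (simp add: h_def V_iff)
    have tr': "sig (sig h) = - h - sig h" using tr by (simp add: Tr_def h_def[symmetric] algebra_simps eq_neg_iff_add_eq_0)
    have 3: "(3 :: 'a) \<in> K" using K.add_mem[OF K.add_mem[OF K.one_mem K.one_mem] K.one_mem] by simp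
    have s2: "sig 2 = 2" using sig_add[of 1 1] by simp
    have s3: "sig 3 = 3" using sig_add[of 2 1] s2 by simp
    \<comment> \<open>An explicit solution of w' - \<sigma>(w') = h for h of trace zero; the
      coefficients come from \<sigma>^2(h) = - h - \<sigma>(h).\<close>
    define w' where "w' = (2 * h + sig h) / 3"
    have 2: "(2 :: 'a) \<in> K" using K.add_mem[OF K.one_mem K.one_mem] by simp
    have w'K: "w' \<in> K" using hK 2 3 by (simp add: w'_def)
    have "sig w' = (2 * sig h + sig (sig h)) / 3" by (simp add: w'_def sig_divide sig_add sig_mult s2 s3)
    then have w': "w' - sig w' = h"
      using three_ne_0 by (simp add: w'_def tr' diff_divide_distrib[symmetric]) (simp add: field_simps)
    define w where "w = w' / \<beta>"
    have wV: "fls_const w \<in> V" using w'K \<beta>K by (simp add: w_def V_iff)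
    have "w + c * sig w = (w' - sig w') / \<beta>"
      using \<beta>0 by (simp add: w_def c_def sig_divide field_simps)
    then have "w + c * sig w = g $$ 0" unfolding w' using \<beta>0 by (simp add: h_def)
    then have "(g - act ?p (fls_const w)) $$ 0 = 0" using p0[OF wV] by simp
    moreover have "g - act ?p (fls_const w) \<in> V" by (rule omodD(5)[OF omod_V g pV[OF wV]])
    ultimately have "g - act ?p (fls_const w) \<in> act ?p ` V" using XV sc_1_V_iff by blast
    then have "(g - act ?p (fls_const w)) + act ?p (fls_const w) \<in> act ?p ` V"
      using wV by (intro omodD(2)[OF om]) auto
    then show ?thesis by simp
  qed
  have "Tr (\<beta> * u) = 0" "Tr (\<beta> * v) = 0"
    by (simp_all add: Tr_def \<beta>_def sig_mult sig_diff algebra_simps)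
  then have "y \<in> act ?p ` V" "z \<in> act ?p ` V" using lift yz by (auto simp: u_def v_def)
  moreover have "Xp 1 * x \<in> act ?p ` V" using XV yz(3) by (auto simp: mem_sc)
  ultimately have sub: "B (Xp 1 * x) y z \<subseteq> act ?p ` V" by (intro B_least[OF om])
  have trim: "Tr (\<beta> * f $$ 0) = 0" if f: "f \<in> act ?p ` V" for f
  proof -
    obtain g where g: "g \<in> V" "f = act ?p g" using f by blast
    have "\<beta> * f $$ 0 = \<beta> * g $$ 0 - sig (\<beta> * g $$ 0)"
      unfolding g(2) p0[OF g(1)] using \<beta>0 by (simp add: c_def sig_mult algebra_simps)
    then show ?thesis by (simp add: Tr_def sig_diff)
  qed
  have "act ?p ` V \<subseteq> B (Xp 1 * x) y z"
  proof (rule ccontr)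
    assume "\<not> ?thesis"
    then obtain f where f: "f \<in> act ?p ` V" "f \<notin> B (Xp 1 * x) y z" by blast
    have fB: "f \<in> B x y z" using f(1) pV unfolding BV by blast
    \<comment> \<open>A test vector: the trace of \<beta> (1 / \<beta>) is 3, so it is outside the
      image. But an image larger than the sublattice would be all of \<open>V\<close>, the
      sublattice having codimension one.\<close>
    define g where "g = fls_const (1 / \<beta>)"
    have "g \<in> V" using \<beta>K by (simp add: g_def V_iff)
    then obtain a where a: "a \<in> k0" "g - fls_const a * f \<in> B (Xp 1 * x) y z"
      using B_cover[OF fB f(2), of g] unfolding BV by blast
    have "fls_const a * f \<in> act ?p ` V" using a(1) f(1) by (intro omodD(3)[OF om]) simp_all
    then have "(g - fls_const a * f) + fls_const a * f \<in> act ?p ` V"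
      using a(2) sub by (intro omodD(2)[OF om]) auto
    then have "Tr (\<beta> * g $$ 0) = 0" using trim by simp
    then show False using \<beta>0 three_ne_0 by (simp add: g_def Tr_def)
  qed
  then show ?thesis using sub pq by blast
qed

section \<open>Transitivity by walking through neighbours\<close>

definition reached :: "'a fls set set \<Rightarrow> bool" where
  "reached c \<longleftrightarrow> (\<exists>p q m. inverse_pair p q m \<and> c = cls (act p ` V))"

lemma on_class_cls_V: "inverse_pair p q m \<Longrightarrow> on_class (act p) (cls V) = cls (act p ` V)"
  using on_class_cls[OF frame_map_act, of p q m 1 "fls_const gen" "fls_const (gen ^ 2)"]
  unfolding act_image_B[symmetric] base_V .

lemma cls_V_vertex: "cls V \<in> vertices building"
proof -
  have "cls (B 1 (fls_const gen) (fls_const (gen ^ 2))) \<in> vertices building"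
    unfolding vertices_building using base by blast
  then show ?thesis unfolding base_V .
qed

text \<open>The first vertex is moved to the class of \<open>V\<close> by the inverse of p, where
  \<open>neighbour\<close> supplies p'; moving back, the second vertex is reached by the product p
  p'.\<close>

lemma reached_step:
  assumes fr: "frame x y z" and r: "reached (cls (B x y z))"
  shows "reached (cls (B (Xp 1 * x) y z))"
proof -
  obtain p q m where pq: "inverse_pair p q m" and c: "cls (B x y z) = cls (act p ` V)"
    using r unfolding reached_def by blast
  have hp: "frame_map (act p)" and hq: "frame_map (act q)"
    using frame_map_act[OF pq] frame_map_act[OF inverse_pair_sym[OF pq]] .
  have "on_class (act q) (cls (B x y z)) = on_class (act q) (on_class (act p) (cls V))"
    by (simp only: c on_class_cls_V[OF pq])
  also have "\<dots> = cls V"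
    by (rule on_class_inverse_pair[OF inverse_pair_sym[OF pq] cls_V_vertex])
  finally have "cls (B (act q x) (act q y) (act q z)) = cls V" unfolding on_class_cls[OF hq] .
  then obtain n where "V = sc n (B (act q x) (act q y) (act q z))" unfolding cls_eq_iff by blast
  then have BV: "B (Xp n * act q x) (Xp n * act q y) (Xp n * act q z) = V" by (simp add: sc_B)
  have "frame (Xp n * act q x) (Xp n * act q y) (Xp n * act q z)"
    by (rule frame_scale[OF frame_map_frame[OF hq fr]])
  then obtain p' q' m' where p': "inverse_pair p' q' m'"
    "B (Xp 1 * (Xp n * act q x)) (Xp n * act q y) (Xp n * act q z) = act p' ` V"
    using neighbour[OF _ BV] by blast
  have "Xp n * act q (Xp 1 * x) = Xp 1 * (Xp n * act q x)"
    unfolding frame_map_Xp[OF hq] Xp_mult_Xp by (simp only: add.commute)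
  then have "act p' ` V = sc n (B (act q (Xp 1 * x)) (act q y) (act q z))"
    unfolding p'(2)[symmetric] sc_B by (simp only:)
  then have "cls (B (act q (Xp 1 * x)) (act q y) (act q z)) = cls (act p' ` V)"
    by (simp only: cls_sc)
  then have "on_class (act q) (cls (B (Xp 1 * x) y z)) = cls (act p' ` V)"
    by (simp only: on_class_cls[OF hq])
  moreover have "cls (B (Xp 1 * x) y z) \<in> vertices building"
    using frame_scale1[OF fr] unfolding vertices_building by blast
  ultimately have "cls (B (Xp 1 * x) y z) = on_class (act p) (cls (act p' ` V))"
    using on_class_inverse_pair[OF pq, of "cls (B (Xp 1 * x) y z)"] by (simp only:)
  also have "\<dots> = on_class (act p) (on_class (act p') (cls V))"
    by (simp only: on_class_cls_V[OF p'(1)])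
  also have "\<dots> = on_class (act (skew_mult p p')) (cls V)"
    by (simp add: on_class_def image_image act_skew_mult)
  also have "\<dots> = cls (act (skew_mult p p') ` V)"
    by (rule on_class_cls_V[OF inverse_pair_skew_mult[OF pq p'(1)]])
  finally show ?thesis unfolding reached_def using inverse_pair_skew_mult[OF pq p'(1)] by blast
qed

lemma reached_scale1:
  assumes "frame x y z" "reached (cls (B x y z))"
  shows "reached (cls (B (Xp (int n) * x) y z))"
proof (induction n)
  case (Suc n)
  have *: "Xp 1 * (Xp (int n) * x) = Xp (int (Suc n)) * x"
    unfolding Xp_mult_Xp by simp
  show ?case using reached_step[OF frame_scale1[OF assms(1)] Suc] unfolding * .
qed (use assms in simp)

lemma reached_scale:
  assumes fr: "frame x y z" and r: "reached (cls (B x y z))"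
  shows "reached (cls (B (Xp (int a) * x) (Xp (int b) * y) (Xp (int c) * z)))"
proof -
  have f: "frame (Xp (int a) * x) y z" "frame (Xp (int a) * x) (Xp (int b) * y) z"
    using frame_scale[OF fr, of "int a" 0 0] frame_scale[OF fr, of "int a" "int b" 0] by simp_all
  have c2: "B z x y = B x y z" for x y z by (rule trans[OF B_cyc B_cyc])
  have "reached (cls (B y z (Xp (int a) * x)))"
    using reached_scale1[OF fr r, of a] unfolding B_cyc[of y z "Xp (int a) * x"] .
  from reached_scale1[OF frame_cyc[OF f(1)] this, of b]
  have "reached (cls (B z (Xp (int a) * x) (Xp (int b) * y)))"
    unfolding B_cyc[of "Xp (int b) * y" z "Xp (int a) * x"] c2[of z "Xp (int a) * x" "Xp (int b) * y"] .
  from reached_scale1[OF frame_cyc[OF frame_cyc[OF f(2)]] this, of c] show ?thesis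
    unfolding c2[of "Xp (int c) * z" "Xp (int a) * x" "Xp (int b) * y"] .
qed

lemma transitive: assumes "c \<in> vertices building" shows "reached c"
proof -
  obtain x y z where c: "frame x y z" "c = cls (B x y z)" using assms unfolding vertices_building by blast
  obtain u v w n where *: "frame u v w" "same_chain 1 (fls_const gen) (fls_const (gen ^ 2)) u v w"
    "coords u v w (B x y z) n"
    using adapted_frame[OF c(1)] .
  obtain i j l where ijl: "B x y z = B (Xp i * u) (Xp j * v) (Xp l * w)"
    using *(3) by (auto simp: coords_def)
  have V: "B u v w = V" using base_V *(2) by (simp add: same_chain_def)
  have "inverse_pair 1 1 0" unfolding inverse_pair_def by (simp add: coeff_1)
  moreover have "act 1 ` V = V" by simp
  ultimately have "reached (cls (B u v w))" unfolding reached_def V by metis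
  \<comment> \<open>The available steps only multiply basis vectors by X, so all exponents must be
    nonnegative; subtracting their minimum does not change the class.\<close>
  define d where "d = min i (min j l)"
  have "reached (cls (B (Xp (int (nat (i - d))) * u) (Xp (int (nat (j - d))) * v) (Xp (int (nat (l - d))) * w)))"
    by (rule reached_scale[OF *(1)]) fact
  moreover have "sc d (B (Xp (i - d) * u) (Xp (j - d) * v) (Xp (l - d) * w)) = B x y z"
    unfolding ijl by (simp add: sc_B Xp_mult_Xp)
  then have "cls (B (Xp (i - d) * u) (Xp (j - d) * v) (Xp (l - d) * w)) = c" unfolding c(2) using cls_sc by metis
  moreover have "d \<le> i" "d \<le> j" "d \<le> l" by (simp_all add: d_def)
  ultimately show ?thesis by simp
qed

text \<open>In the basis b gen, b gen^2, b of \<open>K\<close>, all vectors but the last are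
  multiplied by X, so this is the class of k b + X V.\<close>

definition line :: "'a \<Rightarrow> 'a fls set set" where
  "line b = cls (B (Xp 1 * fls_const (b * gen)) (Xp 1 * fls_const (b * gen ^ 2)) (fls_const b))"

lemma frame_const_scale:
  assumes b: "b \<in> K" "b \<noteq> 0"
  shows "frame (fls_const (b * gen)) (fls_const (b * gen ^ 2)) (fls_const b)"
    "B (fls_const (b * gen)) (fls_const (b * gen ^ 2)) (fls_const b) = V"
proof -
  have B: "B (fls_const b * x) (fls_const b * y) (fls_const b * z) = (*) (fls_const b) ` B x y z" for x y z
    by (rule F_linear_B[symmetric]) (simp add: F_linear_def algebra_simps)
  have "(*) (fls_const b) ` V = V"
  proof
    show "(*) (fls_const b) ` V \<subseteq> V" using const_V[OF b(1)] by blast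
    show "V \<subseteq> (*) (fls_const b) ` V"
    proof
      fix f assume "f \<in> V"
      then have "fls_const (inverse b) * f \<in> V" using b(1) by (intro const_V) simp_all
      moreover have "f = fls_const b * (fls_const (inverse b) * f)"
        using b(2) by (simp add: mult.assoc[symmetric])
      ultimately show "f \<in> (*) (fls_const b) ` V" by blast
    qed
  qed
  then have V: "B (fls_const b * 1) (fls_const b * fls_const gen) (fls_const b * fls_const (gen ^ 2)) = V"
    unfolding B base_V .
  have "indep (fls_const b * 1) (fls_const b * fls_const gen) (fls_const b * fls_const (gen ^ 2))"
    unfolding indep_def
  proof (intro ballI impI)
    fix f g h assume *: "f \<in> F" "g \<in> F" "h \<in> F"
      "f * (fls_const b * 1) + g * (fls_const b * fls_const gen) + h * (fls_const b * fls_const (gen ^ 2)) = 0"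
    have "fls_const b * (f * 1 + g * fls_const gen + h * fls_const (gen ^ 2)) = 0"
      using *(4) by (simp only: distrib_left mult_ac)
    then have "f * 1 + g * fls_const gen + h * fls_const (gen ^ 2) = 0" using b(2) by simp
    then show "f = 0 \<and> g = 0 \<and> h = 0" using gen_frame(1) *(1-3) unfolding indep_def by blast
  qed
  then have "frame (fls_const b * 1) (fls_const b * fls_const gen) (fls_const b * fls_const (gen ^ 2))"
    by (simp only: frame_def V bounded_V)
  from frame_cyc[OF this] show "frame (fls_const (b * gen)) (fls_const (b * gen ^ 2)) (fls_const b)" by simp
  show "B (fls_const (b * gen)) (fls_const (b * gen ^ 2)) (fls_const b) = V"
    using V B_cyc[of "fls_const b * fls_const gen" "fls_const b * fls_const (gen ^ 2)" "fls_const b * 1"] by simp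
qed

lemma line_in_link: assumes "b \<in> K" "b \<noteq> 0" shows "line b \<in> vertices (link building (cls V))"
proof -
  note fr = frame_const_scale[OF assms]
  have "insert (cls V) {line b} \<subseteq> chamber (fls_const (b * gen)) (fls_const (b * gen ^ 2)) (fls_const b)"
    unfolding chamber_def line_def fr(2) by blast
  then have "insert (cls V) {line b} \<in> building" using fr(1) unfolding building_def by blast
  moreover have "line b \<noteq> cls V"
    using chamber_card(2)[OF fr(1)] unfolding fr(2) line_def by blast
  ultimately show ?thesis unfolding link_def by blast
qed

text \<open>Both lattices have the same index, so equal classes mean equal lattices. The line is
  then recovered as the set of constant terms, which here are the multiples of b over
  \<open>k0\<close>.\<close>

lemma line_inj:
  assumes b: "b \<in> K" "b \<noteq> 0" and b': "b' \<in> K" "b' \<noteq> 0" and eq: "line b = line b'"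
  shows "b' / b \<in> k0"
proof -
  let ?M = "\<lambda>b. B (Xp 1 * fls_const (b * gen)) (Xp 1 * fls_const (b * gen ^ 2)) (fls_const b)"
  have fr: "frame (Xp 1 * fls_const (b * gen)) (Xp 1 * fls_const (b * gen ^ 2)) (fls_const b)" if "b \<in> K" "b \<noteq> 0" for b
    using frame_scale[OF frame_const_scale(1)[OF that], of 1 1 0] by simp
  have index: "index (?M b) = index V + 2" if "b \<in> K" "b \<noteq> 0" for b
    using index_scale[OF frame_const_scale(1)[OF that], of 1 1 0] unfolding frame_const_scale(2)[OF that] by simp
  have "?M b = ?M b'"
  proof (rule ccontr)
    assume "?M b \<noteq> ?M b'"
    moreover have "index (?M b) = index (?M b')" unfolding index[OF b] index[OF b'] ..
    ultimately have "cls (?M b) \<noteq> cls (?M b')" by (intro cls_ne[OF fr[OF b] fr[OF b']])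
    then show False using eq by (simp add: line_def)
  qed
  then have "fls_const b' \<in> ?M b" by simp
  then obtain p q r where *: "p \<in> R" "q \<in> R" "r \<in> R"
    "fls_const b' = p * (Xp 1 * fls_const (b * gen)) + q * (Xp 1 * fls_const (b * gen ^ 2)) + r * fls_const b"
    by (rule BE)
  have zero: "(p * (Xp 1 * fls_const a)) $$ 0 = 0" if "p \<in> R" for p a
  proof -
    have eq: "p * (Xp 1 * fls_const a) = Xp 1 * (fls_const a * p)" by (simp only: mult_ac)
    have "p $$ (- 1) = 0" using that by (simp add: R_def)
    then show ?thesis unfolding eq by simp
  qed
  have "b' = (r * fls_const b) $$ 0"
    using arg_cong[OF *(4), of "\<lambda>f. f $$ 0"] zero[OF *(1)] zero[OF *(2)] by simp
  then have "b' = r $$ 0 * b" by simp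
  then show ?thesis using b(2) *(3) by (simp add: R_def F_def)
qed

end

section \<open>Simply transitive groups on buildings\<close>

lemma complex_iso_cong:
  assumes "complex_iso f A C" "\<And>v. v \<in> vertices A \<Longrightarrow> g v = f v" shows "complex_iso g A C"
proof -
  have "g ` S = f ` S" if "S \<in> A" for S
    using assms(2) that by (intro image_cong) auto
  then have "(\<lambda>S. g ` S) ` A = (\<lambda>S. f ` S) ` A" by (rule image_cong[OF refl])
  moreover have "bij_betw g (vertices A) (vertices C) = bij_betw f (vertices A) (vertices C)"
    by (rule bij_betw_cong) (rule assms(2))
  ultimately show ?thesis using assms(1) by (simp add: complex_iso_def)
qed

lemma complex_iso_image: assumes "inj_on f (vertices A)" shows "complex_iso f A ((\<lambda>S. f ` S) ` A)"
proof -
  have "f ` vertices A = vertices ((\<lambda>S. f ` S) ` A)" by blast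
  then show ?thesis using assms unfolding complex_iso_def bij_betw_def by simp
qed

lemma complex_iso_inv:
  assumes "complex_iso f A C" shows "complex_iso (inv_into (vertices A) f) C A"
proof -
  have bij: "bij_betw f (vertices A) (vertices C)" and im: "(\<lambda>S. f ` S) ` A = C"
    using assms by (auto simp: complex_iso_def)
  have "inv_into (vertices A) f ` f ` S = S" if "S \<in> A" for S
  proof (rule inv_into_image_cancel)
    show "inj_on f (vertices A)" using bij by (rule bij_betw_imp_inj_on)
    show "S \<subseteq> vertices A" using that by blast
  qed
  then have "(\<lambda>S. inv_into (vertices A) f ` S) ` C = A"
    unfolding im[symmetric] image_image by simp
  then show ?thesis using bij_betw_inv_into[OF bij] by (simp add: complex_iso_def)
qed

lemma complex_iso_simplex: "complex_iso f A C \<Longrightarrow> S \<in> A \<Longrightarrow> f ` S \<in> C"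
  by (auto simp: complex_iso_def)

lemma vertices_link:
  assumes "simplicial_complex A" shows "vertices (link A v) = {w. w \<noteq> v \<and> {v, w} \<in> A}"
proof
  show "vertices (link A v) \<subseteq> {w. w \<noteq> v \<and> {v, w} \<in> A}"
  proof
    fix w assume "w \<in> vertices (link A v)"
    then obtain S where S: "v \<notin> S" "insert v S \<in> A" "w \<in> S" unfolding link_def by blast
    have "{v, w} \<subseteq> insert v S" using S(3) by blast
    then have "{v, w} \<in> A" using assms S(2) unfolding simplicial_complex_def by blast
    then show "w \<in> {w. w \<noteq> v \<and> {v, w} \<in> A}" using S(1,3) by blast
  qed
  show "{w. w \<noteq> v \<and> {v, w} \<in> A} \<subseteq> vertices (link A v)"
  proof
    fix w assume "w \<in> {w. w \<noteq> v \<and> {v, w} \<in> A}"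
    then have "{w} \<in> link A v" unfolding link_def by auto
    then show "w \<in> vertices (link A v)" by blast
  qed
qed

lemma link_iso:
  assumes A: "simplicial_complex A" and C: "simplicial_complex C" and iso: "complex_iso f A C" and v: "v \<in> vertices A"
  shows "|vertices (link A v)| =o |vertices (link C (f v))|"
proof -
  have bij: "bij_betw f (vertices A) (vertices C)" using iso by (simp add: complex_iso_def)
  have inj: "inj_on f (vertices A)" using bij by (rule bij_betw_imp_inj_on)
  have "bij_betw f {w. w \<noteq> v \<and> {v, w} \<in> A} {w. w \<noteq> f v \<and> {f v, w} \<in> C}"
  proof (rule bij_betw_imageI)
    show "inj_on f {w. w \<noteq> v \<and> {v, w} \<in> A}" by (rule inj_on_subset[OF inj]) blast
    show "f ` {w. w \<noteq> v \<and> {v, w} \<in> A} = {w. w \<noteq> f v \<and> {f v, w} \<in> C}"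
    proof
      show "f ` {w. w \<noteq> v \<and> {v, w} \<in> A} \<subseteq> {w. w \<noteq> f v \<and> {f v, w} \<in> C}"
      proof
        fix w' assume "w' \<in> f ` {w. w \<noteq> v \<and> {v, w} \<in> A}"
        then obtain w where w: "w \<noteq> v" "{v, w} \<in> A" "w' = f w" by blast
        have "f w \<noteq> f v" using inj_onD[OF inj, of w v] w v by blast
        moreover have "{f v, f w} \<in> C" using complex_iso_simplex[OF iso w(2)] by simp
        ultimately show "w' \<in> {w. w \<noteq> f v \<and> {f v, w} \<in> C}" unfolding w(3) by blast
      qed
      show "{w. w \<noteq> f v \<and> {f v, w} \<in> C} \<subseteq> f ` {w. w \<noteq> v \<and> {v, w} \<in> A}"
      proof
        fix w' assume w': "w' \<in> {w. w \<noteq> f v \<and> {f v, w} \<in> C}"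
        let ?j = "inv_into (vertices A) f"
        have "w' \<in> vertices C" using w' by blast
        then have fw: "f (?j w') = w'" using bij by (simp add: bij_betw_inv_into_right)
        have "?j ` {f v, w'} \<in> A" using complex_iso_simplex[OF complex_iso_inv[OF iso]] w' by blast
        then have "{v, ?j w'} \<in> A" using inv_into_f_f[OF inj v] by simp
        moreover have "?j w' \<noteq> v"
        proof
          assume "?j w' = v"
          then have "f v = w'" using fw by simp
          then show False using w' by blast
        qed
        ultimately have "?j w' \<in> {w. w \<noteq> v \<and> {v, w} \<in> A}" by blast
        then show "w' \<in> f ` {w. w \<noteq> v \<and> {v, w} \<in> A}" by (rule rev_image_eqI) (rule fw[symmetric])
      qed
    qed
  qed
  then show ?thesis unfolding vertices_link[OF A] vertices_link[OF C] by (rule card_of_ordIsoI)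
qed

lemma simplicial_complex_iso:
  assumes "complex_iso f A C" "simplicial_complex A" shows "simplicial_complex C"
  unfolding simplicial_complex_def
proof (intro ballI conjI allI impI)
  fix S assume "S \<in> C"
  then have "S \<in> (\<lambda>S. f ` S) ` A" using assms(1) by (simp add: complex_iso_def)
  then obtain T where T: "T \<in> A" "S = f ` T" by blast
  have T': "finite T" "\<And>W. W \<subseteq> T \<Longrightarrow> W \<in> A" using assms(2) T(1) unfolding simplicial_complex_def by simp_all
  show "finite S" unfolding T(2) using T'(1) by (rule finite_imageI)
  show "U \<in> C" if U: "U \<subseteq> S" for U
  proof -
    obtain W where W: "W \<subseteq> T" "U = f ` W" using U unfolding T(2) subset_image_iff by blast
    show ?thesis unfolding W(2) by (rule complex_iso_simplex[OF assms(1) T'(2)[OF W(1)]])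
  qed
qed

lemma building_iso:
  assumes iso: "complex_iso \<iota> \<Delta> \<Delta>'" and b: "A2_tilde_building \<Delta>"
  shows "A2_tilde_building \<Delta>'"
proof -
  have inj: "inj_on \<iota> (vertices \<Delta>)" and im: "(\<lambda>S. \<iota> ` S) ` \<Delta> = \<Delta>'"
    using iso by (auto simp: complex_iso_def bij_betw_def)
  obtain \<A> where A: "\<A> \<noteq> {}" "\<Delta> = \<Union>\<A>" "\<forall>\<Sigma>\<in>\<A>. \<exists>f. complex_iso f A2_tilde_coxeter_complex \<Sigma>"
    "\<forall>A\<in>\<Delta>. \<forall>B\<in>\<Delta>. \<exists>\<Sigma>\<in>\<A>. A \<in> \<Sigma> \<and> B \<in> \<Sigma>"
    "\<forall>\<Sigma>\<in>\<A>. \<forall>\<Sigma>'\<in>\<A>. \<forall>A\<in>\<Sigma> \<inter> \<Sigma>'. \<forall>B\<in>\<Sigma> \<inter> \<Sigma>'.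
       \<exists>f. complex_iso f \<Sigma> \<Sigma>' \<and> (\<forall>x\<in>A \<union> B. f x = x)"
    using b unfolding A2_tilde_building_def by (elim conjE exE) (rule that; assumption)
  define im\<iota> where "im\<iota> \<Sigma> = (\<lambda>S. \<iota> ` S) ` \<Sigma>" for \<Sigma>
  have isoS: "complex_iso \<iota> \<Sigma> (im\<iota> \<Sigma>)" if "\<Sigma> \<in> \<A>" for \<Sigma>
  proof -
    have "vertices \<Sigma> \<subseteq> vertices \<Delta>" using that unfolding A(2) by blast
    then show ?thesis unfolding im\<iota>_def by (intro complex_iso_image inj_on_subset[OF inj])
  qed
  have sc: "simplicial_complex \<Delta>'"
    by (rule simplicial_complex_iso[OF iso]) (use b in \<open>simp add: A2_tilde_building_def\<close>)
  show ?thesis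
    unfolding A2_tilde_building_def
  proof (intro conjI exI[of _ "im\<iota> ` \<A>"] ballI)
    show "simplicial_complex \<Delta>'" by (rule sc)
    show "im\<iota> ` \<A> \<noteq> {}" using A(1) by blast
    show "\<Delta>' = \<Union> (im\<iota> ` \<A>)" unfolding im[symmetric] A(2) im\<iota>_def by blast
    show "\<exists>f. complex_iso f A2_tilde_coxeter_complex \<Sigma>" if S: "\<Sigma> \<in> im\<iota> ` \<A>" for \<Sigma>
    proof -
      obtain S where "S \<in> \<A>" "\<Sigma> = im\<iota> S" using S by blast
      moreover obtain f where "complex_iso f A2_tilde_coxeter_complex S" using A(3) \<open>S \<in> \<A>\<close> by blast
      ultimately have "complex_iso (\<iota> \<circ> f) A2_tilde_coxeter_complex \<Sigma>"
        using complex_iso_comp[OF _ isoS] by simp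
      then show ?thesis by blast
    qed
    show "\<exists>\<Sigma>\<in>im\<iota> ` \<A>. S \<in> \<Sigma> \<and> T \<in> \<Sigma>" if ST: "S \<in> \<Delta>'" "T \<in> \<Delta>'" for S T
    proof -
      obtain S0 T0 where 0: "S0 \<in> \<Delta>" "T0 \<in> \<Delta>" "S = \<iota> ` S0" "T = \<iota> ` T0" using ST unfolding im[symmetric] by blast
      then obtain \<Sigma> where "\<Sigma> \<in> \<A>" "S0 \<in> \<Sigma>" "T0 \<in> \<Sigma>" using A(4) by blast
      then show ?thesis unfolding im\<iota>_def using 0(3,4) by blast
    qed
    show "\<exists>f. complex_iso f \<Sigma> \<Sigma>' \<and> (\<forall>x\<in>S \<union> T. f x = x)"
      if S: "\<Sigma> \<in> im\<iota> ` \<A>" "\<Sigma>' \<in> im\<iota> ` \<A>" "S \<in> \<Sigma> \<inter> \<Sigma>'" "T \<in> \<Sigma> \<inter> \<Sigma>'" for \<Sigma> \<Sigma>' S T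
    proof -
      obtain P P' where P: "P \<in> \<A>" "P' \<in> \<A>" "\<Sigma> = im\<iota> P" "\<Sigma>' = im\<iota> P'" using S(1,2) by blast
      \<comment> \<open>A simplex shared by two image apartments has a preimage in each; they
        coincide because \<iota> is injective on vertices.\<close>
      have pull: "\<exists>S0. S0 \<in> P \<inter> P' \<and> S = \<iota> ` S0" if S: "S \<in> \<Sigma> \<inter> \<Sigma>'" for S
      proof -
        obtain S0 S1 where *: "S0 \<in> P" "S1 \<in> P'" "S = \<iota> ` S0" "S = \<iota> ` S1"
          using S unfolding P(3,4) im\<iota>_def by blast
        have "S0 \<subseteq> vertices \<Delta>" "S1 \<subseteq> vertices \<Delta>" using * P(1,2) A(2) by blast+
        then have "S0 = S1" using inj_on_image_eq_iff[OF inj] *(3,4) by blast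
        then show ?thesis using * by blast
      qed
      obtain S0 where S0: "S0 \<in> P \<inter> P'" "S = \<iota> ` S0" using pull[OF S(3)] by blast
      obtain T0 where T0: "T0 \<in> P \<inter> P'" "T = \<iota> ` T0" using pull[OF S(4)] by blast
      obtain f where f: "complex_iso f P P'" "\<forall>x\<in>S0 \<union> T0. f x = x"
        using A(5)[rule_format, OF P(1,2) S0(1) T0(1)] by blast
      let ?j = "inv_into (vertices P) \<iota>"
      have "complex_iso (\<iota> \<circ> (f \<circ> ?j)) \<Sigma> \<Sigma>'"
        unfolding P(3,4)
        by (rule complex_iso_comp[OF complex_iso_comp[OF complex_iso_inv[OF isoS[OF P(1)]] f(1)] isoS[OF P(2)]])
      moreover have "(\<iota> \<circ> (f \<circ> ?j)) x = x" if x: "x \<in> S \<union> T" for x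
      proof -
        obtain y where y: "y \<in> S0 \<union> T0" "x = \<iota> y" using x S0(2) T0(2) by blast
        have "y \<in> vertices P" using y(1) S0(1) T0(1) by blast
        moreover have "inj_on \<iota> (vertices P)" using isoS[OF P(1)] by (simp add: complex_iso_def bij_betw_def)
        ultimately have "?j x = y" using y(2) by simp
        then show ?thesis using f(2) y by simp
      qed
      ultimately show ?thesis by blast
    qed
  qed
qed

lemma thick_iso:
  assumes iso: "complex_iso \<iota> \<Delta> \<Delta>'" and th: "thick \<Delta>"
  shows "thick \<Delta>'"
  unfolding thick_def
proof (intro ballI impI)
  have inj: "inj_on \<iota> (vertices \<Delta>)" and im: "(\<lambda>S. \<iota> ` S) ` \<Delta> = \<Delta>'"
    using iso by (auto simp: complex_iso_def bij_betw_def)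
  have card: "card (\<iota> ` S) = card S" if "S \<in> \<Delta>" for S
    using that by (intro card_image inj_on_subset[OF inj]) blast
  fix P assume P: "P \<in> \<Delta>'" "card P = 2"
  then obtain Q where Q: "Q \<in> \<Delta>" "P = \<iota> ` Q" unfolding im[symmetric] by blast
  then have "card Q = 2" using card[OF Q(1)] P(2) by simp
  then obtain T where T: "T \<subseteq> {C \<in> \<Delta>. card C = 3 \<and> Q \<subseteq> C}" "card T = 3"
    using th[unfolded thick_def, rule_format, OF Q(1)] by blast
  have "inj_on (\<lambda>S. \<iota> ` S) T"
  proof (rule inj_onI)
    fix C D assume "C \<in> T" "D \<in> T" and eq: "\<iota> ` C = \<iota> ` D"
    then have "C \<subseteq> vertices \<Delta>" "D \<subseteq> vertices \<Delta>" using T(1) by blast+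
    then show "C = D" using inj_on_image_eq_iff[OF inj] eq by blast
  qed
  then have "card ((\<lambda>S. \<iota> ` S) ` T) = 3" using T(2) by (simp add: card_image)
  moreover have "(\<lambda>S. \<iota> ` S) ` T \<subseteq> {C \<in> \<Delta>'. card C = 3 \<and> P \<subseteq> C}"
  proof
    fix C assume "C \<in> (\<lambda>S. \<iota> ` S) ` T"
    then obtain D where D: "D \<in> T" "C = \<iota> ` D" by blast
    then have *: "D \<in> \<Delta>" "card D = 3" "Q \<subseteq> D" using T(1) by blast+
    have "C \<in> \<Delta>'" unfolding D(2) by (rule complex_iso_simplex[OF iso *(1)])
    moreover have "card C = 3" unfolding D(2) card[OF *(1)] by (rule *(2))
    moreover have "P \<subseteq> C" unfolding D(2) Q(2) by (rule image_mono[OF *(3)])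
    ultimately show "C \<in> {C \<in> \<Delta>'. card C = 3 \<and> P \<subseteq> C}" by blast
  qed
  ultimately show "\<exists>T. T \<subseteq> {C \<in> \<Delta>'. card C = 3 \<and> P \<subseteq> C} \<and> card T = 3" by blast
qed

text \<open>The orbit map at \<open>s0\<close> identifies a simply transitive group with the set of
  vertices, so one injection \<iota> places both group and building in \<open>'k\<close>. The
  members of \<open>H\<close> are arbitrary outside the vertices; choosing one \<open>g v\<close>
  for each vertex v avoids forming a quotient of \<open>H\<close>.\<close>

lemma simply_transitive_A2_tilde_group:
  fixes \<Delta> :: "'v set set" and H :: "('v \<Rightarrow> 'v) set" and \<iota> :: "'v \<Rightarrow> 'k"
  assumes b: "A2_tilde_building \<Delta>" and th: "thick \<Delta>" and ty: "type_function \<Delta> \<tau>"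
    and H_iso: "\<And>h. h \<in> H \<Longrightarrow> complex_iso h \<Delta> \<Delta>" and H_rot: "\<And>h. h \<in> H \<Longrightarrow> type_rotating \<Delta> \<tau> h"
    and H_comp: "\<And>h h'. h \<in> H \<Longrightarrow> h' \<in> H \<Longrightarrow> h \<circ> h' \<in> H"
    and H_inv: "\<And>h. h \<in> H \<Longrightarrow> \<exists>h'\<in>H. \<forall>v\<in>vertices \<Delta>. h' (h v) = v"
    and s0: "s0 \<in> vertices \<Delta>"
    and H_trans: "\<And>v. v \<in> vertices \<Delta> \<Longrightarrow> \<exists>h\<in>H. h s0 = v"
    and H_free: "\<And>h v. h \<in> H \<Longrightarrow> h s0 = s0 \<Longrightarrow> v \<in> vertices \<Delta> \<Longrightarrow> h v = v"
    and inj: "inj_on \<iota> (vertices \<Delta>)"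
  shows "\<exists>(G :: 'k monoid) (\<Delta>' :: 'k set set) \<phi>. A2_tilde_group G \<Delta>' \<phi> \<and>
    (\<forall>v\<in>vertices \<Delta>'. |vertices (link \<Delta>' v)| =o |vertices (link \<Delta> s0)| )"
proof -
  define S where "S = vertices \<Delta>"
  note s0 = s0[folded S_def] and H_trans = H_trans[folded S_def] and H_free = H_free[folded S_def]
    and inj = inj[folded S_def] and H_inv = H_inv[folded S_def]
  obtain g where g: "\<And>v. v \<in> S \<Longrightarrow> g v \<in> H" "\<And>v. v \<in> S \<Longrightarrow> g v s0 = v"
    using H_trans by metis
  have mem: "h v \<in> S" if "h \<in> H" "v \<in> S" for h v
    using H_iso[OF that(1)] that(2) bij_betwE unfolding complex_iso_def S_def[symmetric] by metis
  \<comment> \<open>Freeness is assumed at \<open>s0\<close> only. For a left inverse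
    \<open>k\<close> of h, the map \<open>k \<circ> h'\<close> fixes \<open>s0\<close>, hence all
    vertices; \<open>l\<close> then cancels \<open>k\<close>.\<close>
  have eqH: "h v = h' v" if h: "h \<in> H" "h' \<in> H" "h s0 = h' s0" and v: "v \<in> S" for h h' v
  proof -
    obtain k where k: "k \<in> H" "\<forall>v\<in>S. k (h v) = v" using H_inv[OF h(1)] by blast
    obtain l where l: "l \<in> H" "\<forall>v\<in>S. l (k v) = v" using H_inv[OF k(1)] by blast
    have "k (h s0) = s0" using k(2) s0 by blast
    then have "(k \<circ> h') s0 = s0" using h(3) by simp
    then have "(k \<circ> h') v = v" using H_free[OF H_comp[OF k(1) h(2)]] v by blast
    moreover have "k (h v) = v" using k(2) v by blast
    ultimately have eq: "k (h v) = k (h' v)" by simp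
    have "h v = l (k (h v))" using l(2) mem[OF h(1) v] by metis
    also have "\<dots> = h' v" unfolding eq using l(2) mem[OF h(2) v] by metis
    finally show ?thesis .
  qed
  have gid: "g s0 v = v" if "v \<in> S" for v using H_free[OF g(1)[OF s0] g(2)[OF s0] that] .
  have gg: "g (g x y) v = g x (g y v)" if "x \<in> S" "y \<in> S" "v \<in> S" for x y v
    using eqH[of "g (g x y)" "g x \<circ> g y" v] g that mem[OF g(1)] H_comp by simp
  have ginv: "\<exists>y\<in>S. g y x = s0" if x: "x \<in> S" for x
  proof -
    obtain k where k: "k \<in> H" "\<forall>v\<in>S. k (g x v) = v" using H_inv[OF g(1)[OF x]] by blast
    have ks: "k s0 \<in> S" using mem k(1) s0 by blast
    have "g (k s0) x = k x" using eqH[of "g (k s0)" k x] g ks k(1) x by simp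
    also have "\<dots> = k (g x s0)" using g(2)[OF x] by simp
    also have "\<dots> = s0" using k(2) s0 by blast
    finally show ?thesis using ks by blast
  qed
  define j where "j = inv_into S \<iota>"
  have j: "j (\<iota> v) = v" if "v \<in> S" for v using inj that by (simp add: j_def)
  define \<Delta>' where "\<Delta>' = (\<lambda>A. \<iota> ` A) ` \<Delta>"
  have V': "vertices \<Delta>' = \<iota> ` S" unfolding \<Delta>'_def S_def by blast
  have iso: "complex_iso \<iota> \<Delta> \<Delta>'" unfolding \<Delta>'_def by (rule complex_iso_image[OF inj[unfolded S_def]])
  have jiso: "complex_iso j \<Delta>' \<Delta>" unfolding j_def S_def by (rule complex_iso_inv[OF iso])
  define G :: "'k monoid" where "G = \<lparr>carrier = \<iota> ` S, monoid.mult = (\<lambda>a c. \<iota> (g (j a) (j c))), one = \<iota> s0\<rparr>"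
  have [simp]: "carrier G = \<iota> ` S" "a \<otimes>\<^bsub>G\<^esub> c = \<iota> (g (j a) (j c))" "\<one>\<^bsub>G\<^esub> = \<iota> s0" for a c
    by (simp_all add: G_def)
  have gmem: "g x y \<in> S" if "x \<in> S" "y \<in> S" for x y using mem[OF g(1)[OF that(1)] that(2)] .
  have G: "group G"
  proof (rule groupI)
    fix x y assume "x \<in> carrier G" "y \<in> carrier G"
    then show "x \<otimes>\<^bsub>G\<^esub> y \<in> carrier G" using gmem by (auto simp: j)
  next
    show "\<one>\<^bsub>G\<^esub> \<in> carrier G" using s0 by simp
  next
    fix x y z assume "x \<in> carrier G" "y \<in> carrier G" "z \<in> carrier G"
    then obtain u v w where "u \<in> S" "v \<in> S" "w \<in> S" "x = \<iota> u" "y = \<iota> v" "z = \<iota> w" by auto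
    then show "x \<otimes>\<^bsub>G\<^esub> y \<otimes>\<^bsub>G\<^esub> z = x \<otimes>\<^bsub>G\<^esub> (y \<otimes>\<^bsub>G\<^esub> z)" by (simp add: j gmem gg)
  next
    fix x assume "x \<in> carrier G"
    then obtain u where u: "u \<in> S" "x = \<iota> u" by auto
    then show "\<one>\<^bsub>G\<^esub> \<otimes>\<^bsub>G\<^esub> x = x" using s0 by (simp add: j gid)
    obtain y where "y \<in> S" "g y u = s0" using ginv[OF u(1)] by blast
    then show "\<exists>y\<in>carrier G. y \<otimes>\<^bsub>G\<^esub> x = \<one>\<^bsub>G\<^esub>"
      using u by (intro bexI[of _ "\<iota> y"]) (simp_all add: j)
  qed
  interpret G: group G by (rule G)
  \<comment> \<open>Left multiplication, made \<open>undefined\<close> outside the carrier because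
    elements of \<open>BijGroup\<close> are extensional.\<close>
  define \<phi> where "\<phi> a = restrict (\<lambda>c. a \<otimes>\<^bsub>G\<^esub> c) (carrier G)" for a
  have \<phi>: "\<phi> a v = (\<iota> \<circ> (g (j a) \<circ> j)) v" if "v \<in> vertices \<Delta>'" for a v
    using that by (simp add: \<phi>_def V')
  have jS: "j a \<in> S" if "a \<in> carrier G" for a using that j by auto
  have giso: "complex_iso (\<phi> a) \<Delta>' \<Delta>'" if a: "a \<in> carrier G" for a
    by (rule complex_iso_cong[OF complex_iso_comp[OF complex_iso_comp[OF jiso H_iso[OF g(1)[OF jS[OF a]]]] iso] \<phi>])
  have bij: "bij_betw (\<phi> a) (carrier G) (carrier G)" if "a \<in> carrier G" for a
    using giso[OF that] unfolding complex_iso_def V' by simp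
  have action: "group_action G (vertices \<Delta>') \<phi>"
  proof -
    have V'': "vertices \<Delta>' = carrier G" by (simp add: V')
    have "\<phi> \<in> hom G (BijGroup (carrier G))"
    proof (rule homI)
      fix a assume "a \<in> carrier G"
      then show "\<phi> a \<in> carrier (BijGroup (carrier G))"
        using bij[of a] by (simp add: BijGroup_def Bij_def \<phi>_def)
    next
      fix a c assume ac: "a \<in> carrier G" "c \<in> carrier G"
      then have "\<phi> a \<in> Bij (carrier G)" "\<phi> c \<in> Bij (carrier G)"
        using bij[OF ac(1)] bij[OF ac(2)] by (simp_all add: Bij_def \<phi>_def)
      then have "\<phi> a \<otimes>\<^bsub>BijGroup (carrier G)\<^esub> \<phi> c = compose (carrier G) (\<phi> a) (\<phi> c)"
        by (simp add: BijGroup_def)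
      also have "\<dots> = \<phi> (a \<otimes>\<^bsub>G\<^esub> c)"
      proof
        fix x
        show "compose (carrier G) (\<phi> a) (\<phi> c) x = \<phi> (a \<otimes>\<^bsub>G\<^esub> c) x"
        proof (cases "x \<in> carrier G")
          case True
          have "c \<otimes>\<^bsub>G\<^esub> x \<in> carrier G" by (rule G.m_closed[OF ac(2) True])
          then have "compose (carrier G) (\<phi> a) (\<phi> c) x = a \<otimes>\<^bsub>G\<^esub> (c \<otimes>\<^bsub>G\<^esub> x)"
            using True unfolding compose_def \<phi>_def by (simp only: restrict_apply if_True)
          also have "\<dots> = a \<otimes>\<^bsub>G\<^esub> c \<otimes>\<^bsub>G\<^esub> x" by (rule G.m_assoc[OF ac True, symmetric])
          finally show ?thesis using True unfolding \<phi>_def by (simp only: restrict_apply if_True)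
        qed (simp only: compose_def \<phi>_def restrict_apply if_False)
      qed
      finally show "\<phi> (a \<otimes>\<^bsub>G\<^esub> c) = \<phi> a \<otimes>\<^bsub>BijGroup (carrier G)\<^esub> \<phi> c" ..
    qed
    then show ?thesis
      unfolding V'' group_action_def group_hom_def group_hom_axioms_def
      using G group_BijGroup by blast
  qed
  have sc: "simplicial_complex \<Delta>" using b unfolding A2_tilde_building_def by blast
  have "A2_tilde_group G \<Delta>' \<phi>"
    unfolding A2_tilde_group_def
  proof (intro conjI ballI)
    show "group G" "A2_tilde_building \<Delta>'" "thick \<Delta>'" "group_action G (vertices \<Delta>') \<phi>"
      using G building_iso[OF iso b] thick_iso[OF iso th] action .
    show "complex_iso (\<phi> a) \<Delta>' \<Delta>'" if "a \<in> carrier G" for a using giso[OF that] .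
    show "\<exists>!a. a \<in> carrier G \<and> \<phi> a v = w" if vw: "v \<in> vertices \<Delta>'" "w \<in> vertices \<Delta>'" for v w
    proof (rule ex1I)
      have vw': "v \<in> carrier G" "w \<in> carrier G" using vw by (simp_all add: V')
      show "w \<otimes>\<^bsub>G\<^esub> inv\<^bsub>G\<^esub> v \<in> carrier G \<and> \<phi> (w \<otimes>\<^bsub>G\<^esub> inv\<^bsub>G\<^esub> v) v = w"
      proof
        show "w \<otimes>\<^bsub>G\<^esub> inv\<^bsub>G\<^esub> v \<in> carrier G" by (rule G.m_closed[OF vw'(2) G.inv_closed[OF vw'(1)]])
        have "\<phi> (w \<otimes>\<^bsub>G\<^esub> inv\<^bsub>G\<^esub> v) v = w \<otimes>\<^bsub>G\<^esub> inv\<^bsub>G\<^esub> v \<otimes>\<^bsub>G\<^esub> v"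
          unfolding \<phi>_def using vw'(1) by (simp only: restrict_apply if_True)
        also have "\<dots> = w \<otimes>\<^bsub>G\<^esub> (inv\<^bsub>G\<^esub> v \<otimes>\<^bsub>G\<^esub> v)" by (rule G.m_assoc[OF vw'(2) G.inv_closed[OF vw'(1)] vw'(1)])
        also have "\<dots> = w" unfolding G.l_inv[OF vw'(1)] by (rule G.r_one[OF vw'(2)])
        finally show "\<phi> (w \<otimes>\<^bsub>G\<^esub> inv\<^bsub>G\<^esub> v) v = w" .
      qed
      fix a assume a: "a \<in> carrier G \<and> \<phi> a v = w"
      then have w: "w = a \<otimes>\<^bsub>G\<^esub> v"
        unfolding \<phi>_def using vw'(1) by (simp only: restrict_apply if_True)
      have "w \<otimes>\<^bsub>G\<^esub> inv\<^bsub>G\<^esub> v = a \<otimes>\<^bsub>G\<^esub> (v \<otimes>\<^bsub>G\<^esub> inv\<^bsub>G\<^esub> v)"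
        unfolding w using a vw'(1) by (intro G.m_assoc G.inv_closed) blast+
      also have "\<dots> = a" unfolding G.r_inv[OF vw'(1)] using a by (intro G.r_one) blast
      finally show "a = w \<otimes>\<^bsub>G\<^esub> inv\<^bsub>G\<^esub> v" ..
    qed
    show "\<exists>\<tau>. type_function \<Delta>' \<tau> \<and> (\<forall>a\<in>carrier G. type_rotating \<Delta>' \<tau> (\<phi> a))"
    proof (intro exI[of _ "\<tau> \<circ> j"] conjI ballI)
      show "type_function \<Delta>' (\<tau> \<circ> j)"
        unfolding type_function_def
      proof
        fix A assume "A \<in> \<Delta>'"
        then have "j ` A \<in> \<Delta>" using complex_iso_simplex[OF jiso] by blast
        then have "inj_on \<tau> (j ` A)" using ty unfolding type_function_def by blast
        moreover have "inj_on j A"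
        proof (rule inj_on_subset)
          show "inj_on j (vertices \<Delta>')" using jiso by (simp add: complex_iso_def bij_betw_def)
          show "A \<subseteq> vertices \<Delta>'" using \<open>A \<in> \<Delta>'\<close> by blast
        qed
        ultimately show "inj_on (\<tau> \<circ> j) A" by (rule comp_inj_on[rotated])
      qed
      fix a assume a: "a \<in> carrier G"
      obtain c where c: "\<forall>v\<in>S. \<tau> (g (j a) v) = \<tau> v + c"
        using H_rot[OF g(1)[OF jS[OF a]]] unfolding type_rotating_def S_def[symmetric] by blast
      have "(\<tau> \<circ> j) (\<phi> a v) = (\<tau> \<circ> j) v + c" if v: "v \<in> vertices \<Delta>'" for v
      proof -
        have jv: "j v \<in> S" using v V' j by auto
        show ?thesis using \<phi>[OF v, of a] j[OF gmem[OF jS[OF a] jv]] c jv by simp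
      qed
      then show "type_rotating \<Delta>' (\<tau> \<circ> j) (\<phi> a)" unfolding type_rotating_def by blast
    qed
  qed
  moreover have "|vertices (link \<Delta>' v)| =o |vertices (link \<Delta> s0)|" if v: "v \<in> vertices \<Delta>'" for v
  proof -
    obtain u where u: "u \<in> S" "v = \<iota> u" using v V' by blast
    have sc': "simplicial_complex \<Delta>'" by (rule simplicial_complex_iso[OF iso sc])
    have "|vertices (link \<Delta> s0)| =o |vertices (link \<Delta> (g u s0))|"
      by (rule link_iso[OF sc sc H_iso[OF g(1)[OF u(1)]] s0[unfolded S_def]])
    moreover have "|vertices (link \<Delta> u)| =o |vertices (link \<Delta>' (\<iota> u))|"
      by (rule link_iso[OF sc sc' iso u(1)[unfolded S_def]])
    ultimately have "|vertices (link \<Delta> s0)| =o |vertices (link \<Delta>' v)|"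
      unfolding g(2)[OF u(1)] u(2) by (rule ordIso_transitive)
    then show ?thesis by (rule ordIso_symmetric)
  qed
  ultimately show ?thesis by blast
qed

section \<open>A large cyclic cubic extension\<close>

lemma card_of_Times_image_le:
  assumes inf: "infinite X" and "|A| \<le>o |X|" "|C| \<le>o |X|"
  shows "|f ` (A \<times> C)| \<le>o |X|"
proof -
  have "|SIGMA a:A. C| \<le>o |X|" using assms by (intro card_of_Sigma_ordLeq_infinite) simp_all
  then show ?thesis using card_of_image ordLeq_transitive by blast
qed

lemma nat_UN_card_le:
  assumes inf: "infinite X" and "\<And>n::nat. |A n| \<le>o |X|"
  shows "|\<Union>n. A n| \<le>o |X|"
  using assms infinite_iff_card_of_nat[of X] by (intro card_of_UNION_ordLeq_infinite) simp_all

lemma finite_card_le: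
  assumes "finite A" "infinite X" shows "|A| \<le>o |X|"
proof -
  obtain f :: "'a \<Rightarrow> nat" where "inj_on f A" using finite_imp_inj_to_nat_seg[OF assms(1)] by blast
  then have "|A| \<le>o |UNIV :: nat set|" unfolding card_of_ordLeq[symmetric] by blast
  then show ?thesis using assms(2) infinite_iff_card_of_nat ordLeq_transitive by blast
qed

lemma closure_exists:
  fixes X :: "'x set" and S :: "'a set" and ops :: "('a \<Rightarrow> 'a \<Rightarrow> 'a) set"
  assumes inf: "infinite X" and S: "|S| \<le>o |X|" and ops: "finite ops"
  shows "\<exists>K. S \<subseteq> K \<and> |K| \<le>o |X| \<and> (\<forall>f\<in>ops. \<forall>a\<in>K. \<forall>b\<in>K. f a b \<in> K)"
proof -
  \<comment> \<open>The first projection makes each closure step increasing, so that two elements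
    found at different stages meet at a common one.\<close>
  define ops' where "ops' = insert (\<lambda>a b. a) ops"
  define step where "step A = (\<Union>f\<in>ops'. (\<lambda>(a, b). f a b) ` (A \<times> A))" for A
  have stepI: "f a b \<in> step A" if "f \<in> ops'" "a \<in> A" "b \<in> A" for f a b A
    using that unfolding step_def by (intro UN_I[of f] image_eqI[of _ _ "(a, b)"]) auto
  have inc: "A \<subseteq> step A" for A
    using stepI[of "\<lambda>a b. a"] by (auto simp: ops'_def)
  have ops'_le: "|ops'| \<le>o |X|"
    by (rule finite_card_le[OF _ inf]) (simp add: ops'_def ops)
  have card_step: "|step A| \<le>o |X|" if "|A| \<le>o |X|" for A
    unfolding step_def
    by (rule card_of_UNION_ordLeq_infinite[OF inf ops'_le]) (use card_of_Times_image_le[OF inf that that] in blast)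
  define K where "K = (\<Union>n. (step ^^ n) S)"
  have "|(step ^^ n) S| \<le>o |X|" for n
    by (induction n) (use S card_step in auto)
  then have 1: "|K| \<le>o |X|" unfolding K_def by (rule nat_UN_card_le[OF inf])
  have monomial: "(step ^^ m) S \<subseteq> (step ^^ n) S" if "m \<le> n" for m n
    using that
  proof (induction n rule: dec_induct)
    case (step n)
    then show ?case using inc[of "(step ^^ n) S"] by auto
  qed simp
  have 2: "f a b \<in> K" if f: "f \<in> ops" and a: "a \<in> K" and b: "b \<in> K" for f a b
  proof -
    obtain m where "a \<in> (step ^^ m) S" using a unfolding K_def by blast
    moreover obtain n where "b \<in> (step ^^ n) S" using b unfolding K_def by blast
    ultimately have "a \<in> (step ^^ max m n) S" "b \<in> (step ^^ max m n) S"
      using monomial[of m "max m n"] monomial[of n "max m n"] by auto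
    then have "f a b \<in> (step ^^ Suc (max m n)) S" using stepI[of f] f by (simp add: ops'_def)
    then show ?thesis unfolding K_def by blast
  qed
  have "(step ^^ 0) S \<subseteq> K" unfolding K_def by blast
  then have 3: "S \<subseteq> K" by simp
  show ?thesis using 1 2 3 by blast
qed

text \<open>Unary operations are treated as binary ones that ignore an argument, and the nonzero
  element b provides 0 as b - b and 1 as b / b.\<close>

lemma subfield_closure_exists:
  fixes X :: "'x set" and S :: "'a::field set"
  assumes inf: "infinite X" and S: "|S| \<le>o |X|" and ne: "b \<in> S" "b \<noteq> 0"
  shows "\<exists>K. S \<subseteq> K \<and> |K| \<le>o |X| \<and> subfield_of K \<and> (\<forall>a\<in>K. f a \<in> K)"
proof -
  let ?ops = "{(\<lambda>a b. a + b), (\<lambda>a b. a - b), (\<lambda>a b. a * b), (\<lambda>a b. a / b), (\<lambda>a b. f a)} :: ('a \<Rightarrow> 'a \<Rightarrow> 'a) set"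
  obtain K where K: "S \<subseteq> K" "|K| \<le>o |X|" "\<forall>f\<in>?ops. \<forall>a\<in>K. \<forall>b\<in>K. f a b \<in> K"
    using closure_exists[OF inf S, of ?ops] by auto
  have c: "a + b \<in> K" "a - b \<in> K" "a * b \<in> K" "a / b \<in> K" "f a \<in> K" if "a \<in> K" "b \<in> K" for a b
    using K(3) that by auto
  have b: "b \<in> K" using ne(1) K(1) by blast
  have 0: "0 \<in> K" using c(2)[OF b b] by simp
  have 1: "1 \<in> K" using c(4)[OF b b] ne(2) by simp
  have "subfield_of K"
  proof
    show "0 \<in> K" "1 \<in> K" by fact+
    show "a + b \<in> K" "a * b \<in> K" if "a \<in> K" "b \<in> K" for a b using c that by auto
    show "- a \<in> K" if "a \<in> K" for a using c(2)[OF 0 that] by simp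
    show "inverse a \<in> K" if "a \<in> K" for a using c(4)[OF 1 that] by (simp add: divide_inverse)
  qed
  then show ?thesis using K(1,2) c(5)[OF _ b] by blast
qed

text \<open>
  A linearly ordered copy of \<open>'k\<close>: the instance of \<open>idom\<close> for polynomial mappings needs an order
  on the variables.
\<close>

typedef 'k var = "UNIV :: 'k set" ..

definition var_order :: "'k rel" where "var_order = (SOME r. well_order_on UNIV r)"

lemma var_order: "linear_order_on UNIV (var_order :: 'k rel)"
proof -
  have "well_order_on UNIV (var_order :: 'k rel)"
    unfolding var_order_def using well_order_on[of UNIV] by (rule someI_ex)
  then show ?thesis by (simp add: well_order_on_def)
qed

instantiation var :: (type) linorder
begin

definition less_eq_var :: "'a var \<Rightarrow> 'a var \<Rightarrow> bool" where
  "less_eq_var x y \<longleftrightarrow> (Rep_var x, Rep_var y) \<in> var_order"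

definition less_var :: "'a var \<Rightarrow> 'a var \<Rightarrow> bool" where
  "less_var x y \<longleftrightarrow> x \<le> y \<and> \<not> y \<le> x"

instance
proof
  have r: "refl_on UNIV (var_order :: 'a rel)" "trans (var_order :: 'a rel)"
    "antisym (var_order :: 'a rel)" "total_on UNIV (var_order :: 'a rel)"
    using var_order[where 'k = 'a] by (simp_all add: linear_order_on_def partial_order_on_def preorder_on_def)
  fix x y z :: "'a var"
  show "x < y \<longleftrightarrow> x \<le> y \<and> \<not> y \<le> x" by (rule less_var_def)
  show "x \<le> x" using r(1) by (simp add: less_eq_var_def refl_on_def)
  show "x \<le> z" if "x \<le> y" "y \<le> z" using that r(2) unfolding less_eq_var_def by (rule transD[rotated])
  show "x = y" if "x \<le> y" "y \<le> x"
    using antisymD[OF r(3) that[unfolded less_eq_var_def]] by (simp add: Rep_var_inject)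
  show "x \<le> y \<or> y \<le> x"
    using r(1,4) unfolding less_eq_var_def total_on_def refl_on_def by (metis UNIV_I)
qed

end

text \<open>The polynomial ring over the complex numbers in variables indexed by \<open>'k\<close>.
  The complex numbers supply a primitive cube root of unity in characteristic zero.\<close>

type_synonym 'k coeffs = "('k var \<Rightarrow>\<^sub>0 nat) \<Rightarrow>\<^sub>0 complex"

definition X_var :: "'k \<Rightarrow> 'k coeffs" where
  "X_var i = Poly_Mapping.single (Poly_Mapping.single (Abs_var i) 1) 1"

lemma X_var_inj: "X_var i = X_var j \<longleftrightarrow> i = j"
proof
  assume "X_var i = X_var j"
  then have "Poly_Mapping.lookup (X_var i) (Poly_Mapping.single (Abs_var j) 1) = 1"
    by (simp add: X_var_def)
  then have "Poly_Mapping.single (Abs_var i) (1 :: nat) = Poly_Mapping.single (Abs_var j) 1"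
    by (auto simp: X_var_def lookup_single when_def split: if_splits)
  then have "Poly_Mapping.lookup (Poly_Mapping.single (Abs_var i) (1 :: nat)) (Abs_var j) = 1" by simp
  then have "Abs_var i = Abs_var j" by (auto simp: lookup_single when_def split: if_splits)
  then show "i = j" by (simp add: Abs_var_inject)
qed simp

lemma X_var_nonzero: "X_var i \<noteq> 0"
proof
  assume "X_var i = 0"
  then have "Poly_Mapping.lookup (X_var i) (Poly_Mapping.single (Abs_var i) 1) = 0" by simp
  then show False by (simp add: X_var_def)
qed

definition fract_map :: "('a::idom \<Rightarrow> 'a) \<Rightarrow> 'a fract \<Rightarrow> 'a fract" where
  "fract_map h q = (THE r. \<exists>a b. b \<noteq> 0 \<and> q = Fract a b \<and> r = Fract (h a) (h b))"

locale idom_mono =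
  fixes h :: "'a::idom \<Rightarrow> 'a"
  assumes add: "h (a + b) = h a + h b" and mult: "h (a * b) = h a * h b" and one: "h 1 = 1"
    and zero: "h a = 0 \<longleftrightarrow> a = 0"
begin

lemma fract_map_Fract: assumes "b \<noteq> 0" shows "fract_map h (Fract a b) = Fract (h a) (h b)"
  unfolding fract_map_def
proof (rule the_equality)
  show "\<exists>a' b'. b' \<noteq> 0 \<and> Fract a b = Fract a' b' \<and> Fract (h a) (h b) = Fract (h a') (h b')"
    using assms by blast
  fix r assume "\<exists>a' b'. b' \<noteq> 0 \<and> Fract a b = Fract a' b' \<and> r = Fract (h a') (h b')"
  then obtain a' b' where *: "b' \<noteq> 0" "Fract a b = Fract a' b'" "r = Fract (h a') (h b')" by blast
  then have "a * b' = a' * b" using assms by (simp add: eq_fract)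
  then have "h a * h b' = h a' * h b" by (metis mult)
  then show "r = Fract (h a) (h b)" unfolding *(3) using assms *(1) by (simp add: eq_fract zero)
qed

lemma fract_map_add: "fract_map h (p + q) = fract_map h p + fract_map h q"
  by (cases p; cases q) (simp add: fract_map_Fract add mult zero)

lemma fract_map_mult: "fract_map h (p * q) = fract_map h p * fract_map h q"
  by (cases p; cases q) (simp add: fract_map_Fract mult zero)

lemma fract_map_1: "fract_map h 1 = 1"
  by (simp add: One_fract_def fract_map_Fract one)

end

section \<open>An automorphism of order three of a rational function field\<close>

definition omega :: complex where "omega = cis (2 * pi / 3)"

lemma omega_cubed: "omega ^ 3 = 1"
  by (simp add: omega_def DeMoivre)

lemma omega_ne_1: "omega \<noteq> 1"
proof
  assume "omega = 1"
  then have "cos (2 * pi / 3) = 1" by (simp add: omega_def complex_eq_iff)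
  then show False by (simp add: cos_120)
qed

definition om :: "'k coeffs" where "om = Poly_Mapping.single 0 omega"

lemma om_cubed: "om * (om * om) = 1"
  using omega_cubed by (simp add: om_def mult_single power3_eq_cube mult.assoc)

lemma om_ne_1: "om \<noteq> 1"
proof
  assume "om = (1 :: 'k coeffs)"
  then have "Poly_Mapping.lookup (om :: 'k coeffs) 0 = Poly_Mapping.lookup (1 :: 'k coeffs) 0" by simp
  then show False using omega_ne_1 by (simp add: om_def lookup_one)
qed

definition rot :: "'k coeffs poly \<Rightarrow> 'k coeffs poly" where
  "rot p = pcompose p [:0, om:]"

lemma om_ne_0: "om \<noteq> 0"
proof
  assume "om = (0 :: 'k coeffs)"
  then have "om * (om * om) = (0 :: 'k coeffs)" by simp
  then show False unfolding om_cubed by simp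
qed

interpretation rot: idom_mono "rot :: 'k coeffs poly \<Rightarrow> 'k coeffs poly"
proof
  fix a b :: "'k coeffs poly"
  show "rot (a + b) = rot a + rot b" "rot (a * b) = rot a * rot b" "rot 1 = 1"
    by (simp_all add: rot_def pcompose_add pcompose_mult pcompose_1)
  show "rot a = 0 \<longleftrightarrow> a = 0"
    unfolding rot_def by (rule pcompose_eq_0_iff) (simp add: om_ne_0)
qed

lemma rot_rot_rot: "rot (rot (rot p)) = p"
proof -
  have "rot (rot (rot p)) = pcompose p (pcompose [:0, om:] (pcompose [:0, om:] [:0, om:]))"
    by (simp only: rot_def pcompose_assoc)
  also have "pcompose [:0, om:] (pcompose [:0, om:] [:0, om:]) = [:0, 1 :: 'k coeffs:]"
    by (simp add: pcompose_pCons om_cubed)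
  finally show ?thesis by simp
qed

abbreviation rot_fract :: "'k coeffs poly fract \<Rightarrow> 'k coeffs poly fract" where
  "rot_fract \<equiv> fract_map rot"

lemma rot_fract_cubed: "rot_fract (rot_fract (rot_fract q)) = q"
  by (cases q) (simp add: rot.fract_map_Fract rot.zero rot_rot_rot)

text \<open>The elements 1 + X_i T. They are chosen so that no two of them are proportional over the
  fixed field of T -> \<omega> T, and so that none of them is fixed.\<close>

definition lin :: "'k \<Rightarrow> 'k coeffs poly fract" where "lin i = Fract [:1, X_var i:] 1"

lemma lin_nonzero: "lin i \<noteq> 0"
  by (simp add: lin_def Zero_fract_def eq_fract)

lemma rot_lin: "rot_fract (lin i) = Fract [:1, om * X_var i:] 1"
  by (simp add: lin_def rot.fract_map_Fract rot.one) (simp add: rot_def pcompose_pCons mult.commute)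

lemma rot_lin_ne: "rot_fract (lin i) \<noteq> lin i"
  unfolding rot_lin by (simp add: lin_def eq_fract om_ne_1 X_var_nonzero)

text \<open>After clearing denominators, the coefficient of T gives (1 - \<omega>)(X_j - X_i) =
  0.\<close>

lemma rot_lin_quotient: assumes "rot_fract (lin j / lin i) = lin j / lin i" shows "i = j"
proof -
  have "rot_fract (lin j / lin i) * rot_fract (lin i) = rot_fract (lin j)"
    by (simp add: lin_nonzero flip: rot.fract_map_mult)
  then have "lin j * rot_fract (lin i) = rot_fract (lin j) * lin i"
    using assms lin_nonzero[of i] by (simp add: field_simps)
  then have "[:1, X_var j:] * [:1, om * X_var i:] = [:1, om * X_var j:] * [:1, X_var i:]"
    unfolding rot_lin by (simp add: lin_def eq_fract)
  then have "coeff ([:1, X_var j:] * [:1, om * X_var i:]) 1 = coeff ([:1, om * X_var j:] * [:1, X_var i:]) 1"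
    by simp
  then have "X_var j + om * X_var i = om * X_var j + X_var i" by (simp add: algebra_simps)
  then have "(1 - om) * (X_var j - X_var i) = 0" by (simp add: algebra_simps)
  then have "X_var j = X_var i" by (simp add: om_ne_1 om_ne_1[symmetric])
  then show ?thesis by (simp add: X_var_inj)
qed

lemma cyclic_cubic_exists:
  fixes X :: "'k set"
  assumes inf: "infinite X"
  shows "\<exists>K. cyclic_cubic K (rot_fract :: 'k coeffs poly fract \<Rightarrow> _) \<and> |K| \<le>o |X| \<and> lin ` X \<subseteq> K"
proof -
  obtain i where i: "i \<in> X" using inf by fastforce
  obtain K where K: "lin ` X \<subseteq> K" "|K| \<le>o |X|" "subfield_of K" "\<forall>a\<in>K. rot_fract a \<in> K"
    using subfield_closure_exists[OF inf card_of_image[of lin X] imageI[OF i] lin_nonzero, of rot_fract] by blast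
  have "cyclic_cubic K (rot_fract :: 'k coeffs poly fract \<Rightarrow> _)"
  proof (rule cyclic_cubic.intro)
    show "subfield_of K" by (rule K(3))
    show "(3 :: 'k coeffs poly fract) \<noteq> 0"
    proof
      assume "(3 :: 'k coeffs poly fract) = 0"
      then have "of_nat 3 = (0 :: 'k coeffs poly fract)" by simp
      then have "Fract (of_nat 3) 1 = (Fract 0 1 :: 'k coeffs poly fract)"
        by (simp only: of_nat_fract Zero_fract_def)
      then have "of_nat 3 = (0 :: 'k coeffs poly)" using eq_fract(1)[of "1 :: 'k coeffs poly" 1 "of_nat 3" 0] by simp
      then show False by (simp only: of_nat_eq_0_iff)
    qed
    show "\<exists>a\<in>K. rot_fract a \<noteq> a" 
      using K(1) i by (intro bexI[of _ "lin i"] rot_lin_ne) (rule subsetD, assumption, rule imageI)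
    show "rot_fract a \<in> K" if "a \<in> K" for a using K(4) that by blast
  qed (rule rot.fract_map_add rot.fract_map_mult rot.fract_map_1 rot_fract_cubed)+
  then show ?thesis using K(1,2) by blast
qed

section \<open>Cardinalities\<close>

context cyclic_cubic
begin

lemma card_polys:
  assumes inf: "infinite X" and K_le: "|K| \<le>o |X|"
  shows "|{p. \<forall>i. coeff p i \<in> K}| \<le>o |X|"
proof -
  define P where "P n = {p. (\<forall>i. coeff p i \<in> K) \<and> (\<forall>i\<ge>n. coeff p i = 0)}" for n
  have "|P n| \<le>o |X|" for n
  proof (induction n)
    case 0
    have "P 0 \<subseteq> {0}" unfolding P_def by (auto simp: poly_eq_iff)
    then have "finite (P 0)" by (rule finite_subset) simp
    then show ?case using inf by (rule finite_card_le)
  next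
    case (Suc n)
    have "P (Suc n) \<subseteq> (\<lambda>(a, p). pCons a p) ` (K \<times> P n)"
    proof
      fix p assume p: "p \<in> P (Suc n)"
      obtain a q where q: "p = pCons a q" by (cases p)
      have "a \<in> K" "\<forall>i. coeff q i \<in> K" using p unfolding P_def q using coeffs_in_K_pCons by blast+
      moreover have "\<forall>i\<ge>n. coeff q i = 0"
      proof (intro allI impI)
        fix i assume "n \<le> i"
        then have "coeff p (Suc i) = 0" using p unfolding P_def by simp
        then show "coeff q i = 0" by (simp add: q)
      qed
      ultimately show "p \<in> (\<lambda>(a, p). pCons a p) ` (K \<times> P n)"
        unfolding q P_def by (intro image_eqI[of _ _ "(a, q)"]) simp_all
    qed
    then have "|P (Suc n)| \<le>o |(\<lambda>(a, p). pCons a p) ` (K \<times> P n)|" by (rule card_of_mono1)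
    then show ?case using card_of_Times_image_le[OF inf K_le Suc] by (rule ordLeq_transitive)
  qed
  then have "|\<Union>n. P n| \<le>o |X|" by (rule nat_UN_card_le[OF inf])
  moreover have "{p. \<forall>i. coeff p i \<in> K} \<subseteq> (\<Union>n. P n)"
  proof
    fix p assume "p \<in> {p. \<forall>i. coeff p i \<in> K}"
    then have "p \<in> P (Suc (degree p))" unfolding P_def by (auto simp: coeff_eq_0)
    then show "p \<in> (\<Union>n. P n)" by blast
  qed
  ultimately show ?thesis using card_of_mono1 ordLeq_transitive by blast
qed

lemma card_vertices:
  assumes "infinite X" "|K| \<le>o |X|" shows "|vertices building| \<le>o |X|"
proof -
  have "vertices building \<subseteq> (\<lambda>p. cls (act p ` V)) ` {p. \<forall>i. coeff p i \<in> K}"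
    using transitive unfolding reached_def inverse_pair_def by blast
  then have "|vertices building| \<le>o |{p. \<forall>i. coeff p i \<in> K}|" by (rule surj_imp_ordLeq)
  then show ?thesis using card_polys[OF assms] by (rule ordLeq_transitive)
qed

lemma A2_tilde_group_exists:
  fixes \<iota> :: "'a fls set set \<Rightarrow> 'k"
  assumes "inj_on \<iota> (vertices building)"
  shows "\<exists>(G :: 'k monoid) (\<Delta> :: 'k set set) \<phi>. A2_tilde_group G \<Delta> \<phi> \<and>
    (\<forall>v\<in>vertices \<Delta>. |vertices (link \<Delta> v)| =o |vertices (link building (cls V))| )"
proof (rule simply_transitive_A2_tilde_group[where H = "{on_class (act p) | p. \<exists>q m. inverse_pair p q m}" and \<tau> = vertex_type])
  show "A2_tilde_building building" by (rule is_A2_tilde_building[OF base])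
  show "thick building" by (rule thick_building)
  show "type_function building vertex_type" by (rule type_function_vertex_type)
  show "cls V \<in> vertices building" by (rule cls_V_vertex)
  show "inj_on \<iota> (vertices building)" by (rule assms)
next
  fix h assume "h \<in> {on_class (act p) | p. \<exists>q m. inverse_pair p q m}"
  then obtain p q m where h: "h = on_class (act p)" and pq: "inverse_pair p q m" by blast
  show "complex_iso h building building" unfolding h by (rule on_class_iso[OF pq])
  show "type_rotating building vertex_type h" unfolding h by (rule type_rotating_on_class[OF frame_map_act[OF pq]])
  show "\<exists>h'\<in>{on_class (act p) | p. \<exists>q m. inverse_pair p q m}. \<forall>v\<in>vertices building. h' (h v) = v"
    using on_class_inverse_pair[OF inverse_pair_sym[OF pq]] inverse_pair_sym[OF pq] unfolding h by blast
  show "h v = v" if "h (cls V) = cls V" "v \<in> vertices building" for v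
    using stabilizer_trivial[OF pq _ that(2)] that(1) unfolding h on_class_cls_V[OF pq] by blast
  fix h' assume "h' \<in> {on_class (act p) | p. \<exists>q m. inverse_pair p q m}"
  then obtain p' q' m' where h': "h' = on_class (act p')" and pq': "inverse_pair p' q' m'" by blast
  have "h \<circ> h' = on_class (act (skew_mult p p'))"
    unfolding h h' by (simp add: fun_eq_iff on_class_def image_image act_skew_mult)
  then show "h \<circ> h' \<in> {on_class (act p) | p. \<exists>q m. inverse_pair p q m}"
    using inverse_pair_skew_mult[OF pq pq'] by blast
next
  fix v assume "v \<in> vertices building"
  then obtain p q m where "inverse_pair p q m" "v = cls (act p ` V)" using transitive unfolding reached_def by blast
  then show "\<exists>h\<in>{on_class (act p) | p. \<exists>q m. inverse_pair p q m}. h (cls V) = v" using on_class_cls_V by blast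
qed

end

theorem theorem1p4:
  fixes \<kappa> :: "'k rel"
  assumes "Cinfinite \<kappa>"
  shows "\<exists>(G :: 'k monoid) (\<Delta> :: 'k set set) (\<phi> :: 'k \<Rightarrow> 'k \<Rightarrow> 'k).
           A2_tilde_group G \<Delta> \<phi> \<and> (\<forall>v\<in>vertices \<Delta>. |vertices (link \<Delta> v)| =o \<kappa>)"
proof -
  define X where "X = Field \<kappa>"
  have inf: "infinite X" and X: "|X| =o \<kappa>"
    using assms card_of_Field_ordIso by (auto simp: X_def cinfinite_def)
  obtain K where K: "cyclic_cubic K (rot_fract :: 'k coeffs poly fract \<Rightarrow> _)" "|K| \<le>o |X|" "lin ` X \<subseteq> K"
    using cyclic_cubic_exists[OF inf] by blast
  interpret C: cyclic_cubic K "rot_fract :: 'k coeffs poly fract \<Rightarrow> _" by (rule K(1))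
  \<comment> \<open>This bound serves twice: it provides the injection of the vertices into
    \<open>'k\<close>, and it bounds the link from above.\<close>
  have vert: "|vertices C.building| \<le>o |X|" by (rule C.card_vertices[OF inf K(2)])
  then obtain \<iota> :: "_ \<Rightarrow> 'k" where \<iota>: "inj_on \<iota> (vertices C.building)"
    unfolding card_of_ordLeq[symmetric] by blast
  obtain G :: "'k monoid" and \<Delta> :: "'k set set" and \<phi> where G: "A2_tilde_group G \<Delta> \<phi>"
    "\<forall>v\<in>vertices \<Delta>. |vertices (link \<Delta> v)| =o |vertices (link C.building (cls C.V))|"
    using C.A2_tilde_group_exists[OF \<iota>] by blast
  have linK: "lin i \<in> K" if "i \<in> X" for i using K(3) that by blast
  have "inj_on (\<lambda>i. C.line (lin i)) X"
  proof (rule inj_onI)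
    fix i j assume "i \<in> X" "j \<in> X" "C.line (lin i) = C.line (lin j)"
    then have "lin j / lin i \<in> C.k0" by (intro C.line_inj linK lin_nonzero)
    then have "rot_fract (lin j / lin i) = lin j / lin i" by (simp only: C.k0_def mem_Collect_eq)
    then show "i = j" by (rule rot_lin_quotient)
  qed
  moreover have "(\<lambda>i. C.line (lin i)) ` X \<subseteq> vertices (link C.building (cls C.V))"
    by (rule image_subsetI) (intro C.line_in_link linK lin_nonzero)
  ultimately have lower: "|X| \<le>o |vertices (link C.building (cls C.V))|"
    unfolding card_of_ordLeq[symmetric] by blast
  have "vertices (link C.building (cls C.V)) \<subseteq> vertices C.building" by (auto simp: link_def)
  then have "|vertices (link C.building (cls C.V))| \<le>o |X|"
    by (rule ordLeq_transitive[OF card_of_mono1 vert])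
  then have "|vertices (link C.building (cls C.V))| =o |X|" using lower by (simp add: ordIso_iff_ordLeq)
  then have "|vertices (link C.building (cls C.V))| =o \<kappa>" using X by (rule ordIso_transitive)
  then have "|vertices (link \<Delta> v)| =o \<kappa>" if "v \<in> vertices \<Delta>" for v
    by (rule ordIso_transitive[OF bspec[OF G(2) that]])
  then show ?thesis using G(1) by (intro exI conjI ballI)
qed

end
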